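(* Let $L>0$, $c\in L^\infty(0,L)$ and $D>0$. The one-dimensional reaction-diffusion equation with delayed boundary control $$y_t=y_{xx}+c(x)y,\qquad y(t,0)=0,\qquad y(t,L)=u_D(t)=u(t-D),\qquad y(0,\cdot)=y_0\in L^2(0,L),$$ is exponentially stabilizable, with a feedback that is built from a finite-dimensional linear control system with input delay. More precisely, with the feedback defined by $u_D(0)=0$, $u_D'(t)=\alpha(t-D)$ for $t>0$, and $$\alpha(t)=\begin{cases}0 & \text{if } t<D,\\ K_1(D)X_1(t)+K_1(D)\displaystyle\int_{\max(t-D,D)}^t e^{(t-D-s)A_1}B_1\alpha(s)\,ds & \text{if } t\ge D,\end{cases}$$ (where $X_1$, $A_1$, $B_1$, $K_1(D)$ are defined in the context), the function $t\mapsto\|y(t,\cdot)\|_{H^1(0,L)}$ converges exponentially to $0$ as $t\to+\infty$; that is, there exists $\mu>0$ such that for every $y_0\in L^2(0,L)$ there is a constant $C>0$ with $\|y(t,\cdot)\|_{H^1(0,L)}\le Ce^{-\mu t}$ for all sufficiently large $t$.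
   Context: Let $A=\partial_{xx}+c(\cdot)\,\mathrm{id}$ on $D(A)=H^2(0,L)\cap H^1_0(0,L)$, a self-adjoint operator on $L^2(0,L)$ with compact resolvent. Let $(e_j)_{j\ge1}$ be a Hilbert basis of $L^2(0,L)$ consisting of eigenfunctions of $A$, with eigenvalues $\lambda_1>\lambda_2>\cdots$, $\lambda_j\to-\infty$. Let $n$ be the number of nonnegative eigenvalues. Put $a(x)=\frac{x}{L}c(x)$, $b(x)=-\frac{x}{L}$, $a_j=\langle a,e_j\rangle_{L^2(0,L)}$, $b_j=\langle b,e_j\rangle_{L^2(0,L)}$. Set $w(t,x)=y(t,x)-\frac{x}{L}u_D(t)$, so that $w_t=Aw+a\,u_D+b\,u_D'$, $w(t,0)=w(t,L)=0$, $w(0,\cdot)=y_0$; the solution $y$ is understood through the (mild) solution $w$ of this equation. Put $w_j(t)=\langle w(t,\cdot),e_j\rangle_{L^2(0,L)}$ and $$X_1(t)=\begin{pmatrix}u_D(t)\\ w_1(t)\\ \vdots\\ w_n(t)\end{pmatrix},\quad A_1=\begin{pmatrix}0&0&\cdots&0\\ a_1&\lambda_1&\cdots&0\\ \vdots&\vdots&\ddots&\vdots\\ a_n&0&\cdots&\lambda_n\end{pmatrix},\quad B_1=\begin{pmatrix}1\\ b_1\\ \vdots\\ b_n\end{pmatrix}.$$ Thus $X_1'(t)=A_1X_1(t)+B_1\alpha(t-D)$, which is the finite-dimensional linear control system with input delay. $K_1(D)$ is a $1\times(n+1)$ real matrix such that $A_1+e^{-DA_1}B_1K_1(D)$ has $-1$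 as an eigenvalue of algebraic multiplicity $n+1$; such a matrix exists (this is part of what makes the feedback available). *)

theory Defs
  imports "HOL-Analysis.Analysis" "Jordan_Normal_Form.Char_Poly"
begin

unbundle no vec_syntax

section \<open>Lebesgue and Sobolev spaces on the interval $(0,L)$\<close>

text \<open>
  Elements of $L^2(0,L)$ are represented by functions \<open>real \<Rightarrow> real\<close>. Only their values on $(0,L)$
  matter, and equality is equality almost everywhere on $(0,L)$.
\<close>

definition L2 :: "real \<Rightarrow> (real \<Rightarrow> real) set" where
  "L2 L = {f. f \<in> borel_measurable (lebesgue_on {0<..<L}) \<and>
              integrable (lebesgue_on {0<..<L}) (\<lambda>x. (f x)\<^sup>2)}"

definition L2_inner :: "real \<Rightarrow> (real \<Rightarrow> real) \<Rightarrow> (real \<Rightarrow> real) \<Rightarrow> real" where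
  "L2_inner L f g = (LINT x|lebesgue_on {0<..<L}. f x * g x)"

definition L2_norm :: "real \<Rightarrow> (real \<Rightarrow> real) \<Rightarrow> real" where
  "L2_norm L f = sqrt (L2_inner L f f)"

definition L2_eq :: "real \<Rightarrow> (real \<Rightarrow> real) \<Rightarrow> (real \<Rightarrow> real) \<Rightarrow> bool" where
  "L2_eq L f g \<longleftrightarrow> (AE x in lebesgue_on {0<..<L}. f x = g x)"

definition L_infty :: "real \<Rightarrow> (real \<Rightarrow> real) set" where
  "L_infty L = {f. f \<in> borel_measurable (lebesgue_on {0<..<L}) \<and>
                   (\<exists>M. AE x in lebesgue_on {0<..<L}. \<bar>f x\<bar> \<le> M)}"

text \<open>$C_c^\infty(0,L)$, extended by zero to the real line.\<close>

definition test_functions :: "real \<Rightarrow> (real \<Rightarrow> real) set" where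
  "test_functions L = {\<phi>. (\<forall>k. (deriv ^^ k) \<phi> differentiable_on UNIV) \<and>
                          (\<exists>K. compact K \<and> K \<subseteq> {0<..<L} \<and> (\<forall>x. x \<notin> K \<longrightarrow> \<phi> x = 0))}"

definition weak_deriv :: "real \<Rightarrow> (real \<Rightarrow> real) \<Rightarrow> (real \<Rightarrow> real) \<Rightarrow> bool" where
  "weak_deriv L f g \<longleftrightarrow> f \<in> L2 L \<and> g \<in> L2 L \<and>
     (\<forall>\<phi>\<in>test_functions L. L2_inner L f (deriv \<phi>) = - L2_inner L g \<phi>)"

definition H1 :: "real \<Rightarrow> (real \<Rightarrow> real) set" where
  "H1 L = {f. \<exists>g. weak_deriv L f g}"

text \<open>The weak derivative is unique almost everywhere, so the choice below does not affect the norm.\<close>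

definition H1_norm :: "real \<Rightarrow> (real \<Rightarrow> real) \<Rightarrow> real" where
  "H1_norm L f = sqrt ((L2_norm L f)\<^sup>2 + (L2_norm L (SOME g. weak_deriv L f g))\<^sup>2)"

definition H10 :: "real \<Rightarrow> (real \<Rightarrow> real) set" where
  "H10 L = {f \<in> H1 L. \<forall>\<epsilon>>0. \<exists>\<phi>\<in>test_functions L. H1_norm L (\<lambda>x. f x - \<phi> x) < \<epsilon>}"

text \<open>Orthonormal with dense linear span; the index set is $\{1,2,\dots\}$, so \<open>e 0\<close> is never used.\<close>

definition hilbert_basis :: "real \<Rightarrow> (nat \<Rightarrow> real \<Rightarrow> real) \<Rightarrow> bool" where
  "hilbert_basis L e \<longleftrightarrow>
     (\<forall>j\<ge>1. e j \<in> L2 L) \<and>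
     (\<forall>i\<ge>1. \<forall>j\<ge>1. L2_inner L (e i) (e j) = (if i = j then 1 else 0)) \<and>
     (\<forall>f\<in>L2 L. \<forall>\<epsilon>>0. \<exists>N r. L2_norm L (\<lambda>x. f x - (\<Sum>j=1..N. r j * e j x)) < \<epsilon>)"


section \<open>The operator $A$, its semigroup, and mild solutions\<close>

text \<open>
  The graph of the unbounded operator: \<open>A_graph L c f g\<close> says that
  $f \in D(A) = H^2(0,L) \cap H^1_0(0,L)$ and $g = A f = f'' + c f$ in $L^2(0,L)$.
\<close>

definition A_graph :: "real \<Rightarrow> (real \<Rightarrow> real) \<Rightarrow> (real \<Rightarrow> real) \<Rightarrow> (real \<Rightarrow> real) \<Rightarrow> bool" where
  "A_graph L c f g \<longleftrightarrow> f \<in> H10 L \<and>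
     (\<exists>f' f''. weak_deriv L f f' \<and> weak_deriv L f' f'' \<and>
               L2_eq L g (\<lambda>x. f'' x + c x * f x))"

definition C0_semigroup :: "real \<Rightarrow> (real \<Rightarrow> (real \<Rightarrow> real) \<Rightarrow> (real \<Rightarrow> real)) \<Rightarrow> bool" where
  "C0_semigroup L S \<longleftrightarrow>
     (\<forall>t\<ge>0. \<forall>f\<in>L2 L. S t f \<in> L2 L) \<and>
     (\<forall>t\<ge>0. \<forall>f\<in>L2 L. \<forall>g\<in>L2 L. \<forall>p q.
        L2_eq L (S t (\<lambda>x. p * f x + q * g x)) (\<lambda>x. p * S t f x + q * S t g x)) \<and>
     (\<forall>t\<ge>0. \<exists>M. \<forall>f\<in>L2 L. L2_norm L (S t f) \<le> M * L2_norm L f) \<and>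
     (\<forall>f\<in>L2 L. L2_eq L (S 0 f) f) \<and>
     (\<forall>s\<ge>0. \<forall>t\<ge>0. \<forall>f\<in>L2 L. L2_eq L (S (s + t) f) (S s (S t f))) \<and>
     (\<forall>f\<in>L2 L. ((\<lambda>t. L2_norm L (\<lambda>x. S t f x - f x)) \<longlongrightarrow> 0) (at_right 0))"

definition generated_by_A ::
  "real \<Rightarrow> (real \<Rightarrow> real) \<Rightarrow> (real \<Rightarrow> (real \<Rightarrow> real) \<Rightarrow> (real \<Rightarrow> real)) \<Rightarrow> bool" where
  "generated_by_A L c S \<longleftrightarrow>
     (\<forall>f\<in>L2 L. \<forall>g\<in>L2 L. A_graph L c f g \<longleftrightarrow>
        ((\<lambda>h. L2_norm L (\<lambda>x. (S h f x - f x) / h - g x)) \<longlongrightarrow> 0) (at_right 0))"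

text \<open>
  The integral $I = \int_J F(s)\,ds$ of an $L^2(0,L)$-valued function, determined by its inner
  products with all elements of $L^2(0,L)$. It agrees with the Bochner integral whenever $F$ is
  Bochner integrable.
\<close>

definition has_L2_integral ::
  "real \<Rightarrow> (real \<Rightarrow> real \<Rightarrow> real) \<Rightarrow> (real \<Rightarrow> real) \<Rightarrow> real set \<Rightarrow> bool" where
  "has_L2_integral L F I J \<longleftrightarrow> I \<in> L2 L \<and> (\<forall>s\<in>J. F s \<in> L2 L) \<and>
     (\<forall>v\<in>L2 L. integrable (lebesgue_on J) (\<lambda>s. L2_inner L (F s) v) \<and>
               L2_inner L I v = (LINT s|lebesgue_on J. L2_inner L (F s) v))"

text \<open>
  Mild solution $w \in C([0,\infty); L^2(0,L))$ of $w_t = A w + f$, $w(0,\cdot) = w_0$, that is,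
  $w(t) = S(t) w_0 + \int_0^t S(t-s) f(s)\,ds$ with $S(t) = e^{tA}$.
\<close>

definition mild_solution ::
  "real \<Rightarrow> (real \<Rightarrow> real) \<Rightarrow> (real \<Rightarrow> real \<Rightarrow> real) \<Rightarrow> (real \<Rightarrow> real) \<Rightarrow> (real \<Rightarrow> real \<Rightarrow> real) \<Rightarrow> bool" where
  "mild_solution L c f w0 w \<longleftrightarrow>
     (\<forall>t\<ge>0. w t \<in> L2 L) \<and>
     (\<forall>t\<ge>0. ((\<lambda>s. L2_norm L (\<lambda>x. w s x - w t x)) \<longlongrightarrow> 0) (at t within {0..})) \<and>
     (\<exists>S. C0_semigroup L S \<and> generated_by_A L c S \<and>
        (\<forall>t\<ge>0. has_L2_integral L (\<lambda>s. S (t - s) (f s)) (\<lambda>x. w t x - S t w0 x) {0..t}))"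


section \<open>The finite-dimensional system and the feedback\<close>

definition a_fun :: "real \<Rightarrow> (real \<Rightarrow> real) \<Rightarrow> real \<Rightarrow> real" where
  "a_fun L c x = x / L * c x"

definition b_fun :: "real \<Rightarrow> real \<Rightarrow> real" where
  "b_fun L x = - x / L"

definition num_nonneg :: "(nat \<Rightarrow> real) \<Rightarrow> nat" where
  "num_nonneg lam = card {j. 1 \<le> j \<and> 0 \<le> lam j}"

definition mat_exp :: "real mat \<Rightarrow> real mat" where
  "mat_exp M = mat (dim_row M) (dim_row M) (\<lambda>(i, j). \<Sum>k. (M ^\<^sub>m k) $$ (i, j) / fact k)"

text \<open>Row and column $0$ belong to $u_D$; row and column $j \ge 1$ belong to $w_j$.\<close>

definition A1 :: "real \<Rightarrow> (real \<Rightarrow> real) \<Rightarrow> (nat \<Rightarrow> real \<Rightarrow> real) \<Rightarrow> (nat \<Rightarrow> real) \<Rightarrow> real mat" where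
  "A1 L c e lam = mat (num_nonneg lam + 1) (num_nonneg lam + 1)
     (\<lambda>(i, j). if i = 0 then 0
               else if j = 0 then L2_inner L (a_fun L c) (e i)
               else if i = j then lam i else 0)"

definition B1 :: "real \<Rightarrow> (nat \<Rightarrow> real \<Rightarrow> real) \<Rightarrow> (nat \<Rightarrow> real) \<Rightarrow> real mat" where
  "B1 L e lam = mat (num_nonneg lam + 1) 1
     (\<lambda>(i, j). if i = 0 then 1 else L2_inner L (b_fun L) (e i))"

definition X1 :: "real \<Rightarrow> (nat \<Rightarrow> real \<Rightarrow> real) \<Rightarrow> (nat \<Rightarrow> real) \<Rightarrow>
    (real \<Rightarrow> real) \<Rightarrow> (real \<Rightarrow> real \<Rightarrow> real) \<Rightarrow> real \<Rightarrow> real Matrix.vec" where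
  "X1 L e lam uD w t = Matrix.vec (num_nonneg lam + 1)
     (\<lambda>i. if i = 0 then uD t else L2_inner L (w t) (e i))"

definition admissible_gain :: "real \<Rightarrow> real \<Rightarrow> (real \<Rightarrow> real) \<Rightarrow> (nat \<Rightarrow> real \<Rightarrow> real) \<Rightarrow>
    (nat \<Rightarrow> real) \<Rightarrow> real mat \<Rightarrow> bool" where
  "admissible_gain L D c e lam K1 \<longleftrightarrow>
     K1 \<in> carrier_mat 1 (num_nonneg lam + 1) \<and>
     Polynomial.order (-1) (char_poly (A1 L c e lam +
        mat_exp ((- D) \<cdot>\<^sub>m A1 L c e lam) * B1 L e lam * K1)) = num_nonneg lam + 1"

text \<open>The vector $\int_{\max(t-D,D)}^t e^{(t-D-s)A_1} B_1 \alpha(s)\,ds$, integrated entry by entry.\<close>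

definition delay_integral :: "real \<Rightarrow> real \<Rightarrow> (real \<Rightarrow> real) \<Rightarrow> (nat \<Rightarrow> real \<Rightarrow> real) \<Rightarrow>
    (nat \<Rightarrow> real) \<Rightarrow> (real \<Rightarrow> real) \<Rightarrow> real \<Rightarrow> real Matrix.vec" where
  "delay_integral L D c e lam \<alpha> t = Matrix.vec (num_nonneg lam + 1)
     (\<lambda>i. LINT s|lebesgue_on {max (t - D) D..t}.
            (mat_exp ((t - D - s) \<cdot>\<^sub>m A1 L c e lam) * B1 L e lam) $$ (i, 0) * \<alpha> s)"

text \<open>
  The closed loop. The control $u$ lives on $[-D,\infty)$ and $u_D(t) = u(t-D)$. Since $\alpha$ jumps
  at time $D$, the conditions $u_D(0) = 0$, $u_D'(t) = \alpha(t-D)$ are understood in the absolutely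
  continuous sense, i.e. in integrated form. The solution $y$ is the function for which
  $w(t,x) = y(t,x) - \frac{x}{L} u_D(t)$ is a mild solution of $w_t = A w + a u_D + b u_D'$,
  $w(0,\cdot) = y_0$.
\<close>

definition closed_loop_solution :: "real \<Rightarrow> real \<Rightarrow> (real \<Rightarrow> real) \<Rightarrow> (nat \<Rightarrow> real \<Rightarrow> real) \<Rightarrow>
    (nat \<Rightarrow> real) \<Rightarrow> real mat \<Rightarrow> (real \<Rightarrow> real) \<Rightarrow>
    (real \<Rightarrow> real) \<Rightarrow> (real \<Rightarrow> real) \<Rightarrow> (real \<Rightarrow> real \<Rightarrow> real) \<Rightarrow> bool" where
  "closed_loop_solution L D c e lam K1 y0 u \<alpha> y \<longleftrightarrow>
     (let uD = (\<lambda>t. u (t - D));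
          w = (\<lambda>t x. y t x - x / L * uD t)
      in (\<forall>t. integrable (lebesgue_on {-D..t}) \<alpha>) \<and>
         (\<forall>t\<ge>0. uD t = (LINT s|lebesgue_on {0..t}. \<alpha> (s - D))) \<and>
         mild_solution L c (\<lambda>t x. a_fun L c x * uD t + b_fun L x * \<alpha> (t - D)) y0 w \<and>
         (\<forall>t. \<alpha> t = (if t < D then 0
                     else (K1 *\<^sub>v X1 L e lam uD w t) $ 0
                        + (K1 *\<^sub>v delay_integral L D c e lam \<alpha> t) $ 0)))"

end

theory Submission
  imports Defs "Jordan_Normal_Form.Schur_Decomposition"
begin

text \<open>
  In the eigenbasis, \<open>w\<close> splits into scalar equations driven by \<open>u\<^sub>D\<close> and \<open>\<alpha>\<close>. The modes with
  nonnegative eigenvalues, together with \<open>u\<^sub>D\<close>, form the delayed system \<open>X\<^sub>1\<close>. The feedback is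
  \<open>\<alpha> = K\<^sub>1 Z\<close> with the Artstein transform
  \<open>Z t = X\<^sub>1 t + \<integral> e\<^bsup>(t - D - s) A\<^sub>1\<^esup> B\<^sub>1 \<alpha> s ds\<close>, and \<open>Z\<close> solves the undelayed equation
  \<open>Z' = (A\<^sub>1 + e\<^bsup>- D A\<^sub>1\<^esup> B\<^sub>1 K\<^sub>1) Z\<close>, whose matrix has the single eigenvalue \<open>-1\<close>. So \<open>Z\<close>, hence
  \<open>\<alpha>\<close>, \<open>u\<^sub>D\<close> and \<open>X\<^sub>1\<close>, decay exponentially. The remaining modes are stable and driven by a
  decaying input, and parabolic smoothing makes \<open>\<Sum> (1 + \<bar>\<lambda>\<^sub>j\<bar>) w\<^sub>j\<^sup>2\<close>, which controls the
  \<open>H\<^sup>1\<close> norm, decay as well.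

  The gain exists because \<open>a\<^sub>j + \<lambda>\<^sub>j b\<^sub>j = - (1/L) \<integral> x e\<^sub>j'' = - e\<^sub>j' L\<close>, and this is nonzero: a
  solution of the second order equation with \<open>e\<^sub>j L = e\<^sub>j' L = 0\<close> vanishes.
\<close>

section \<open>The Hilbert space $L^2(0,L)$\<close>

text \<open>Three features of the definitions shape the proof. \<open>mild_solution\<close> asks for
  some semigroup generated by A, so decay has to be shown for every such semigroup: its action on
  Fourier coefficients turns out to be forced, and each mode becomes an explicit scalar formula.
  \<open>H10\<close> is a closure and carries no boundary values, so a trace is found to vanish by
  comparing integration by parts with boundary terms to integration by parts in \<open>H10\<close>.
  And \<open>\<alpha>\<close> is merely locally integrable; the feedback law itself makes it
  continuous from D on, and only then can Z be differentiated. Existence does not iterate the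
  feedback law: the equation for Z is solved on the whole line, the control is read off as K_1 Z,
  and the law is verified afterwards. Two losses in the rates are deliberate. Z is shown to decay
  like exp (- t / 2), not exp (- t), which swallows the polynomial factors of Jordan blocks. In the
  tail half of each eigenvalue is given up; what remains yields a factor 1 / |la j| that pays for
  the weight 1 + |la j|.\<close>

lemma finite_measure_interval: "finite_measure (lebesgue_on {0<..<L::real})"
  by (rule finite_measure_lebesgue_on) auto

lemma L2_measurable: "f \<in> L2 L \<Longrightarrow> f \<in> borel_measurable (lebesgue_on {0<..<L})"
  by (simp add: L2_def)

lemma L2_mult_integrable:
  assumes "f \<in> L2 L" "g \<in> L2 L"
  shows "integrable (lebesgue_on {0<..<L}) (\<lambda>x. f x * g x)"
proof (rule Bochner_Integration.integrable_bound[where f = "\<lambda>x. (f x)\<^sup>2 + (g x)\<^sup>2"])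
  show "integrable (lebesgue_on {0<..<L}) (\<lambda>x. (f x)\<^sup>2 + (g x)\<^sup>2)"
    using assms by (auto simp: L2_def)
  show "(\<lambda>x. f x * g x) \<in> borel_measurable (lebesgue_on {0<..<L})"
    using assms by (auto simp: L2_def)
  have "\<bar>u * v\<bar> \<le> u\<^sup>2 + v\<^sup>2" for u v :: real
  proof -
    have "0 \<le> (\<bar>u\<bar> - \<bar>v\<bar>)\<^sup>2" by simp
    then have "2 * (\<bar>u\<bar> * \<bar>v\<bar>) \<le> u\<^sup>2 + v\<^sup>2"
      by (simp add: power2_eq_square algebra_simps)
    moreover have "0 \<le> \<bar>u\<bar> * \<bar>v\<bar>" by simp
    ultimately show ?thesis unfolding abs_mult by linarith
  qed
  then show "AE x in lebesgue_on {0<..<L}. norm (f x * g x) \<le> norm ((f x)\<^sup>2 + (g x)\<^sup>2)"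
    by (intro always_eventually) auto
qed

lemma L2_zero [simp, intro]: "(\<lambda>x. 0) \<in> L2 L"
  by (simp add: L2_def)

lemma L2_scale [intro]: "f \<in> L2 L \<Longrightarrow> (\<lambda>x. r * f x) \<in> L2 L"
  by (auto simp: L2_def power_mult_distrib)

lemma L2_add [intro]:
  assumes "f \<in> L2 L" "g \<in> L2 L"
  shows "(\<lambda>x. f x + g x) \<in> L2 L"
proof -
  have "integrable (lebesgue_on {0<..<L}) (\<lambda>x. (f x)\<^sup>2 + (g x)\<^sup>2 + 2 * (f x * g x))"
    using assms L2_mult_integrable[OF assms] by (auto simp: L2_def)
  then show ?thesis
    using assms by (auto simp: L2_def power2_sum algebra_simps)
qed

lemma L2_minus [intro]: "f \<in> L2 L \<Longrightarrow> (\<lambda>x. - f x) \<in> L2 L"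
  using L2_scale[of f L "-1"] by simp

lemma L2_diff [intro]:
  assumes "f \<in> L2 L" "g \<in> L2 L"
  shows "(\<lambda>x. f x - g x) \<in> L2 L"
  using L2_add[OF assms(1) L2_minus[OF assms(2)]] by simp

lemma L2_sum [intro]: "(\<And>i. i \<in> I \<Longrightarrow> f i \<in> L2 L) \<Longrightarrow> (\<lambda>x. \<Sum>i\<in>I. f i x) \<in> L2 L"
  by (induction I rule: infinite_finite_induct) auto

lemma L2_bounded:
  assumes "f \<in> borel_measurable (lebesgue_on {0<..<L})" "AE x in lebesgue_on {0<..<L}. \<bar>f x\<bar> \<le> M"
  shows "f \<in> L2 L"
proof -
  interpret finite_measure "lebesgue_on {0<..<L}" by (rule finite_measure_interval)
  have "integrable (lebesgue_on {0<..<L}) (\<lambda>x. (f x)\<^sup>2)"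
  proof (rule integrable_const_bound[where B = "M\<^sup>2"])
    show "AE x in lebesgue_on {0<..<L}. norm ((f x)\<^sup>2) \<le> M\<^sup>2"
      using assms(2) by eventually_elim (auto simp: abs_le_square_iff[symmetric])
  qed (use assms in measurable)
  then show ?thesis using assms by (simp add: L2_def)
qed

lemma L2_const [simp, intro]: "(\<lambda>x. r) \<in> L2 L"
  by (rule L2_bounded[where M = "\<bar>r\<bar>"]) auto

lemma continuous_measurable_interval:
  assumes "continuous_on UNIV (f :: real \<Rightarrow> real)"
  shows "f \<in> borel_measurable (lebesgue_on S)"
  using borel_measurable_continuous_onI[OF assms]
  by (simp add: borel_measurable_if_D measurable_completion measurable_restrict_space1)

lemma L2_continuous:
  assumes "continuous_on UNIV f"
  shows "f \<in> L2 L"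
proof -
  have "bounded (f ` {0..L})"
    by (intro compact_imp_bounded compact_continuous_image continuous_on_subset[OF assms]) auto
  then obtain M where M: "\<And>x. x \<in> {0..L} \<Longrightarrow> \<bar>f x\<bar> \<le> M"
    unfolding bounded_iff by (metis imageI real_norm_def)
  show ?thesis
    by (rule L2_bounded[where M = M])
       (auto intro!: M continuous_measurable_interval assms AE_I2)
qed

lemma L2_integrable: "f \<in> L2 L \<Longrightarrow> integrable (lebesgue_on {0<..<L}) f"
  using L2_mult_integrable[of f L "\<lambda>_. 1"] by simp

lemma L_infty_mult_L2:
  assumes "c \<in> L_infty L" "f \<in> L2 L"
  shows "(\<lambda>x. c x * f x) \<in> L2 L"
proof -
  obtain M where M: "AE x in lebesgue_on {0<..<L}. \<bar>c x\<bar> \<le> M"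
    using assms by (auto simp: L_infty_def)
  have [measurable]: "c \<in> borel_measurable (lebesgue_on {0<..<L})"
    "f \<in> borel_measurable (lebesgue_on {0<..<L})"
    using assms by (auto simp: L_infty_def L2_def)
  have "integrable (lebesgue_on {0<..<L}) (\<lambda>x. (c x * f x)\<^sup>2)"
  proof (rule Bochner_Integration.integrable_bound[where f = "\<lambda>x. M\<^sup>2 * (f x)\<^sup>2"])
    show "integrable (lebesgue_on {0<..<L}) (\<lambda>x. M\<^sup>2 * (f x)\<^sup>2)"
      using assms by (auto simp: L2_def)
    show "AE x in lebesgue_on {0<..<L}. norm ((c x * f x)\<^sup>2) \<le> norm (M\<^sup>2 * (f x)\<^sup>2)"
      using M by eventually_elim
        (auto simp: power_mult_distrib abs_le_square_iff[symmetric] intro!: mult_right_mono)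
  qed simp
  then show ?thesis by (simp add: L2_def)
qed

section \<open>Inner product and norm\<close>

lemma L2_inner_commute: "L2_inner L f g = L2_inner L g f"
  by (simp add: L2_inner_def mult.commute)

lemma L2_inner_scale_left [simp]: "L2_inner L (\<lambda>x. r * f x) g = r * L2_inner L f g"
  by (simp add: L2_inner_def mult.assoc)

lemma L2_inner_scale_right [simp]: "L2_inner L g (\<lambda>x. r * f x) = r * L2_inner L g f"
  by (metis L2_inner_scale_left L2_inner_commute)

lemma L2_inner_zero_left [simp]: "L2_inner L (\<lambda>x. 0) g = 0"
  by (simp add: L2_inner_def)

lemma L2_inner_zero_right [simp]: "L2_inner L g (\<lambda>x. 0) = 0"
  by (simp add: L2_inner_def)

lemma L2_inner_add_left:
  assumes "f \<in> L2 L" "g \<in> L2 L" "h \<in> L2 L"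
  shows "L2_inner L (\<lambda>x. f x + g x) h = L2_inner L f h + L2_inner L g h"
  using L2_mult_integrable[OF assms(1,3)] L2_mult_integrable[OF assms(2,3)]
  by (simp add: L2_inner_def ring_distribs)

lemma L2_inner_diff_left:
  assumes "f \<in> L2 L" "g \<in> L2 L" "h \<in> L2 L"
  shows "L2_inner L (\<lambda>x. f x - g x) h = L2_inner L f h - L2_inner L g h"
  using L2_mult_integrable[OF assms(1,3)] L2_mult_integrable[OF assms(2,3)]
  by (simp add: L2_inner_def ring_distribs)

lemma L2_inner_add_right:
  assumes "f \<in> L2 L" "g \<in> L2 L" "h \<in> L2 L"
  shows "L2_inner L h (\<lambda>x. f x + g x) = L2_inner L h f + L2_inner L h g"
  by (metis L2_inner_add_left[OF assms] L2_inner_commute)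

lemma L2_inner_diff_right:
  assumes "f \<in> L2 L" "g \<in> L2 L" "h \<in> L2 L"
  shows "L2_inner L h (\<lambda>x. f x - g x) = L2_inner L h f - L2_inner L h g"
  by (metis L2_inner_diff_left[OF assms] L2_inner_commute)

lemma L2_inner_sum_left:
  assumes "\<And>i. i \<in> I \<Longrightarrow> f i \<in> L2 L" "h \<in> L2 L"
  shows "L2_inner L (\<lambda>x. \<Sum>i\<in>I. f i x) h = (\<Sum>i\<in>I. L2_inner L (f i) h)"
  using assms
  by (induction I rule: infinite_finite_induct) (auto simp: L2_inner_add_left L2_sum)

lemma L2_inner_sum_right:
  assumes "\<And>i. i \<in> I \<Longrightarrow> f i \<in> L2 L" "h \<in> L2 L"
  shows "L2_inner L h (\<lambda>x. \<Sum>i\<in>I. f i x) = (\<Sum>i\<in>I. L2_inner L h (f i))"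
  using L2_inner_sum_left[OF assms] by (simp add: L2_inner_commute)

lemma L2_inner_self_nonneg [simp]: "0 \<le> L2_inner L f f"
  by (simp add: L2_inner_def)

lemma L2_norm_nonneg [simp]: "0 \<le> L2_norm L f"
  by (simp add: L2_norm_def)

lemma L2_norm_power2: "(L2_norm L f)\<^sup>2 = L2_inner L f f"
  by (simp add: L2_norm_def)

lemma L2_norm_power2_LINT: "(L2_norm L f)\<^sup>2 = (LINT x|lebesgue_on {0<..<L}. (f x)\<^sup>2)"
  unfolding L2_norm_power2 L2_inner_def by (simp add: power2_eq_square)

lemma L2_norm_scale [simp]: "L2_norm L (\<lambda>x. r * f x) = \<bar>r\<bar> * L2_norm L f"
  by (simp add: L2_norm_def real_sqrt_mult flip: mult.assoc)

lemma L2_norm_minus [simp]: "L2_norm L (\<lambda>x. - f x) = L2_norm L f"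
  using L2_norm_scale[of L "-1" f] by simp

lemma L2_norm_zero [simp]: "L2_norm L (\<lambda>x. 0) = 0"
  by (simp add: L2_norm_def)

lemma L2_norm_diff_commute: "L2_norm L (\<lambda>x. f x - g x) = L2_norm L (\<lambda>x. g x - f x)"
  using L2_norm_minus[of L "\<lambda>x. f x - g x"] by simp

lemma L2_norm_power2_add:
  assumes "f \<in> L2 L" "g \<in> L2 L"
  shows "(L2_norm L (\<lambda>x. f x + g x))\<^sup>2 = (L2_norm L f)\<^sup>2 + 2 * L2_inner L f g + (L2_norm L g)\<^sup>2"
  using assms L2_inner_commute[of L g f]
  by (simp add: L2_norm_power2 L2_inner_add_left L2_inner_add_right L2_add)

lemma L2_Cauchy_Schwarz:
  assumes "f \<in> L2 L" "g \<in> L2 L"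
  shows "\<bar>L2_inner L f g\<bar> \<le> L2_norm L f * L2_norm L g"
proof -
  define A B C where "A = L2_inner L f f" and "B = L2_inner L f g" and "C = L2_inner L g g"
  have quad: "0 \<le> A + 2 * t * B + t\<^sup>2 * C" for t
  proof -
    have "0 \<le> (L2_norm L (\<lambda>x. f x + t * g x))\<^sup>2" by simp
    also have "\<dots> = A + 2 * t * B + t\<^sup>2 * C"
      using L2_norm_power2_add[OF assms(1) L2_scale[OF assms(2)], of t]
      unfolding L2_norm_power2 by (simp add: A_def B_def C_def power2_eq_square)
    finally show ?thesis .
  qed
  have "0 \<le> C" "0 \<le> A" by (simp_all add: C_def A_def)
  have "B\<^sup>2 \<le> A * C"
  proof (cases "C = 0")
    case True
    have "B = 0"
    proof (rule ccontr)
      assume "B \<noteq> 0"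
      \<comment> \<open>For \<open>C = 0\<close> the quadratic is affine in t, and at this t it
        would equal -1.\<close>
      with quad[of "- (A + 1) / (2 * B)"] True show False by (simp add: field_simps)
    qed
    then show ?thesis using True by simp
  next
    case False
    with \<open>0 \<le> C\<close> have "0 < C" by simp
    \<comment> \<open>The minimiser of the quadratic.\<close>
    from quad[of "- B / C"] have "0 \<le> A - B\<^sup>2 / C"
      using False by (simp add: power2_eq_square field_simps)
    then show ?thesis using \<open>0 < C\<close> by (simp add: field_simps)
  qed
  then have "sqrt (B\<^sup>2) \<le> sqrt (A * C)" by (rule real_sqrt_le_mono)
  then show ?thesis by (simp add: L2_norm_def A_def B_def C_def real_sqrt_mult)
qed

lemma L2_norm_triangle:
  assumes "f \<in> L2 L" "g \<in> L2 L"
  shows "L2_norm L (\<lambda>x. f x + g x) \<le> L2_norm L f + L2_norm L g"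
proof (rule power2_le_imp_le)
  show "(L2_norm L (\<lambda>x. f x + g x))\<^sup>2 \<le> (L2_norm L f + L2_norm L g)\<^sup>2"
    using L2_norm_power2_add[OF assms] L2_Cauchy_Schwarz[OF assms]
    by (simp add: power2_sum)
qed simp

lemma L2_norm_triangle3:
  assumes "f \<in> L2 L" "g \<in> L2 L" "h \<in> L2 L"
  shows "L2_norm L (\<lambda>x. f x - h x) \<le> L2_norm L (\<lambda>x. f x - g x) + L2_norm L (\<lambda>x. g x - h x)"
  using L2_norm_triangle[OF L2_diff[OF assms(1,2)] L2_diff[OF assms(2,3)]] by simp

lemma L2_eq_iff_norm:
  assumes "f \<in> L2 L" "g \<in> L2 L"
  shows "L2_eq L f g \<longleftrightarrow> L2_norm L (\<lambda>x. f x - g x) = 0"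
proof -
  have "integrable (lebesgue_on {0<..<L}) (\<lambda>x. (f x - g x)\<^sup>2)"
    using L2_diff[OF assms] by (simp add: L2_def)
  then have "(LINT x|lebesgue_on {0<..<L}. (f x - g x)\<^sup>2) = 0 \<longleftrightarrow>
      (AE x in lebesgue_on {0<..<L}. (f x - g x)\<^sup>2 = 0)"
    by (intro integral_nonneg_eq_0_iff_AE) auto
  then show ?thesis
    by (simp add: L2_eq_def L2_norm_def L2_inner_def power2_eq_square)
qed

lemma L2_inner_cong:
  assumes "f \<in> L2 L" "g \<in> L2 L" "h \<in> L2 L" "L2_eq L f g"
  shows "L2_inner L f h = L2_inner L g h"
  unfolding L2_inner_def
proof (rule integral_cong_AE)
  show "AE x in lebesgue_on {0<..<L}. f x * h x = g x * h x"
    using assms(4) unfolding L2_eq_def by eventually_elim simp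
qed (intro borel_measurable_integrable L2_mult_integrable assms)+

lemma L2_norm_cong:
  assumes "f \<in> L2 L" "g \<in> L2 L" "L2_eq L f g"
  shows "L2_norm L f = L2_norm L g"
proof -
  have "L2_inner L f f = L2_inner L g g"
    using L2_inner_cong[OF assms(1,2,1,3)] L2_inner_cong[OF assms(1,2,2,3)]
      L2_inner_commute[of L g f] by simp
  then show ?thesis by (simp add: L2_norm_def)
qed

text \<open>Cauchy-Schwarz makes the pairing continuous. The filter is arbitrary because the lemma
  serves both for sequences and for continuity in time.\<close>

lemma L2_inner_tendsto:
  assumes "\<forall>\<^sub>F n in F. f n \<in> L2 L" "g \<in> L2 L" "h \<in> L2 L"
    and "((\<lambda>n. L2_norm L (\<lambda>x. f n x - g x)) \<longlongrightarrow> 0) F"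
  shows "((\<lambda>n. L2_inner L (f n) h) \<longlongrightarrow> L2_inner L g h) F"
proof (rule Lim_transform2[OF tendsto_const], rule Lim_null_comparison)
  show "\<forall>\<^sub>F n in F. norm (L2_inner L g h - L2_inner L (f n) h)
      \<le> L2_norm L (\<lambda>x. f n x - g x) * L2_norm L h"
    using assms(1)
  proof eventually_elim
    case (elim n)
    then show ?case
      using L2_Cauchy_Schwarz[OF L2_diff[OF elim assms(2)] assms(3)] assms(2,3)
      by (simp add: L2_inner_diff_left abs_minus_commute)
  qed
  show "((\<lambda>n. L2_norm L (\<lambda>x. f n x - g x) * L2_norm L h) \<longlongrightarrow> 0) F"
    using tendsto_mult_left_zero[OF assms(4)] by simp
qed

lemma L2_norm_tendsto:
  assumes "\<forall>\<^sub>F n in F. f n \<in> L2 L" "g \<in> L2 L"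
    and "((\<lambda>n. L2_norm L (\<lambda>x. f n x - g x)) \<longlongrightarrow> 0) F"
  shows "((\<lambda>n. L2_norm L (f n)) \<longlongrightarrow> L2_norm L g) F"
proof (rule Lim_transform2[OF tendsto_const], rule Lim_null_comparison[OF _ assms(3)])
  show "\<forall>\<^sub>F n in F. norm (L2_norm L g - L2_norm L (f n)) \<le> L2_norm L (\<lambda>x. f n x - g x)"
    using assms(1)
  proof eventually_elim
    case (elim n)
    have "L2_norm L (f n) \<le> L2_norm L (\<lambda>x. f n x - g x) + L2_norm L g"
      using L2_norm_triangle[OF L2_diff[OF elim assms(2)] assms(2)] by simp
    moreover have "L2_norm L g \<le> L2_norm L (\<lambda>x. g x - f n x) + L2_norm L (f n)"
      using L2_norm_triangle[OF L2_diff[OF assms(2) elim] elim] by simp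
    ultimately show ?case
      using L2_norm_diff_commute[of L "f n" g] by auto
  qed
qed

lemma L2_norm_mult_L_infty:
  assumes "c \<in> L_infty L"
  shows "\<exists>M\<ge>0. \<forall>f\<in>L2 L. L2_norm L (\<lambda>x. c x * f x) \<le> M * L2_norm L f"
proof -
  obtain M where M: "AE x in lebesgue_on {0<..<L}. \<bar>c x\<bar> \<le> M"
    using assms by (auto simp: L_infty_def)
  have "L2_norm L (\<lambda>x. c x * f x) \<le> \<bar>M\<bar> * L2_norm L f" if f: "f \<in> L2 L" for f
  proof -
    have cf: "(\<lambda>x. c x * f x) \<in> L2 L" by (rule L_infty_mult_L2[OF assms(1) f])
    have "L2_inner L (\<lambda>x. c x * f x) (\<lambda>x. c x * f x) \<le> L2_inner L (\<lambda>x. M * f x) (\<lambda>x. M * f x)"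
      unfolding L2_inner_def
    proof (rule integral_mono_AE)
      show "AE x in lebesgue_on {0<..<L}. c x * f x * (c x * f x) \<le> M * f x * (M * f x)"
        using M
      proof eventually_elim
        case (elim x)
        then have "\<bar>c x * f x\<bar> \<le> \<bar>M * f x\<bar>" by (auto simp: abs_mult intro!: mult_right_mono)
        then show ?case by (simp only: abs_le_square_iff power2_eq_square)
      qed
    qed (intro L2_mult_integrable cf L2_scale f)+
    then have "L2_norm L (\<lambda>x. c x * f x) \<le> L2_norm L (\<lambda>x. M * f x)"
      unfolding L2_norm_def by (rule real_sqrt_le_mono)
    then show ?thesis by simp
  qed
  then show ?thesis by (intro exI[of _ "\<bar>M\<bar>"]) auto
qed

text \<open>Geometrically small increments are summable almost everywhere, which gives a pointwise
  limit; Fatou's lemma then upgrades pointwise convergence to convergence in norm.\<close>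

lemma L2_complete_fast:
  assumes f: "\<And>n. f n \<in> L2 L"
    and d: "\<And>n. L2_norm L (\<lambda>x. f (Suc n) x - f n x) \<le> (1/2) ^ n"
  shows "\<exists>g\<in>L2 L. (\<lambda>n. L2_norm L (\<lambda>x. f n x - g x)) \<longlonglongrightarrow> 0"
proof -
  let ?M = "lebesgue_on {0<..<L}"
  have [measurable]: "f n \<in> borel_measurable ?M" for n using f by (auto simp: L2_def)
  \<comment> \<open>The subtracted term lets the induction close; it is dropped again when
    \<open>E\<close> is introduced.\<close>
  have dist: "L2_norm L (\<lambda>x. f n x - f (n + k) x) \<le> 2 * (1/2) ^ n - 2 * (1/2) ^ (n + k)" for n k
  proof (induction k)
    case (Suc k)
    have "L2_norm L (\<lambda>x. f n x - f (n + Suc k) x) \<le> L2_norm L (\<lambda>x. f n x - f (n + k) x)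
        + L2_norm L (\<lambda>x. f (n + k) x - f (Suc (n + k)) x)"
      using L2_norm_triangle3[OF f f f, of n "n + Suc k" "n + k"] by (simp only: add_Suc_right)
    also have "\<dots> \<le> 2 * (1/2) ^ n - 2 * (1/2) ^ (n + k) + (1/2) ^ (n + k)"
      using Suc d[of "n + k"] L2_norm_diff_commute[of L "f (n + k)" "f (Suc (n + k))"] by linarith
    finally show ?case by simp
  qed simp
  define \<delta> where "\<delta> n x = \<bar>f (Suc n) x - f n x\<bar>" for n x
  have [measurable]: "\<delta> n \<in> borel_measurable ?M" for n unfolding \<delta>_def by measurable
  define K where "K = L2_norm L (\<lambda>x. 1)"
  have \<delta>L2: "\<delta> n \<in> L2 L" for n
    using L2_diff[OF f f, of "Suc n" n] by (auto simp: L2_def \<delta>_def)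
  \<comment> \<open>The interval has finite measure, so pairing with the constant 1 turns the L^2
    bound on an increment into an L^1 bound.\<close>
  have \<delta>int: "(\<integral>\<^sup>+ x. ennreal (\<delta> n x) \<partial>?M) \<le> ennreal ((1/2) ^ n * K)" for n
  proof -
    have "(\<integral>\<^sup>+ x. ennreal (\<delta> n x) \<partial>?M) = ennreal (LINT x|?M. \<delta> n x)"
      using L2_integrable[OF \<delta>L2[of n]]
      by (intro nn_integral_eq_integral) (simp_all add: \<delta>_def[abs_def])
    also have "(LINT x|?M. \<delta> n x) = L2_inner L (\<delta> n) (\<lambda>x. 1)" by (simp add: L2_inner_def)
    also have "\<dots> \<le> L2_norm L (\<delta> n) * K"
      using L2_Cauchy_Schwarz[OF \<delta>L2[of n] L2_const[of 1]] by (simp add: K_def)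
    also have "L2_norm L (\<delta> n) = L2_norm L (\<lambda>x. f (Suc n) x - f n x)"
      by (simp add: L2_norm_def L2_inner_def \<delta>_def)
    also have "\<dots> * K \<le> (1/2) ^ n * K" using d[of n] by (intro mult_right_mono) (simp_all add: K_def)
    finally show ?thesis by (simp add: ennreal_leI)
  qed
  have "(\<integral>\<^sup>+ x. (\<Sum>n. ennreal (\<delta> n x)) \<partial>?M) = (\<Sum>n. \<integral>\<^sup>+ x. ennreal (\<delta> n x) \<partial>?M)"
    by (rule nn_integral_suminf) measurable
  also have "\<dots> \<le> (\<Sum>n. ennreal ((1/2) ^ n * K))"
    by (intro suminf_le \<delta>int) auto
  also have "\<dots> = ennreal (\<Sum>n. (1/2) ^ n * K)"
    by (rule suminf_ennreal2) (auto simp: K_def intro!: summable_mult2)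
  finally have "(\<integral>\<^sup>+ x. (\<Sum>n. ennreal (\<delta> n x)) \<partial>?M) \<noteq> \<infinity>"
    by (auto simp: top_unique)
  then have "AE x in ?M. (\<Sum>n. ennreal (\<delta> n x)) \<noteq> \<infinity>"
    by (intro nn_integral_noteq_infinite) auto
  then have conv: "AE x in ?M. convergent (\<lambda>n. f n x)"
  proof eventually_elim
    case (elim x)
    then have "summable (\<lambda>n. \<delta> n x)"
      by (intro summable_suminf_not_top) (auto simp: \<delta>_def)
    then have "summable (\<lambda>n. f (Suc n) x - f n x)"
      unfolding \<delta>_def by (rule summable_rabs_cancel)
    then have "convergent (\<lambda>n. \<Sum>k<n. f (Suc k) x - f k x)"
      by (simp add: summable_iff_convergent)
    then have "convergent (\<lambda>n. f n x - f 0 x)" by (simp add: sum_lessThan_telescope[of "\<lambda>n. f n x"])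
    then have "convergent (\<lambda>n. (f n x - f 0 x) + f 0 x)"
      by (intro convergent_add convergent_const)
    then show ?case by simp
  qed
  define g where "g x = lim (\<lambda>n. f n x)" for x
  have [measurable]: "g \<in> borel_measurable ?M"
    unfolding g_def by measurable
  have lim: "AE x in ?M. (\<lambda>n. f n x) \<longlonglongrightarrow> g x"
    using conv by eventually_elim (simp add: g_def convergent_LIMSEQ_iff)
  obtain E :: "nat \<Rightarrow> real" where distE: "\<And>n k. L2_norm L (\<lambda>x. f n x - f (n + k) x) \<le> E n"
    and Epos: "\<And>n. 0 \<le> E n" and E0: "E \<longlonglongrightarrow> 0"
  proof (rule that)
    show "L2_norm L (\<lambda>x. f n x - f (n + k) x) \<le> 2 * (1/2) ^ n" for n k
    proof -
      have "0 \<le> 2 * (1/2::real) ^ (n + k)" by simp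
      with dist[of n k] show ?thesis by linarith
    qed
    show "(\<lambda>n. 2 * (1/2::real) ^ n) \<longlonglongrightarrow> 0"
      using tendsto_mult_right_zero[OF LIMSEQ_power_zero[of "1/2::real"], of 2] by simp
  qed simp
  \<comment> \<open>Fatou's lemma in the second index: the bound on f n - f (n + k) is uniform in k
    and survives the pointwise limit.\<close>
  have bnd: "(\<integral>\<^sup>+ x. ennreal ((f n x - g x)\<^sup>2) \<partial>?M) \<le> ennreal ((E n)\<^sup>2)" for n
  proof -
    have "(\<integral>\<^sup>+ x. ennreal ((f n x - g x)\<^sup>2) \<partial>?M)
        = (\<integral>\<^sup>+ x. liminf (\<lambda>k. ennreal ((f n x - f (n + k) x)\<^sup>2)) \<partial>?M)"
    proof (rule nn_integral_cong_AE)
      show "AE x in ?M. ennreal ((f n x - g x)\<^sup>2) = liminf (\<lambda>k. ennreal ((f n x - f (n + k) x)\<^sup>2))"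
        using lim
      proof eventually_elim
        case (elim x)
        have "(\<lambda>k. f (n + k) x) \<longlonglongrightarrow> g x"
          using LIMSEQ_ignore_initial_segment[OF elim, of n] by (simp add: add.commute)
        then have "(\<lambda>k. ennreal ((f n x - f (n + k) x)\<^sup>2)) \<longlonglongrightarrow> ennreal ((f n x - g x)\<^sup>2)"
          by (intro tendsto_ennrealI tendsto_intros)
        then show ?case by (rule lim_imp_Liminf[OF trivial_limit_sequentially, symmetric])
      qed
    qed
    also have "\<dots> \<le> liminf (\<lambda>k. \<integral>\<^sup>+ x. ennreal ((f n x - f (n + k) x)\<^sup>2) \<partial>?M)"
      by (rule nn_integral_liminf) measurable
    also have "\<dots> \<le> liminf (\<lambda>k::nat. ennreal ((E n)\<^sup>2))"
    proof (rule Liminf_mono, rule always_eventually, rule allI)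
      fix k
      have "(\<integral>\<^sup>+ x. ennreal ((f n x - f (n + k) x)\<^sup>2) \<partial>?M)
          = ennreal ((L2_norm L (\<lambda>x. f n x - f (n + k) x))\<^sup>2)"
        using L2_diff[OF f f, of n "n + k"]
        by (subst nn_integral_eq_integral) (auto simp: L2_norm_power2_LINT L2_def)
      also have "\<dots> \<le> ennreal ((E n)\<^sup>2)"
      proof (intro ennreal_leI power_mono)
        show "L2_norm L (\<lambda>x. f n x - f (n + k) x) \<le> E n"
          by (rule distE)
      qed simp
      finally show "(\<integral>\<^sup>+ x. ennreal ((f n x - f (n + k) x)\<^sup>2) \<partial>?M) \<le> ennreal ((E n)\<^sup>2)" .
    qed
    also have "\<dots> = ennreal ((E n)\<^sup>2)" by (simp add: Liminf_const)
    finally show ?thesis .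
  qed
  have int: "integrable ?M (\<lambda>x. (f n x - g x)\<^sup>2)" for n
    using order_le_less_trans[OF bnd[of n], of "\<infinity>"] by (intro integrableI_nonneg) auto
  have fg: "(\<lambda>x. f n x - g x) \<in> L2 L" for n using int[of n] by (simp add: L2_def)
  have gL2: "g \<in> L2 L" using L2_diff[OF f[of 0] fg[of 0]] by simp
  have nb: "L2_norm L (\<lambda>x. f n x - g x) \<le> E n" for n
  proof (rule power2_le_imp_le)
    have "ennreal ((L2_norm L (\<lambda>x. f n x - g x))\<^sup>2) = (\<integral>\<^sup>+ x. ennreal ((f n x - g x)\<^sup>2) \<partial>?M)"
      using int[of n] by (subst nn_integral_eq_integral) (auto simp: L2_norm_power2_LINT)
    also note bnd[of n]
    finally show "(L2_norm L (\<lambda>x. f n x - g x))\<^sup>2 \<le> (E n)\<^sup>2" by simp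
  qed (rule Epos)
  have "(\<lambda>n. L2_norm L (\<lambda>x. f n x - g x)) \<longlonglongrightarrow> 0"
    by (rule Lim_null_comparison[OF _ E0]) (simp add: nb)
  with gL2 show ?thesis by blast
qed

text \<open>A Cauchy sequence has a subsequence with geometrically small increments, and it
  converges to the limit of that subsequence.\<close>

lemma L2_complete:
  assumes f: "\<And>n. f n \<in> L2 L"
    and cauchy: "\<And>\<epsilon>. \<epsilon> > 0 \<Longrightarrow> \<exists>N. \<forall>m\<ge>N. \<forall>n\<ge>m. L2_norm L (\<lambda>x. f n x - f m x) < \<epsilon>"
  shows "\<exists>g\<in>L2 L. (\<lambda>n. L2_norm L (\<lambda>x. f n x - g x)) \<longlonglongrightarrow> 0"
proof -
  have "\<exists>N. \<forall>m\<ge>N. \<forall>n\<ge>m. L2_norm L (\<lambda>x. f n x - f m x) < (1/2) ^ k" for k :: nat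
    by (rule cauchy) simp
  then obtain N where N: "\<And>k m n. m \<ge> N k \<Longrightarrow> n \<ge> m \<Longrightarrow> L2_norm L (\<lambda>x. f n x - f m x) < (1/2) ^ k"
    by metis
  \<comment> \<open>Summing the thresholds makes \<open>r\<close> monotone and at least
    \<open>N k\<close>; adding k makes it unbounded.\<close>
  define r where "r k = (\<Sum>i\<le>k. N i) + k" for k
  have rN: "N k \<le> r k" and rk: "k \<le> r k" and rmono: "r k \<le> r (Suc k)" for k
    by (auto simp: r_def intro!: member_le_sum trans_le_add1)
  obtain g where g: "g \<in> L2 L" "(\<lambda>k. L2_norm L (\<lambda>x. f (r k) x - g x)) \<longlonglongrightarrow> 0"
    using L2_complete_fast[of "\<lambda>k. f (r k)" L] N[OF rN rmono] f by (auto intro: less_imp_le)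
  have "(\<lambda>n. L2_norm L (\<lambda>x. f n x - g x)) \<longlonglongrightarrow> 0"
  proof (rule LIMSEQ_I)
    fix \<epsilon> :: real assume \<epsilon>: "0 < \<epsilon>"
    then obtain m0 where m0: "\<And>m n. m \<ge> m0 \<Longrightarrow> n \<ge> m \<Longrightarrow> L2_norm L (\<lambda>x. f n x - f m x) < \<epsilon> / 2"
      using cauchy[of "\<epsilon> / 2"] by auto
    have "\<forall>\<^sub>F k in sequentially. L2_norm L (\<lambda>x. f (r k) x - g x) < \<epsilon> / 2"
      using order_tendstoD(2)[OF g(2), of "\<epsilon> / 2"] \<epsilon> by simp
    then obtain k0 where k0: "\<And>k. k \<ge> k0 \<Longrightarrow> L2_norm L (\<lambda>x. f (r k) x - g x) < \<epsilon> / 2"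
      by (auto simp: eventually_sequentially)
    have "L2_norm L (\<lambda>x. f n x - g x) < \<epsilon>" if "n \<ge> m0" for n
    proof -
      let ?k = "max k0 n"
      have "L2_norm L (\<lambda>x. f n x - g x) \<le> L2_norm L (\<lambda>x. f n x - f (r ?k) x) + L2_norm L (\<lambda>x. f (r ?k) x - g x)"
        by (rule L2_norm_triangle3[OF f f g(1)])
      also have "L2_norm L (\<lambda>x. f n x - f (r ?k) x) < \<epsilon> / 2"
        using m0[OF that, of "r ?k"] rk[of ?k] by (simp add: L2_norm_diff_commute)
      finally show ?thesis using k0[of ?k] by simp
    qed
    then show "\<exists>no. \<forall>n\<ge>no. norm (L2_norm L (\<lambda>x. f n x - g x) - 0) < \<epsilon>" by auto
  qed
  with g(1) show ?thesis by blast
qed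

section \<open>Smooth bumps and the fundamental lemma\<close>

text \<open>The powers in the denominator are there because differentiating exp (- eps / u) produces
  them: up to linear combinations the family is closed under differentiation. The parameter eps is
  kept so that letting it tend to 0 brings the bumps up to 1.\<close>

definition flat :: "real \<Rightarrow> nat \<Rightarrow> real \<Rightarrow> real" where
  "flat \<epsilon> i u = (if 0 < u then exp (- \<epsilon> / u) / u ^ i else 0)"

lemma flat_tendsto_0:
  assumes "0 < \<epsilon>"
  shows "(flat \<epsilon> i \<longlongrightarrow> 0) (at 0)"
proof -
  have "((\<lambda>v. (\<epsilon> * v) ^ i / exp (\<epsilon> * v)) \<longlongrightarrow> 0) at_top"
    by (rule filterlim_compose[OF tendsto_power_div_exp_0])
       (use assms in \<open>auto intro!: filterlim_tendsto_pos_mult_at_top[OF tendsto_const] filterlim_ident\<close>)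
  then have "((\<lambda>v. (1 / \<epsilon> ^ i) * ((\<epsilon> * v) ^ i / exp (\<epsilon> * v))) \<longlongrightarrow> (1 / \<epsilon> ^ i) * 0) at_top"
    by (intro tendsto_intros)
  then have lim: "((\<lambda>v. v ^ i / exp (\<epsilon> * v)) \<longlongrightarrow> 0) at_top"
    using assms by (simp add: power_mult_distrib)
  have "((\<lambda>u. (inverse u) ^ i / exp (\<epsilon> * inverse u)) \<longlongrightarrow> 0) (at_right 0)"
    by (rule filterlim_compose[OF lim filterlim_inverse_at_top_right])
  moreover have "\<forall>\<^sub>F u in at_right 0. (inverse u) ^ i / exp (\<epsilon> * inverse u) = flat \<epsilon> i u"
    using eventually_at_right_less[of 0]
    by eventually_elim (simp add: flat_def exp_minus field_simps power_inverse)
  ultimately have "(flat \<epsilon> i \<longlongrightarrow> 0) (at_right 0)"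
    by (rule Lim_transform_eventually)
  moreover have "(flat \<epsilon> i \<longlongrightarrow> 0) (at_left 0)"
    by (rule tendsto_eventually) (auto simp: eventually_at_filter flat_def)
  ultimately show ?thesis by (simp add: filterlim_split_at)
qed

lemma flat_deriv:
  assumes "0 < \<epsilon>"
  shows "(flat \<epsilon> i has_real_derivative (\<epsilon> * flat \<epsilon> (i + 2) u - real i * flat \<epsilon> (Suc i) u)) (at u)"
proof -
  consider "u < 0" | "u = 0" | "0 < u" by linarith
  then show ?thesis
  proof cases
    case 1
    have ev: "\<forall>\<^sub>F x in nhds u. flat \<epsilon> i x = 0"
      using eventually_nhds_in_open[of "{..<0}" u] 1
      by (auto elim!: eventually_mono simp: flat_def)
    show ?thesis
      using 1 by (subst DERIV_cong_ev[OF refl ev refl]) (simp add: flat_def)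
  next
    case 2
    \<comment> \<open>At the origin the difference quotient of \<open>flat \<epsilon> i\<close> is
      exactly \<open>flat \<epsilon> (Suc i)\<close>, which tends to 0.\<close>
    have "((\<lambda>h. (flat \<epsilon> i (0 + h) - flat \<epsilon> i 0) / h) \<longlongrightarrow> 0) (at 0)"
    proof (rule Lim_transform_eventually[OF flat_tendsto_0[OF assms, of "Suc i"]])
      show "\<forall>\<^sub>F h in at 0. flat \<epsilon> (Suc i) h = (flat \<epsilon> i (0 + h) - flat \<epsilon> i 0) / h"
        by (rule always_eventually) (auto simp: flat_def)
    qed
    then show ?thesis using 2 by (simp add: DERIV_def flat_def)
  next
    case 3
    have "((\<lambda>u. exp (- \<epsilon> / u) / u ^ i) has_real_derivative
        \<epsilon> * flat \<epsilon> (i + 2) u - real i * flat \<epsilon> (Suc i) u) (at u)"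
    proof -
      have e: "((\<lambda>u. exp (- \<epsilon> / u)) has_real_derivative exp (- \<epsilon> / u) * (\<epsilon> / u\<^sup>2)) (at u)"
        using 3 by (auto intro!: derivative_eq_intros simp: power2_eq_square)
      have "u ^ i \<noteq> 0" using 3 by simp
      from DERIV_divide[OF e DERIV_pow this] show ?thesis
      proof (rule DERIV_cong)
        have id: "(E * (\<epsilon> / u\<^sup>2) * (u * p) - q * p * E) / (u * p * (u * p))
            = \<epsilon> * (E / (u * (u * (u * p)))) - q * (E / (u * (u * p)))" if "p \<noteq> 0" for E p q :: real
          using 3 that by (simp add: divide_simps power2_eq_square) (simp add: algebra_simps)
        show "(exp (- \<epsilon> / u) * (\<epsilon> / u\<^sup>2) * u ^ i - exp (- \<epsilon> / u) * (real i * u ^ (i - Suc 0))) / (u ^ i * u ^ i)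
            = \<epsilon> * flat \<epsilon> (i + 2) u - real i * flat \<epsilon> (Suc i) u"
        proof (cases i)
          case (Suc m)
          then show ?thesis
            using id[of "u ^ m" "exp (- \<epsilon> / u)" "real (Suc m)"] 3 by (simp add: flat_def mult_ac)
        qed (use 3 in \<open>simp add: flat_def power2_eq_square\<close>)
      qed
    qed
    moreover have ev: "\<forall>\<^sub>F x in nhds u. flat \<epsilon> i x = exp (- \<epsilon> / x) / x ^ i"
      using eventually_nhds_in_open[of "{0<..}" u] 3
      by (auto elim!: eventually_mono simp: flat_def)
    ultimately show ?thesis
      by (subst DERIV_cong_ev[OF refl ev refl])
  qed
qed

text \<open>A space of functions closed under differentiation, so all its members are smooth.\<close>

inductive_set bump_span :: "real \<Rightarrow> real \<Rightarrow> real \<Rightarrow> (real \<Rightarrow> real) set" for \<epsilon> a b where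
  gen: "(\<lambda>x. flat \<epsilon> i (x - a) * flat \<epsilon> j (b - x)) \<in> bump_span \<epsilon> a b"
| add: "f \<in> bump_span \<epsilon> a b \<Longrightarrow> g \<in> bump_span \<epsilon> a b \<Longrightarrow> (\<lambda>x. f x + g x) \<in> bump_span \<epsilon> a b"
| scale: "f \<in> bump_span \<epsilon> a b \<Longrightarrow> (\<lambda>x. r * f x) \<in> bump_span \<epsilon> a b"

lemma bump_span_deriv:
  assumes "0 < \<epsilon>" "f \<in> bump_span \<epsilon> a b"
  shows "\<exists>f'\<in>bump_span \<epsilon> a b. \<forall>x. (f has_real_derivative f' x) (at x)"
  using assms(2)
proof induction
  case (gen i j)
  let ?g = "\<lambda>i j x. flat \<epsilon> i (x - a) * flat \<epsilon> j (b - x)"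
  define f' where "f' x = (\<epsilon> * ?g (i + 2) j x + (- real i) * ?g (Suc i) j x)
      + ((- \<epsilon>) * ?g i (j + 2) x + real j * ?g i (Suc j) x)" for x
  have "f' \<in> bump_span \<epsilon> a b"
    unfolding f'_def by (intro bump_span.intros)
  moreover have "(?g i j has_real_derivative f' x) (at x)" for x
  proof -
    have 1: "((\<lambda>x. flat \<epsilon> i (x - a)) has_real_derivative
        (\<epsilon> * flat \<epsilon> (i + 2) (x - a) - real i * flat \<epsilon> (Suc i) (x - a)) * 1) (at x)"
      by (rule DERIV_chain2[OF flat_deriv[OF assms(1)]]) (auto intro!: derivative_eq_intros)
    have 2: "((\<lambda>x. flat \<epsilon> j (b - x)) has_real_derivative
        (\<epsilon> * flat \<epsilon> (j + 2) (b - x) - real j * flat \<epsilon> (Suc j) (b - x)) * (- 1)) (at x)"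
      by (rule DERIV_chain2[OF flat_deriv[OF assms(1)]]) (auto intro!: derivative_eq_intros)
    show ?thesis
      by (rule DERIV_cong[OF DERIV_mult[OF 1 2]]) (simp add: f'_def algebra_simps)
  qed
  ultimately show ?case by blast
next
  case (add f g)
  then obtain f' g' where "f' \<in> bump_span \<epsilon> a b" "g' \<in> bump_span \<epsilon> a b"
    "\<forall>x. (f has_real_derivative f' x) (at x)" "\<forall>x. (g has_real_derivative g' x) (at x)" by blast
  then show ?case
    by (intro bexI[of _ "\<lambda>x. f' x + g' x"]) (auto intro!: DERIV_add bump_span.add)
next
  case (scale f r)
  then obtain f' where "f' \<in> bump_span \<epsilon> a b" "\<forall>x. (f has_real_derivative f' x) (at x)" by blast
  then show ?case
    by (intro bexI[of _ "\<lambda>x. r * f' x"]) (auto intro!: DERIV_cmult bump_span.scale)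
qed

text \<open>Smoothness in \<open>test_functions\<close> speaks of all iterates of
  \<open>deriv\<close>. A set that is closed under taking one derivative reduces this to a single
  differentiation; below it is applied to bumps, to linear combinations and to primitives.\<close>

lemma smooth_of_closed_under_deriv:
  assumes "\<And>f. f \<in> P \<Longrightarrow> \<exists>f'\<in>P. \<forall>x. (f has_real_derivative f' x) (at x)" and "f \<in> P"
  shows "(deriv ^^ k) f \<in> P" "(deriv ^^ k) f differentiable_on UNIV"
proof -
  have deriv: "deriv f \<in> P" if "f \<in> P" for f
  proof -
    obtain f' where "f' \<in> P" "\<forall>x. (f has_real_derivative f' x) (at x)" using assms(1)[OF \<open>f \<in> P\<close>] by blast
    moreover from this have "deriv f = f'" by (auto intro!: DERIV_imp_deriv)
    ultimately show ?thesis by simp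
  qed
  show *: "(deriv ^^ k) f \<in> P"
    by (induction k) (simp_all add: assms(2) deriv)
  show "(deriv ^^ k) f differentiable_on UNIV"
    using assms(1)[OF *] by (auto simp: differentiable_on_def real_differentiable_def)
qed

definition bump :: "real \<Rightarrow> real \<Rightarrow> real \<Rightarrow> real \<Rightarrow> real" where
  "bump \<epsilon> a b x = flat \<epsilon> 0 (x - a) * flat \<epsilon> 0 (b - x)"

lemma bump_test:
  assumes "0 < \<epsilon>" "0 < a" "b < L"
  shows "bump \<epsilon> a b \<in> test_functions L"
proof -
  have "bump \<epsilon> a b \<in> bump_span \<epsilon> a b"
    using bump_span.gen[of \<epsilon> 0 a 0 b] by (simp add: bump_def[abs_def])
  then have "(deriv ^^ k) (bump \<epsilon> a b) differentiable_on UNIV" for k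
    using smooth_of_closed_under_deriv(2)[of "bump_span \<epsilon> a b"] bump_span_deriv[OF assms(1)] by blast
  moreover have "bump \<epsilon> a b x = 0" if "x \<notin> {a..b}" for x
    using that by (auto simp: bump_def flat_def)
  moreover have "compact {a..b}" "{a..b} \<subseteq> {0<..<L}" using assms by auto
  ultimately show ?thesis unfolding test_functions_def by blast
qed

lemma bump_pos: "a < x \<Longrightarrow> x < b \<Longrightarrow> 0 < bump \<epsilon> a b x"
  by (simp add: bump_def flat_def)

lemma bump_nonneg: "0 \<le> bump \<epsilon> a b x"
  by (simp add: bump_def flat_def)

lemma bump_le_1: "0 < \<epsilon> \<Longrightarrow> bump \<epsilon> a b x \<le> 1"
  by (auto simp: bump_def flat_def intro!: mult_le_one)

text \<open>Shrinking the supports slightly reaches the indicator of any open subinterval of \<open>(0,L)\<close>.\<close>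

lemma bump_tendsto_indicator:
  "(\<lambda>n. bump (1 / real (Suc n)) (a + 1 / real (Suc n)) (b - 1 / real (Suc n)) x)
     \<longlonglongrightarrow> indicator {a<..<b} x"
proof (cases "x \<in> {a<..<b}")
  case True
  let ?d = "\<lambda>n. 1 / real (Suc n)"
  have d: "?d \<longlonglongrightarrow> 0" using LIMSEQ_inverse_real_of_nat by (simp add: inverse_eq_divide)
  have "\<forall>\<^sub>F n in sequentially. ?d n < min (x - a) (b - x)"
    using order_tendstoD(2)[OF d, of "min (x - a) (b - x)"] True by auto
  then have ev: "\<forall>\<^sub>F n in sequentially. exp (- ?d n / (x - (a + ?d n))) * exp (- ?d n / (b - ?d n - x))
      = bump (?d n) (a + ?d n) (b - ?d n) x"
    by eventually_elim (auto simp: bump_def flat_def)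
  have "(\<lambda>n. exp (- ?d n / (x - (a + ?d n))) * exp (- ?d n / (b - ?d n - x)))
      \<longlonglongrightarrow> exp (- 0 / (x - (a + 0))) * exp (- 0 / (b - 0 - x))"
    by (intro tendsto_intros d) (use True in auto)
  then show ?thesis using Lim_transform_eventually[OF _ ev] True by simp
next
  case False
  have "bump (1 / real (Suc n)) (a + 1 / real (Suc n)) (b - 1 / real (Suc n)) x = 0" for n
  proof -
    have "bump d (a + d) (b - d) x = 0" if "0 < d" for d
      using False that by (auto simp: bump_def flat_def)
    then show ?thesis by simp
  qed
  then show ?thesis using False by simp
qed

section \<open>Calculus of test functions\<close>

lemma test_function_deriv:
  assumes "\<phi> \<in> test_functions L"
  shows "(\<phi> has_real_derivative deriv \<phi> x) (at x)"
proof -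
  have "\<phi> differentiable_on UNIV"
    using assms unfolding test_functions_def by (auto dest: spec[of _ 0])
  then show ?thesis
    by (simp add: differentiable_on_def real_differentiable_def DERIV_deriv_iff_real_differentiable)
qed

lemma deriv_test_function:
  assumes "\<phi> \<in> test_functions L"
  shows "deriv \<phi> \<in> test_functions L"
proof -
  obtain K where K: "compact K" "K \<subseteq> {0<..<L}" "\<And>x. x \<notin> K \<Longrightarrow> \<phi> x = 0"
    and sm: "\<And>k. (deriv ^^ k) \<phi> differentiable_on UNIV"
    using assms by (auto simp: test_functions_def)
  have "deriv \<phi> x = 0" if "x \<notin> K" for x
  proof -
    have "((\<lambda>_. 0) has_real_derivative 0) (at x)" by simp
    moreover have ev: "\<forall>\<^sub>F y in nhds x. \<phi> y = 0"
      using eventually_nhds_in_open[of "- K" x] that compact_imp_closed[OF K(1)] K(3) open_Compl[of K]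
      by (auto elim!: eventually_mono)
    ultimately have "(\<phi> has_real_derivative 0) (at x)"
      by (subst DERIV_cong_ev[OF refl ev refl])
    then show ?thesis by (rule DERIV_imp_deriv)
  qed
  moreover have "(deriv ^^ k) (deriv \<phi>) differentiable_on UNIV" for k
    using sm[of "Suc k"] by (simp add: funpow_swap1)
  ultimately show ?thesis using K(1,2) unfolding test_functions_def by blast
qed

lemma test_function_continuous: "\<phi> \<in> test_functions L \<Longrightarrow> continuous_on UNIV \<phi>"
  by (meson DERIV_continuous continuous_at_imp_continuous_on test_function_deriv)

lemma test_function_L2: "\<phi> \<in> test_functions L \<Longrightarrow> \<phi> \<in> L2 L"
  by (intro L2_continuous test_function_continuous)

lemma test_function_zero:
  assumes "\<phi> \<in> test_functions L" "x \<notin> {0<..<L}"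
  shows "\<phi> x = 0"
  using assms by (auto simp: test_functions_def)

lemma LINT_interval_FTC:
  fixes F f :: "real \<Rightarrow> real"
  assumes "0 \<le> L" "\<And>x. (F has_real_derivative f x) (at x)" "continuous_on UNIV f"
  shows "(LINT x|lebesgue_on {0<..<L}. f x) = F L - F 0"
proof -
  have "(LINT x|lebesgue_on {0<..<L}. f x) = integral {0<..<L} f"
    using L2_integrable[OF L2_continuous[OF assms(3)]]
    by (intro lebesgue_integral_eq_integral) auto
  also have "\<dots> = integral {0..L} f"
    by (simp add: integral_open_interval_real)
  also have "(f has_integral (F L - F 0)) {0..L}"
    using assms by (intro fundamental_theorem_of_calculus)
      (auto simp: has_real_derivative_iff_has_vector_derivative[symmetric] intro: has_field_derivative_at_within)
  then have "integral {0..L} f = F L - F 0" by (rule integral_unique)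
  finally show ?thesis .
qed

text \<open>Passing to a Borel function on the whole line gives access to product measures and to
  $\pi$-systems.\<close>

lemma borel_version:
  fixes h :: "real \<Rightarrow> real"
  assumes S: "S \<in> sets borel" and h: "integrable (lebesgue_on S) h"
  obtains g where "g \<in> borel_measurable borel" "integrable lborel g" "\<And>x. x \<notin> S \<Longrightarrow> g x = 0"
    "AE x in lebesgue_on S. h x = g x"
    "\<And>k :: real \<Rightarrow> real. k \<in> borel_measurable borel \<Longrightarrow> (LINT x|lebesgue_on S. h x * k x) = (LINT x|lborel. g x * k x)"
proof -
  have Sl: "S \<in> sets lebesgue" using S by simp
  have int: "integrable lebesgue (\<lambda>x. indicator S x * h x)"
    using h integrable_restrict_space[of S lebesgue h] Sl by simp
  then have "(\<lambda>x. indicator S x * h x) \<in> borel_measurable (completion lborel)"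
    by (rule borel_measurable_integrable)
  from completion_ex_borel_measurable_real[OF this] obtain g0 where
    g0: "g0 \<in> borel_measurable lborel" "AE x in lborel. indicator S x * h x = g0 x" by auto
  define g where "g x = indicator S x * g0 x" for x
  have gm[measurable]: "g \<in> borel_measurable borel" using g0(1) S unfolding g_def by measurable
  have ae: "AE x in lebesgue. indicator S x * h x = g x"
    using AE_completion[OF g0(2)] by eventually_elim (auto simp: g_def indicator_def)
  have "integrable lebesgue g"
    using int ae by (subst integrable_cong_AE[of _ _ "\<lambda>x. indicator S x * h x"]) (auto simp: borel_measurable_integrable measurable_completion)
  then have gi: "integrable lborel g" by (simp add: integrable_completion)
  have aeS: "AE x in lebesgue_on S. h x = g x"
    using ae Sl by (auto simp: AE_restrict_space_iff elim!: eventually_mono)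
  have "(LINT x|lebesgue_on S. h x * k x) = (LINT x|lborel. g x * k x)"
    if [measurable]: "k \<in> borel_measurable borel" for k :: "real \<Rightarrow> real"
  proof -
    have km: "k \<in> borel_measurable (lebesgue_on S)"
      by (simp add: measurable_completion measurable_restrict_space1)
    have gmS: "g \<in> borel_measurable (lebesgue_on S)"
      by (simp add: measurable_completion measurable_restrict_space1)
    have "(LINT x|lebesgue_on S. h x * k x) = (LINT x|lebesgue_on S. g x * k x)"
      using aeS by (intro integral_cong_AE borel_measurable_times borel_measurable_integrable[OF h] km gmS)
        (auto elim!: eventually_mono)
    also have "\<dots> = (LINT x|lebesgue. indicator S x * (g x * k x))"
      using Sl by (subst integral_restrict_space) (auto simp: set_lebesgue_integral_def)
    also have "\<dots> = (LINT x|lebesgue. g x * k x)"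
      by (rule Bochner_Integration.integral_cong) (auto simp: g_def indicator_def)
    also have "\<dots> = (LINT x|lborel. g x * k x)"
      by (rule integral_completion) measurable
    finally show ?thesis .
  qed
  with gm gi aeS show ?thesis by (intro that[of g]) (auto simp: g_def)
qed

text \<open>Open intervals form an intersection-stable generator of the Borel sets, so vanishing
  integrals over intervals propagate to all Borel sets, and a density with all integrals zero is
  zero almost everywhere.\<close>

lemma AE_zero_of_interval_integrals:
  fixes h :: "real \<Rightarrow> real"
  assumes h: "integrable (lebesgue_on {0<..<L}) h"
    and zero: "\<And>a b. 0 \<le> a \<Longrightarrow> a < b \<Longrightarrow> b \<le> L \<Longrightarrow>
      (LINT x|lebesgue_on {0<..<L}. h x * indicator {a<..<b} x) = 0"
  shows "AE x in lebesgue_on {0<..<L}. h x = 0"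
proof -
  obtain g where gm[measurable]: "g \<in> borel_measurable borel" and gi: "integrable lborel g"
    and g0: "\<And>x. x \<notin> {0<..<L} \<Longrightarrow> g x = 0"
    and ae: "AE x in lebesgue_on {0<..<L}. h x = g x"
    and eq: "\<And>k :: real \<Rightarrow> real. k \<in> borel_measurable borel \<Longrightarrow>
      (LINT x|lebesgue_on {0<..<L}. h x * k x) = (LINT x|lborel. g x * k x)"
    using borel_version[OF _ h] by auto
  have seti: "set_integrable lborel A g" if "A \<in> sets borel" for A
    using integrable_mult_indicator[of A lborel g] gi that by (simp add: set_integrable_def)
  have Ioo: "(LINT x:{a<..<b}|lborel. g x) = 0" for a b
  proof (cases "max a 0 < min b L")
    case True
    have "(LINT x:{a<..<b}|lborel. g x) = (LINT x|lborel. g x * indicator {max a 0<..<min b L} x)"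
      unfolding set_lebesgue_integral_def
      using g0 by (intro Bochner_Integration.integral_cong) (auto simp: indicator_def)
    also have "\<dots> = 0" using zero[of "max a 0" "min b L"] True eq[of "indicator {max a 0<..<min b L}"] by simp
    finally show ?thesis .
  next
    case False
    have "indicator {a<..<b} x *\<^sub>R g x = 0" for x
      using False g0[of x] by (auto simp: indicator_def)
    then show ?thesis unfolding set_lebesgue_integral_def by (simp only: integral_zero)
  qed
  \<comment> \<open>The complement case of the induction compares with the integral over the whole
    line.\<close>
  have UN: "(LINT x:UNIV|lborel. g x) = 0"
  proof -
    have "(LINT x:UNIV|lborel. g x) = (LINT x:{0<..<L}|lborel. g x)"
      unfolding set_lebesgue_integral_def
      using g0 by (intro Bochner_Integration.integral_cong) (auto simp: indicator_def)
    then show ?thesis using Ioo by simp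
  qed
  let ?G = "range (\<lambda>(a, b). box a b :: real set)"
  have sig: "sigma_sets UNIV ?G = sets borel"
    by (simp add: borel_eq_box)
  have all: "(LINT x:A|lborel. g x) = 0" if "A \<in> sets borel" for A
  proof -
    have "Int_stable ?G"
      by (auto simp: Int_stable_def box_real)
    moreover have "?G \<subseteq> Pow UNIV" by simp
    moreover have "A \<in> sigma_sets UNIV ?G" using that sig by simp
    ultimately show ?thesis
    proof (induction A rule: sigma_sets_induct_disjoint)
      case (basic A) then show ?case using Ioo by (auto simp: box_real)
    next
      case empty then show ?case by (simp add: set_lebesgue_integral_def)
    next
      case (compl A)
      have A: "A \<in> sets borel" using compl(1) sig by simp
      have "(LINT x:UNIV - A \<union> A|lborel. g x) = (LINT x:UNIV - A|lborel. g x) + (LINT x:A|lborel. g x)"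
        using A by (intro set_integral_Un seti) auto
      then show ?case using compl UN by simp
    next
      case (union A)
      then have "(LINT x:(\<Union>i. A i)|lborel. g x) = (\<Sum>i. LINT x:A i|lborel. g x)"
        using sig by (intro lebesgue_integral_countable_add seti) (auto simp: disjoint_family_on_def)
      then show ?case using union by simp
    qed
  qed
  have "AE x in lborel. g x = 0"
    by (rule density_unique_real) (use gi all in \<open>auto simp: set_lebesgue_integral_def\<close>)
  then have "AE x in lebesgue. g x = 0" by (rule AE_completion)
  then have "AE x in lebesgue_on {0<..<L}. g x = 0"
    by (auto simp: AE_restrict_space_iff elim!: eventually_mono)
  with ae show ?thesis by eventually_elim simp
qed


text \<open>The fundamental lemma of the calculus of variations: bumps converge boundedly to the
  indicator of an interval, so by dominated convergence \<open>g\<close> has zero integral over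
  every subinterval.\<close>

lemma L2_eq_zero_of_test_functions:
  assumes g: "g \<in> L2 L" and zero: "\<And>\<phi>. \<phi> \<in> test_functions L \<Longrightarrow> L2_inner L g \<phi> = 0"
  shows "L2_eq L g (\<lambda>x. 0)"
  unfolding L2_eq_def
proof (rule AE_zero_of_interval_integrals[OF L2_integrable[OF g]])
  fix a b :: real assume ab: "0 \<le> a" "a < b" "b \<le> L"
  let ?M = "lebesgue_on {0<..<L}"
  define \<psi> where "\<psi> n = bump (1 / real (Suc n)) (a + 1 / real (Suc n)) (b - 1 / real (Suc n))" for n
  have pos: "0 < 1 / real (Suc n)" for n by simp
  have test: "\<psi> n \<in> test_functions L" for n
    unfolding \<psi>_def using ab pos[of n] by (intro bump_test) linarith+
  have [measurable]: "g \<in> borel_measurable ?M" "\<psi> n \<in> borel_measurable ?M" for n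
    using g test_function_L2[OF test] by (auto dest: L2_measurable)
  have "(\<lambda>n. LINT x|?M. g x * \<psi> n x) \<longlonglongrightarrow> (LINT x|?M. g x * indicator {a<..<b} x)"
  proof (rule integral_dominated_convergence[where w = "\<lambda>x. \<bar>g x\<bar>"])
    have "indicator {a<..<b} \<in> borel_measurable (borel :: real measure)" by simp
    then have "indicator {a<..<b} \<in> borel_measurable ?M"
      by (simp add: measurable_completion measurable_restrict_space1)
    then show "(\<lambda>x. g x * indicator {a<..<b} x) \<in> borel_measurable ?M" by measurable
    show "integrable ?M (\<lambda>x. \<bar>g x\<bar>)" using L2_integrable[OF g] by simp
    show "AE x in ?M. (\<lambda>n. g x * \<psi> n x) \<longlonglongrightarrow> g x * indicator {a<..<b} x"
      unfolding \<psi>_def by (intro AE_I2 tendsto_mult_left bump_tendsto_indicator)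
    show "AE x in ?M. norm (g x * \<psi> n x) \<le> \<bar>g x\<bar>" for n
      unfolding \<psi>_def using pos[of n]
      by (intro AE_I2) (simp add: abs_mult bump_nonneg bump_le_1 mult_left_le del: of_nat_Suc)
  qed measurable
  moreover have "(LINT x|?M. g x * \<psi> n x) = 0" for n
    using zero[OF test[of n]] by (simp add: L2_inner_def)
  ultimately show "(LINT x|?M. g x * indicator {a<..<b} x) = 0"
    by (simp add: LIMSEQ_const_iff)
qed

section \<open>Weak derivatives\<close>

lemma weak_deriv_L2: "weak_deriv L f g \<Longrightarrow> f \<in> L2 L" "weak_deriv L f g \<Longrightarrow> g \<in> L2 L"
  by (auto simp: weak_deriv_def)

lemma weak_deriv_H1: "weak_deriv L f g \<Longrightarrow> f \<in> H1 L"
  by (auto simp: H1_def)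

lemma weak_deriv_test:
  "weak_deriv L f g \<Longrightarrow> \<phi> \<in> test_functions L \<Longrightarrow> L2_inner L f (deriv \<phi>) = - L2_inner L g \<phi>"
  by (simp add: weak_deriv_def)

lemma weak_deriv_unique:
  assumes "weak_deriv L f g" "weak_deriv L f h"
  shows "L2_eq L g h"
proof -
  note L2s = weak_deriv_L2[OF assms(1)] weak_deriv_L2[OF assms(2)]
  have "L2_eq L (\<lambda>x. g x - h x) (\<lambda>x. 0)"
  proof (rule L2_eq_zero_of_test_functions)
    fix \<phi> assume \<phi>: "\<phi> \<in> test_functions L"
    then show "L2_inner L (\<lambda>x. g x - h x) \<phi> = 0"
      using weak_deriv_test[OF assms(1) \<phi>] weak_deriv_test[OF assms(2) \<phi>] L2s
      by (simp add: L2_inner_diff_left test_function_L2)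
  qed (use L2s in auto)
  then show ?thesis by (simp add: L2_eq_def)
qed

lemma weak_deriv_add:
  assumes "weak_deriv L f f'" "weak_deriv L g g'"
  shows "weak_deriv L (\<lambda>x. f x + g x) (\<lambda>x. f' x + g' x)"
  using assms
  by (auto simp: weak_deriv_def L2_inner_add_left test_function_L2 deriv_test_function)

lemma weak_deriv_scale:
  assumes "weak_deriv L f f'"
  shows "weak_deriv L (\<lambda>x. r * f x) (\<lambda>x. r * f' x)"
  using assms by (auto simp: weak_deriv_def)

lemma weak_deriv_diff:
  assumes "weak_deriv L f f'" "weak_deriv L g g'"
  shows "weak_deriv L (\<lambda>x. f x - g x) (\<lambda>x. f' x - g' x)"
  using weak_deriv_add[OF assms(1) weak_deriv_scale[OF assms(2), of "-1"]] by simp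

lemma weak_deriv_zero: "weak_deriv L (\<lambda>x. 0) (\<lambda>x. 0)"
  by (simp add: weak_deriv_def)

lemma weak_deriv_sum:
  assumes "\<And>i. i \<in> I \<Longrightarrow> weak_deriv L (f i) (f' i)"
  shows "weak_deriv L (\<lambda>x. \<Sum>i\<in>I. f i x) (\<lambda>x. \<Sum>i\<in>I. f' i x)"
  using assms
  by (induction I rule: infinite_finite_induct) (auto intro: weak_deriv_add weak_deriv_zero)

lemma weak_deriv_C1:
  assumes "0 < L" and F: "\<And>x. (F has_real_derivative f x) (at x)" and f: "continuous_on UNIV f"
  shows "weak_deriv L F f"
  unfolding weak_deriv_def
proof (intro conjI ballI)
  have Fc: "continuous_on UNIV F"
    by (meson DERIV_continuous continuous_at_imp_continuous_on F)
  show FL2: "F \<in> L2 L" and fL2: "f \<in> L2 L" by (rule L2_continuous, fact)+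
  fix \<phi> assume \<phi>: "\<phi> \<in> test_functions L"
  note d\<phi> = deriv_test_function[OF \<phi>]
  have "(LINT x|lebesgue_on {0<..<L}. f x * \<phi> x + deriv \<phi> x * F x) = F L * \<phi> L - F 0 * \<phi> 0"
    using assms(1)
    by (intro LINT_interval_FTC[where F = "\<lambda>x. F x * \<phi> x"])
       (auto intro!: DERIV_mult F test_function_deriv[OF \<phi>] continuous_intros Fc f
          test_function_continuous[OF \<phi>] test_function_continuous[OF d\<phi>])
  also have "\<dots> = 0" using test_function_zero[OF \<phi>] by simp
  finally show "L2_inner L F (deriv \<phi>) = - L2_inner L f \<phi>"
    using L2_mult_integrable[OF fL2 test_function_L2[OF \<phi>]]
      L2_mult_integrable[OF test_function_L2[OF d\<phi>] FL2]
    by (simp add: L2_inner_def mult.commute)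
qed

lemma weak_deriv_of_test_function:
  assumes "0 < L" "\<phi> \<in> test_functions L"
  shows "weak_deriv L \<phi> (deriv \<phi>)"
  using assms by (intro weak_deriv_C1 test_function_deriv[OF assms(2)]
      test_function_continuous[OF deriv_test_function])

text \<open>Weak differentiation is a closed operator, since both sides of its defining identity are
  continuous in the L^2 norm. This makes term-by-term differentiation of eigenfunction series
  possible.\<close>

lemma weak_deriv_closed:
  assumes "\<And>n. weak_deriv L (f n) (f' n)" "g \<in> L2 L" "g' \<in> L2 L"
    and "(\<lambda>n. L2_norm L (\<lambda>x. f n x - g x)) \<longlonglongrightarrow> 0" "(\<lambda>n. L2_norm L (\<lambda>x. f' n x - g' x)) \<longlonglongrightarrow> 0"
  shows "weak_deriv L g g'"
  unfolding weak_deriv_def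
proof (intro conjI ballI assms)
  fix \<phi> assume \<phi>: "\<phi> \<in> test_functions L"
  have "(\<lambda>n. L2_inner L (f n) (deriv \<phi>)) \<longlonglongrightarrow> L2_inner L g (deriv \<phi>)"
    by (rule L2_inner_tendsto[OF _ assms(2) _ assms(4)])
       (use \<phi> weak_deriv_L2[OF assms(1)] in \<open>auto intro: test_function_L2 deriv_test_function\<close>)
  moreover have "(\<lambda>n. L2_inner L (f' n) \<phi>) \<longlonglongrightarrow> L2_inner L g' \<phi>"
    by (rule L2_inner_tendsto[OF _ assms(3) _ assms(5)])
       (use \<phi> weak_deriv_L2[OF assms(1)] in \<open>auto intro: test_function_L2\<close>)
  then have "(\<lambda>n. - L2_inner L (f' n) \<phi>) \<longlonglongrightarrow> - L2_inner L g' \<phi>" by (rule tendsto_minus)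
  ultimately show "L2_inner L g (deriv \<phi>) = - L2_inner L g' \<phi>"
    using weak_deriv_test[OF assms(1) \<phi>] by (simp add: LIMSEQ_unique)
qed

text \<open>Any weak derivative at hand may replace the one picked by choice, because two of them
  agree almost everywhere.\<close>

lemma H1_norm_eq:
  assumes "weak_deriv L f g"
  shows "H1_norm L f = sqrt ((L2_norm L f)\<^sup>2 + (L2_norm L g)\<^sup>2)"
proof -
  have "weak_deriv L f (SOME g. weak_deriv L f g)" using assms by (rule someI[of "weak_deriv L f"])
  then have "L2_norm L (SOME g. weak_deriv L f g) = L2_norm L g"
    using weak_deriv_unique[OF _ assms] by (intro L2_norm_cong) (auto dest: weak_deriv_L2 intro: weak_deriv_L2[OF assms])
  then show ?thesis by (simp add: H1_norm_def)
qed

lemma H1_norm_le_sum: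
  assumes "weak_deriv L f g"
  shows "H1_norm L f \<le> L2_norm L f + L2_norm L g"
  unfolding H1_norm_eq[OF assms] by (rule sqrt_sum_squares_le_sum) auto

lemma H10_H1: "f \<in> H10 L \<Longrightarrow> f \<in> H1 L"
  by (simp add: H10_def)

lemma H10_approx:
  assumes "0 < L" "f \<in> H10 L" "weak_deriv L f f'" "0 < \<epsilon>"
  shows "\<exists>\<phi>\<in>test_functions L. L2_norm L (\<lambda>x. f x - \<phi> x) < \<epsilon> \<and> L2_norm L (\<lambda>x. f' x - deriv \<phi> x) < \<epsilon>"
proof -
  obtain \<phi> where \<phi>: "\<phi> \<in> test_functions L" "H1_norm L (\<lambda>x. f x - \<phi> x) < \<epsilon>"
    using assms by (auto simp: H10_def)
  have "weak_deriv L (\<lambda>x. f x - \<phi> x) (\<lambda>x. f' x - deriv \<phi> x)"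
    by (intro weak_deriv_diff assms weak_deriv_of_test_function \<phi>)
  from H1_norm_eq[OF this] have "L2_norm L (\<lambda>x. f x - \<phi> x) \<le> H1_norm L (\<lambda>x. f x - \<phi> x)"
    "L2_norm L (\<lambda>x. f' x - deriv \<phi> x) \<le> H1_norm L (\<lambda>x. f x - \<phi> x)"
    by (auto intro!: real_le_rsqrt)
  with \<phi> show ?thesis by (intro bexI[of _ \<phi>]) auto
qed

text \<open>For test functions this is the definition of the weak derivative of \<open>g\<close>;
  density carries it to \<open>H10\<close>. Boundary conditions are imposed on \<open>f\<close>
  alone, so \<open>g\<close> may be a polynomial that tests the boundary values of
  \<open>f\<close>.\<close>

lemma H10_IBP:
  assumes "0 < L" "f \<in> H10 L" "weak_deriv L f f'" "weak_deriv L g g'"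
  shows "L2_inner L f' g = - L2_inner L f g'"
proof -
  have "\<exists>\<phi>\<in>test_functions L. L2_norm L (\<lambda>x. f x - \<phi> x) < inverse (real (Suc n)) \<and>
      L2_norm L (\<lambda>x. f' x - deriv \<phi> x) < inverse (real (Suc n))" for n
    by (rule H10_approx[OF assms(1-3)]) simp
  then obtain \<phi> where \<phi>: "\<And>n. \<phi> n \<in> test_functions L"
    and n: "\<And>n. L2_norm L (\<lambda>x. f x - \<phi> n x) < inverse (real (Suc n))"
      "\<And>n. L2_norm L (\<lambda>x. f' x - deriv (\<phi> n) x) < inverse (real (Suc n))" by metis
  note L2s = weak_deriv_L2[OF assms(3)] weak_deriv_L2[OF assms(4)]
  have "(\<lambda>n. L2_norm L (\<lambda>x. \<phi> n x - f x)) \<longlonglongrightarrow> 0"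
    by (rule Lim_null_comparison[OF _ LIMSEQ_inverse_real_of_nat])
       (use n(1) in \<open>auto simp: L2_norm_diff_commute[of L "\<phi> _"] intro!: always_eventually less_imp_le\<close>)
  then have "(\<lambda>n. L2_inner L (\<phi> n) g') \<longlonglongrightarrow> L2_inner L f g'"
    using L2s \<phi> by (intro L2_inner_tendsto) (auto intro!: always_eventually test_function_L2)
  moreover have "(\<lambda>n. L2_norm L (\<lambda>x. deriv (\<phi> n) x - f' x)) \<longlonglongrightarrow> 0"
    by (rule Lim_null_comparison[OF _ LIMSEQ_inverse_real_of_nat])
       (use n(2) in \<open>auto simp: L2_norm_diff_commute[of L "deriv (\<phi> _)"] intro!: always_eventually less_imp_le\<close>)
  then have "(\<lambda>n. L2_inner L (deriv (\<phi> n)) g) \<longlonglongrightarrow> L2_inner L f' g"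
    using L2s \<phi> by (intro L2_inner_tendsto) (auto intro!: always_eventually test_function_L2 deriv_test_function)
  moreover have "L2_inner L (deriv (\<phi> n)) g = - L2_inner L (\<phi> n) g'" for n
    using weak_deriv_test[OF assms(4) \<phi>] by (simp add: L2_inner_commute)
  ultimately show ?thesis
    using LIMSEQ_unique[OF _ tendsto_minus] by force
qed

text \<open>Closedness of \<open>H10\<close> under H^1 limits puts the sum of an eigenfunction
  series into the domain of A. The quarters of epsilon pay for four terms: approximation by
  \<open>f n\<close> and then by a test function, each for the function and for the
  derivative.\<close>

lemma H10_limit:
  assumes "0 < L" "weak_deriv L g g'"
    and "\<And>n::nat. f n \<in> H10 L" "\<And>n. weak_deriv L (f n) (f' n)"
    and "(\<lambda>n. L2_norm L (\<lambda>x. f n x - g x)) \<longlonglongrightarrow> 0" "(\<lambda>n. L2_norm L (\<lambda>x. f' n x - g' x)) \<longlonglongrightarrow> 0"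
  shows "g \<in> H10 L"
  unfolding H10_def
proof (intro CollectI conjI allI impI)
  show "g \<in> H1 L" by (rule weak_deriv_H1[OF assms(2)])
  fix \<epsilon> :: real assume \<epsilon>: "0 < \<epsilon>"
  then have "\<forall>\<^sub>F n in sequentially. L2_norm L (\<lambda>x. f n x - g x) < \<epsilon> / 4 \<and> L2_norm L (\<lambda>x. f' n x - g' x) < \<epsilon> / 4"
    using order_tendstoD(2)[OF assms(5), of "\<epsilon> / 4"] order_tendstoD(2)[OF assms(6), of "\<epsilon> / 4"]
    by (simp add: eventually_conj)
  then obtain n where n: "L2_norm L (\<lambda>x. f n x - g x) < \<epsilon> / 4" "L2_norm L (\<lambda>x. f' n x - g' x) < \<epsilon> / 4"
    by (auto simp: eventually_sequentially)
  obtain \<phi> where \<phi>: "\<phi> \<in> test_functions L" "L2_norm L (\<lambda>x. f n x - \<phi> x) < \<epsilon> / 4"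
    "L2_norm L (\<lambda>x. f' n x - deriv \<phi> x) < \<epsilon> / 4"
    using H10_approx[OF assms(1) assms(3) assms(4), of "\<epsilon> / 4"] \<epsilon> by auto
  note L2s = weak_deriv_L2[OF assms(2)] weak_deriv_L2[OF assms(4), of n]
    test_function_L2[OF \<phi>(1)] test_function_L2[OF deriv_test_function[OF \<phi>(1)]]
  have "H1_norm L (\<lambda>x. g x - \<phi> x) \<le> L2_norm L (\<lambda>x. g x - \<phi> x) + L2_norm L (\<lambda>x. g' x - deriv \<phi> x)"
    by (intro H1_norm_le_sum weak_deriv_diff assms weak_deriv_of_test_function \<phi>)
  also have "L2_norm L (\<lambda>x. g x - \<phi> x) \<le> L2_norm L (\<lambda>x. g x - f n x) + L2_norm L (\<lambda>x. f n x - \<phi> x)"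
    by (rule L2_norm_triangle3) (use L2s in auto)
  also have "L2_norm L (\<lambda>x. g' x - deriv \<phi> x) \<le> L2_norm L (\<lambda>x. g' x - f' n x) + L2_norm L (\<lambda>x. f' n x - deriv \<phi> x)"
    by (rule L2_norm_triangle3) (use L2s in auto)
  finally show "\<exists>\<phi>\<in>test_functions L. H1_norm L (\<lambda>x. g x - \<phi> x) < \<epsilon>"
    using n \<phi> L2_norm_diff_commute[of L g "f n"] L2_norm_diff_commute[of L g' "f' n"]
    by (intro bexI[of _ \<phi>]) auto
qed

lemma test_functions_linear:
  assumes "\<phi> \<in> test_functions L" "\<psi> \<in> test_functions L"
  shows "(\<lambda>x. r * \<phi> x + s * \<psi> x) \<in> test_functions L"
    "deriv (\<lambda>x. r * \<phi> x + s * \<psi> x) = (\<lambda>x. r * deriv \<phi> x + s * deriv \<psi> x)"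
proof -
  have D: "((\<lambda>x. r * f x + s * g x) has_real_derivative r * deriv f x + s * deriv g x) (at x)"
    if "f \<in> test_functions L" "g \<in> test_functions L" for f g x
    by (intro DERIV_add DERIV_cmult test_function_deriv[OF that(1)] test_function_deriv[OF that(2)])
  show "deriv (\<lambda>x. r * \<phi> x + s * \<psi> x) = (\<lambda>x. r * deriv \<phi> x + s * deriv \<psi> x)"
    using D[OF assms] by (intro ext DERIV_imp_deriv)
  \<comment> \<open>The set of all such combinations is closed under differentiation, so its members
    are smooth.\<close>
  define P where "P = {(\<lambda>x. r * f x + s * g x) | f g. f \<in> test_functions L \<and> g \<in> test_functions L}"
  have "\<exists>h'\<in>P. \<forall>x. (h has_real_derivative h' x) (at x)" if hP: "h \<in> P" for h
  proof -
    obtain f g where fg: "f \<in> test_functions L" "g \<in> test_functions L" and h: "h = (\<lambda>x. r * f x + s * g x)"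
      using hP by (auto simp: P_def)
    have "(\<lambda>x. r * deriv f x + s * deriv g x) \<in> P"
      unfolding P_def using fg[THEN deriv_test_function]
      by (intro CollectI exI[of _ "deriv f"] exI[of _ "deriv g"]) auto
    then show ?thesis
      unfolding h by (rule bexI[rotated]) (intro allI D fg)
  qed
  moreover have "(\<lambda>x. r * \<phi> x + s * \<psi> x) \<in> P" using assms by (auto simp: P_def)
  ultimately have "(deriv ^^ k) (\<lambda>x. r * \<phi> x + s * \<psi> x) differentiable_on UNIV" for k
    by (rule smooth_of_closed_under_deriv(2))
  moreover obtain K where "compact K" "K \<subseteq> {0<..<L}" "\<And>x. x \<notin> K \<Longrightarrow> \<phi> x = 0"
    using assms by (auto simp: test_functions_def)
  moreover obtain K' where "compact K'" "K' \<subseteq> {0<..<L}" "\<And>x. x \<notin> K' \<Longrightarrow> \<psi> x = 0"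
    using assms by (auto simp: test_functions_def)
  ultimately show "(\<lambda>x. r * \<phi> x + s * \<psi> x) \<in> test_functions L"
    unfolding test_functions_def by (intro CollectI conjI exI[of _ "K \<union> K'"]) auto
qed

lemma test_functions_zero: "(\<lambda>x. 0) \<in> test_functions L"
proof -
  have "(deriv ^^ k) (\<lambda>x::real. 0::real) = (\<lambda>x. 0)" for k
    by (induction k) simp_all
  then show ?thesis unfolding test_functions_def by (intro CollectI conjI exI[of _ "{}"]) auto
qed

lemma H10_zero: "0 < L \<Longrightarrow> (\<lambda>x. 0) \<in> H10 L"
  unfolding H10_def
  using weak_deriv_H1[OF weak_deriv_zero] H1_norm_eq[OF weak_deriv_zero, of L]
  by (auto intro!: bexI[OF _ test_functions_zero])

lemma H10_linear:
  assumes "0 < L" "f \<in> H10 L" "g \<in> H10 L"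
  shows "(\<lambda>x. r * f x + s * g x) \<in> H10 L"
proof -
  obtain f' g' where w: "weak_deriv L f f'" "weak_deriv L g g'"
    using assms(2,3)[THEN H10_H1] by (auto simp: H1_def)
  show ?thesis unfolding H10_def
  proof (intro CollectI conjI allI impI)
    show "(\<lambda>x. r * f x + s * g x) \<in> H1 L"
      by (rule weak_deriv_H1[OF weak_deriv_add[OF weak_deriv_scale[OF w(1)] weak_deriv_scale[OF w(2)]]])
    fix \<epsilon> :: real assume \<epsilon>: "0 < \<epsilon>"
    \<comment> \<open>Function and derivative together cost at most 2 (|r| + |s|) times delta; the
      summand 1 keeps the denominator positive.\<close>
    define \<delta> where "\<delta> = \<epsilon> / (4 * (\<bar>r\<bar> + \<bar>s\<bar> + 1))"
    have \<delta>: "0 < \<delta>" using \<epsilon> by (auto simp: \<delta>_def intro!: divide_pos_pos)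
    have \<delta>': "(2 * \<bar>r\<bar> + 2 * \<bar>s\<bar>) * \<delta> < \<epsilon>"
    proof -
      have "(2 * \<bar>r\<bar> + 2 * \<bar>s\<bar>) * \<delta> \<le> (2 * (\<bar>r\<bar> + \<bar>s\<bar> + 1)) * \<delta>" using \<delta> by (intro mult_right_mono) auto
      also have "\<dots> = \<epsilon> / 2" using abs_ge_zero[of r] abs_ge_zero[of s] by (simp add: \<delta>_def field_simps)
      finally show ?thesis using \<epsilon> by simp
    qed
    obtain \<phi> where \<phi>: "\<phi> \<in> test_functions L" "L2_norm L (\<lambda>x. f x - \<phi> x) < \<delta>" "L2_norm L (\<lambda>x. f' x - deriv \<phi> x) < \<delta>"
      using H10_approx[OF assms(1,2) w(1) \<delta>] by auto
    obtain \<psi> where \<psi>: "\<psi> \<in> test_functions L" "L2_norm L (\<lambda>x. g x - \<psi> x) < \<delta>" "L2_norm L (\<lambda>x. g' x - deriv \<psi> x) < \<delta>"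
      using H10_approx[OF assms(1,3) w(2) \<delta>] by auto
    let ?F = "\<lambda>x. r * (f x - \<phi> x) + s * (g x - \<psi> x)"
    let ?F' = "\<lambda>x. r * (f' x - deriv \<phi> x) + s * (g' x - deriv \<psi> x)"
    have tr: "L2_norm L (\<lambda>x. r * u x + s * v x) \<le> (\<bar>r\<bar> + \<bar>s\<bar>) * \<delta>"
      if "u \<in> L2 L" "v \<in> L2 L" "L2_norm L u < \<delta>" "L2_norm L v < \<delta>" for u v
    proof -
      have "L2_norm L (\<lambda>x. r * u x + s * v x) \<le> \<bar>r\<bar> * L2_norm L u + \<bar>s\<bar> * L2_norm L v"
        using L2_norm_triangle[OF L2_scale[OF that(1), of r] L2_scale[OF that(2), of s]] by simp
      also have "\<dots> \<le> \<bar>r\<bar> * \<delta> + \<bar>s\<bar> * \<delta>" using that by (intro add_mono mult_left_mono) auto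
      finally show ?thesis by (simp add: algebra_simps)
    qed
    have wd: "weak_deriv L (\<lambda>x. f x - \<phi> x) (\<lambda>x. f' x - deriv \<phi> x)"
      "weak_deriv L (\<lambda>x. g x - \<psi> x) (\<lambda>x. g' x - deriv \<psi> x)"
      by (intro weak_deriv_diff w weak_deriv_of_test_function assms \<phi> \<psi>)+
    have "H1_norm L ?F \<le> L2_norm L ?F + L2_norm L ?F'"
      by (rule H1_norm_le_sum[OF weak_deriv_add[OF weak_deriv_scale[OF wd(1)] weak_deriv_scale[OF wd(2)]]])
    also have "\<dots> \<le> (\<bar>r\<bar> + \<bar>s\<bar>) * \<delta> + (\<bar>r\<bar> + \<bar>s\<bar>) * \<delta>"
      by (intro add_mono tr \<phi> \<psi> weak_deriv_L2[OF wd(1)] weak_deriv_L2[OF wd(2)])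
    also have "\<dots> < \<epsilon>" using \<delta>' by (simp add: algebra_simps)
    finally have "H1_norm L (\<lambda>x. r * f x + s * g x - (r * \<phi> x + s * \<psi> x)) < \<epsilon>"
      by (simp add: algebra_simps)
    then show "\<exists>\<phi>\<in>test_functions L. H1_norm L (\<lambda>x. r * f x + s * g x - \<phi> x) < \<epsilon>"
      by (intro bexI[of _ "\<lambda>x. r * \<phi> x + s * \<psi> x"] test_functions_linear \<phi> \<psi>)
  qed
qed

lemma H10_sum:
  assumes "0 < L" "\<And>i. i \<in> I \<Longrightarrow> f i \<in> H10 L"
  shows "(\<lambda>x. \<Sum>i\<in>I. r i * f i x) \<in> H10 L"
  using assms(2)
proof (induction I rule: infinite_finite_induct)
  case (insert i I)
  then show ?case using H10_linear[OF assms(1), of "f i" "\<lambda>x. \<Sum>i\<in>I. r i * f i x" "r i" 1] by auto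
qed (auto intro: H10_zero[OF assms(1)])

section \<open>Absolutely continuous representatives and unique continuation\<close>

text \<open>Primitives on the whole line have two-sided derivatives everywhere, which spares all
  later integral formulas and differential equations a separate treatment of endpoints.\<close>

lemma antiderivative_on_line:
  fixes f :: "real \<Rightarrow> real"
  assumes "continuous_on UNIV f"
  obtains F where "\<And>x. (F has_real_derivative f x) (at x)"
proof -
  have "\<exists>F. \<forall>x::real. -\<infinity> < ereal x \<longrightarrow> ereal x < \<infinity> \<longrightarrow> (F has_vector_derivative f x) (at x)"
    by (rule einterval_antiderivative) (use assms in \<open>auto simp: continuous_on_eq_continuous_at\<close>)
  then show ?thesis
    using that by (auto simp: has_real_derivative_iff_has_vector_derivative)
qed

lemma compact_subset_interval:
  fixes K :: "real set"
  assumes "compact K" "K \<subseteq> {0<..<L}" "0 < L"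
  obtains m M where "0 < m" "M < L" "K \<subseteq> {m..M}"
proof (cases "K = {}")
  case True
  then show ?thesis using that[of "L/2" "L/2"] assms by auto
next
  case False
  obtain m where "m \<in> K" "\<And>x. x \<in> K \<Longrightarrow> m \<le> x" using compact_attains_inf[OF assms(1) False] by auto
  moreover obtain M where "M \<in> K" "\<And>x. x \<in> K \<Longrightarrow> x \<le> M" using compact_attains_sup[OF assms(1) False] by auto
  ultimately show ?thesis
    using assms(2) by (intro that[of m M]) (auto simp: subset_iff)
qed

text \<open>A primitive of a test function is constant on either side of the support. Normalisation
  at 0 makes it vanish on the left, the zero mean makes it vanish on the right, so it is again a
  test function.\<close>

lemma antiderivative_test_function:
  assumes "0 < L" and \<phi>: "\<phi> \<in> test_functions L" and "L2_inner L \<phi> (\<lambda>x. 1) = 0"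
  obtains \<Phi> where "\<Phi> \<in> test_functions L" "deriv \<Phi> = \<phi>"
proof -
  obtain F where F: "\<And>x. (F has_real_derivative \<phi> x) (at x)"
    using antiderivative_on_line[OF test_function_continuous[OF \<phi>]] by auto
  define \<Phi> where "\<Phi> x = F x - F 0" for x
  have D: "(\<Phi> has_real_derivative \<phi> x) (at x)" for x
    unfolding \<Phi>_def by (rule DERIV_cong[OF DERIV_diff[OF F DERIV_const]]) simp
  have \<Phi>L: "\<Phi> L = 0"
    using LINT_interval_FTC[OF _ F test_function_continuous[OF \<phi>], of L] assms(1,3)
    by (simp add: \<Phi>_def L2_inner_def)
  obtain K where K: "compact K" "K \<subseteq> {0<..<L}" "\<And>x. x \<notin> K \<Longrightarrow> \<phi> x = 0"
    using \<phi> by (auto simp: test_functions_def)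
  obtain m M where mM: "0 < m" "M < L" "K \<subseteq> {m..M}"
    using compact_subset_interval[OF K(1,2) assms(1)] by metis
  have zero: "\<Phi> x = 0" if x: "x \<notin> {m..M}" for x
  proof -
    have const: "\<exists>k. \<forall>y\<in>S. \<Phi> y = k" if "convex S" "S \<inter> {m..M} = {}" for S
    proof (rule has_field_derivative_zero_constant[OF that(1)])
      fix y assume "y \<in> S"
      then have "\<phi> y = 0" using that K(3) mM(3) by auto
      then show "(\<Phi> has_real_derivative 0) (at y within S)"
        using D[of y] by (auto intro: has_field_derivative_at_within)
    qed
    consider "x < m" | "M < x" using x by force
    then show ?thesis
    proof cases
      case 1
      have "{..<m} \<inter> {m..M} = {}" by auto
      then obtain k where "\<forall>y\<in>{..<m}. \<Phi> y = k" using const[of "{..<m}"] by auto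
      then show ?thesis using 1 mM(1) by (metis \<Phi>_def cancel_comm_monoid_add_class.diff_cancel lessThan_iff)
    next
      case 2
      have "{M<..} \<inter> {m..M} = {}" by auto
      then obtain k where "\<forall>y\<in>{M<..}. \<Phi> y = k" using const[of "{M<..}"] by auto
      then show ?thesis using 2 mM(2) \<Phi>L by (metis greaterThan_iff)
    qed
  qed
  \<comment> \<open>Adding \<open>\<Phi>\<close> to the test functions keeps the set closed under
    differentiation, which gives smoothness.\<close>
  have "\<exists>f'\<in>insert \<Phi> (test_functions L). \<forall>x. (f has_real_derivative f' x) (at x)"
    if "f \<in> insert \<Phi> (test_functions L)" for f
  proof (cases "f = \<Phi>")
    case True
    then show ?thesis using D \<phi> by (intro bexI[of _ \<phi>]) auto
  next
    case False
    then show ?thesis using that test_function_deriv deriv_test_function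
      by (intro bexI[of _ "deriv f"]) auto
  qed
  then have "(deriv ^^ k) \<Phi> differentiable_on UNIV" for k
    by (rule smooth_of_closed_under_deriv(2)) auto
  then have "\<Phi> \<in> test_functions L"
    unfolding test_functions_def using zero mM by (intro CollectI conjI exI[of _ "{m..M}"]) auto
  moreover have "deriv \<Phi> = \<phi>" using D by (auto intro!: DERIV_imp_deriv)
  ultimately show ?thesis by (rule that)
qed

text \<open>Subtracting a multiple of one fixed bump of nonzero mean makes any test function a
  derivative of a test function, to which \<open>h\<close> is orthogonal. Hence pairing with
  \<open>h\<close> is a constant times taking the mean.\<close>

lemma du_Bois_Reymond:
  assumes "0 < L" and h: "weak_deriv L h (\<lambda>x. 0)"
  shows "\<exists>C. L2_eq L h (\<lambda>x. C)"
proof -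
  define \<beta> where "\<beta> = bump 1 (L/3) (2*L/3)"
  have \<beta>: "\<beta> \<in> test_functions L" unfolding \<beta>_def using assms(1) by (intro bump_test) auto
  define I where "I = L2_inner L \<beta> (\<lambda>x. 1)"
  have "I \<noteq> 0"
  proof
    assume "I = 0"
    then have "(LINT x|lebesgue_on {0<..<L}. \<beta> x) = 0" by (simp add: I_def L2_inner_def)
    then have "AE x in lebesgue_on {0<..<L}. \<beta> x = 0"
      using L2_integrable[OF test_function_L2[OF \<beta>]]
      by (subst (asm) integral_nonneg_eq_0_iff_AE) (auto simp: \<beta>_def bump_nonneg)
    then have "AE x in lebesgue. x \<in> {0<..<L} \<longrightarrow> \<beta> x = 0"
      by (simp add: AE_restrict_space_iff)
    then have "AE x in lebesgue. x \<notin> {L/3<..<2*L/3}"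
    proof eventually_elim
      case (elim x)
      then show ?case using bump_pos[of "L/3" x "2*L/3" 1] by (auto simp: \<beta>_def)
    qed
    then have "{L/3<..<2*L/3} \<in> null_sets lebesgue"
      by (subst AE_iff_null_sets) auto
    then have "emeasure lebesgue {L/3<..<2*L/3} = 0" by (rule null_setsD1)
    then show False using assms(1) by simp
  qed
  define C where "C = L2_inner L h \<beta> / I"
  have hL2: "h \<in> L2 L" by (rule weak_deriv_L2[OF h])
  have "L2_eq L (\<lambda>x. h x - C) (\<lambda>x. 0)"
  proof (rule L2_eq_zero_of_test_functions)
    fix \<phi> assume \<phi>: "\<phi> \<in> test_functions L"
    define r where "r = L2_inner L \<phi> (\<lambda>x. 1) / I"
    let ?\<psi> = "\<lambda>x. 1 * \<phi> x + (- r) * \<beta> x"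
    have \<psi>: "?\<psi> \<in> test_functions L" by (rule test_functions_linear[OF \<phi> \<beta>])
    have expand: "L2_inner L ?\<psi> k = L2_inner L \<phi> k - r * L2_inner L \<beta> k" if "k \<in> L2 L" for k
      using L2_inner_diff_left[OF test_function_L2[OF \<phi>] L2_scale[OF test_function_L2[OF \<beta>]] that, of r]
      by simp
    have "L2_inner L ?\<psi> (\<lambda>x. 1) = 0" using \<open>I \<noteq> 0\<close> by (subst expand) (auto simp: r_def I_def)
    then obtain \<Phi> where \<Phi>: "\<Phi> \<in> test_functions L" "deriv \<Phi> = ?\<psi>"
      using antiderivative_test_function[OF assms(1) \<psi>] by metis
    then have "L2_inner L ?\<psi> h = 0"
      using weak_deriv_test[OF h \<Phi>(1)] L2_inner_commute[of L h] unfolding \<Phi>(2) by simp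
    then have "L2_inner L \<phi> h = r * L2_inner L \<beta> h" using expand[OF hL2] by simp
    then show "L2_inner L (\<lambda>x. h x - C) \<phi> = 0"
      using L2_inner_diff_left[OF hL2 L2_const[of C L] test_function_L2[OF \<phi>]] \<open>I \<noteq> 0\<close>
        L2_inner_scale_left[of L C "\<lambda>x. 1" \<phi>]
      by (simp add: C_def r_def L2_inner_commute[of L "\<lambda>x. 1" \<phi>] L2_inner_commute[of L \<phi> h] L2_inner_commute[of L \<beta> h])
  qed (use hL2 in auto)
  then show ?thesis by (auto simp: L2_eq_def)
qed

text \<open>Integration by parts for the indefinite integral of a merely integrable
  \<open>g\<close>: after exchanging the order of integration the inner integral is that of \<psi>'
  from s to b.\<close>

lemma Fubini_indefinite:
  fixes g :: "real \<Rightarrow> real"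
  assumes "a \<le> b" and gi: "integrable lborel g"
    and \<psi>: "\<And>x. (\<psi> has_real_derivative \<psi>' x) (at x)" and \<psi>c: "continuous_on UNIV \<psi>'"
    and g0: "\<And>x. x \<notin> {a..b} \<Longrightarrow> g x = 0"
  shows "(LINT x|lborel. indicator {a..b} x * \<psi>' x * (LINT s|lborel. g s * indicator {..x} s))
       = (LINT s|lborel. g s * (\<psi> b - \<psi> s))"
proof -
  have [measurable]: "g \<in> borel_measurable borel" using borel_measurable_integrable[OF gi] by simp
  have [measurable]: "\<psi>' \<in> borel_measurable borel" by (rule borel_measurable_continuous_onI[OF \<psi>c])
  obtain M where M: "\<And>x. x \<in> {a..b} \<Longrightarrow> \<bar>\<psi>' x\<bar> \<le> M"
    using compact_imp_bounded[OF compact_continuous_image[OF continuous_on_subset[OF \<psi>c subset_UNIV] compact_Icc[of a b]]]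
    unfolding bounded_iff by (metis imageI real_norm_def)
  have M0: "0 \<le> M" using M[of a] assms(1) by force
  \<comment> \<open>Putting both indicators into the kernel makes it jointly measurable and
    dominated by |g s| M on the strip over the interval.\<close>
  define f where "f s x = g s * (indicator {..x} s * (indicator {a..b} x * \<psi>' x))" for s x
  have ind: "indicator {..x} s = (if s \<le> x then 1 else (0::real))" for s x :: real by auto
  have fm[measurable]: "case_prod f \<in> borel_measurable (lborel \<Otimes>\<^sub>M lborel)"
    unfolding f_def ind split_beta' by measurable
  have boxint: "integrable lborel (\<lambda>x. indicator {a..b} x * M)"
    using borel_integrable_atLeastAtMost'[of a b "\<lambda>_. M"] by (simp add: set_integrable_def)
  have fx: "integrable lborel (\<lambda>x. f s x)" for s
  proof (rule Bochner_Integration.integrable_bound[where f = "\<lambda>x. \<bar>g s\<bar> * (indicator {a..b} x * M)"])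
    show "AE x in lborel. norm (f s x) \<le> norm (\<bar>g s\<bar> * (indicator {a..b} x * M))"
      using M M0 by (intro AE_I2) (auto simp: f_def abs_mult indicator_def intro!: mult_left_mono)
  qed (use boxint in \<open>auto simp: f_def ind\<close>)
  have "integrable (lborel \<Otimes>\<^sub>M lborel) (case_prod f)"
  proof (rule lborel_pair.Fubini_integrable[OF fm])
    show "AE x in lborel. integrable lborel (\<lambda>y. case (x, y) of (x, xa) \<Rightarrow> f x xa)"
      using fx by auto
    show "integrable lborel (\<lambda>x. LBINT y. norm (case (x, y) of (x, xa) \<Rightarrow> f x xa))"
    proof (rule Bochner_Integration.integrable_bound[where f = "\<lambda>s. g s * (M * (b - a))"])
      show "AE s in lborel. norm (LBINT y. norm (case (s, y) of (x, xa) \<Rightarrow> f x xa)) \<le> norm (g s * (M * (b - a)))"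
      proof (intro AE_I2)
        fix s
        have "(LBINT y. norm (f s y)) \<le> (LBINT y. \<bar>g s\<bar> * (indicator {a..b} y * M))"
        proof (rule integral_mono)
          show "integrable lborel (\<lambda>y. norm (f s y))" by (rule integrable_norm[OF fx])
          show "integrable lborel (\<lambda>y. \<bar>g s\<bar> * (indicator {a..b} y * M))" using boxint by simp
          show "norm (f s y) \<le> \<bar>g s\<bar> * (indicator {a..b} y * M)" for y
            using M[of y] M0 by (auto simp: f_def abs_mult indicator_def intro!: mult_left_mono)
        qed
        also have "\<dots> = \<bar>g s\<bar> * (M * (b - a))" using assms(1) by simp
        finally show "norm (LBINT y. norm (case (s, y) of (x, xa) \<Rightarrow> f x xa)) \<le> norm (g s * (M * (b - a)))"
          using M0 assms(1) by (simp add: abs_mult)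
      qed
      show "integrable lborel (\<lambda>s. g s * (M * (b - a)))" using gi by simp
    qed measurable
  qed
  then have Fub: "(LINT x|lborel. LINT s|lborel. f s x) = (LINT s|lborel. LINT x|lborel. f s x)"
    by (rule lborel_pair.Fubini_integral)
  have "(LINT x|lborel. indicator {a..b} x * \<psi>' x * (LINT s|lborel. g s * indicator {..x} s))
      = (LINT x|lborel. LINT s|lborel. f s x)"
  proof (rule Bochner_Integration.integral_cong[OF refl])
    fix x
    have "(LINT s|lborel. f s x) = (LINT s|lborel. (indicator {a..b} x * \<psi>' x) * (g s * indicator {..x} s))"
      by (intro Bochner_Integration.integral_cong) (auto simp: f_def)
    then show "indicator {a..b} x * \<psi>' x * (LINT s|lborel. g s * indicator {..x} s) = (LINT s|lborel. f s x)"
      by simp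
  qed
  also note Fub
  also have "(LINT s|lborel. LINT x|lborel. f s x) = (LINT s|lborel. g s * (\<psi> b - \<psi> s))"
  proof (rule Bochner_Integration.integral_cong[OF refl])
    fix s
    show "(LINT x|lborel. f s x) = g s * (\<psi> b - \<psi> s)"
    proof (cases "s \<in> {a..b}")
      case True
      have "(LINT x|lborel. f s x) = (LINT x|lborel. g s * (indicator {s..b} x *\<^sub>R \<psi>' x))"
        using True by (intro Bochner_Integration.integral_cong) (auto simp: f_def indicator_def)
      also have "\<dots> = g s * (LINT x|lborel. indicator {s..b} x *\<^sub>R \<psi>' x)" by simp
      also have "(LINT x|lborel. indicator {s..b} x *\<^sub>R \<psi>' x) = \<psi> b - \<psi> s"
        using True \<psi> continuous_on_subset[OF \<psi>c]
        by (intro integral_FTC_Icc) (auto simp: has_real_derivative_iff_has_vector_derivative[symmetric]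
            intro: has_field_derivative_at_within)
      finally show ?thesis .
    qed (simp add: g0 f_def)
  qed
  finally show ?thesis .
qed

text \<open>The moving indicators converge except at the single point s = x, and |g|
  dominates.\<close>

lemma continuous_indefinite_integral:
  fixes g :: "real \<Rightarrow> real"
  assumes gi: "integrable lborel g"
  shows "continuous_on UNIV (\<lambda>x. LINT s|lborel. g s * indicator {..x} s)"
proof (intro continuous_at_imp_continuous_on ballI)
  fix x :: real
  have [measurable]: "g \<in> borel_measurable borel" using borel_measurable_integrable[OF gi] by simp
  show "isCont (\<lambda>x. LINT s|lborel. g s * indicator {..x} s) x"
    unfolding continuous_at_sequentially
  proof (intro allI impI)
    fix X :: "nat \<Rightarrow> real" assume X: "X \<longlonglongrightarrow> x"
    show "((\<lambda>x. LINT s|lborel. g s * indicator {..x} s) \<circ> X) \<longlonglongrightarrow> (LINT s|lborel. g s * indicator {..x} s)"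
      unfolding o_def
    proof (rule integral_dominated_convergence[where w = "\<lambda>s. \<bar>g s\<bar>"])
      show "AE s in lborel. (\<lambda>n. g s * indicator {..X n} s) \<longlonglongrightarrow> g s * indicator {..x} s"
        using AE_lborel_singleton[of x]
      proof eventually_elim
        case (elim s)
        consider "s < x" | "x < s" using elim by linarith
        then have "\<forall>\<^sub>F n in sequentially. (indicator {..x} s :: real) = indicator {..X n} s"
        proof cases
          case 1
          show ?thesis using order_tendstoD(1)[OF X 1] by eventually_elim (use 1 in auto)
        next
          case 2
          show ?thesis using order_tendstoD(2)[OF X 2] by eventually_elim (use 2 in auto)
        qed
        then have "(\<lambda>n. indicator {..X n} s) \<longlonglongrightarrow> (indicator {..x} s :: real)"
          by (rule Lim_transform_eventually[OF tendsto_const])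
        then show ?case by (rule tendsto_mult_left)
      qed
    qed (use gi in \<open>auto simp: indicator_def\<close>)
  qed
qed

text \<open>The indefinite integral G of \<open>g\<close> is continuous and has weak derivative
  \<open>g\<close>, so f - G is constant by du Bois-Reymond. The last clause is integration by parts
  with boundary terms; through it F 0 and F L act as the traces of \<open>f\<close>.\<close>

lemma H1_representative:
  assumes L: "0 < L" and fg: "weak_deriv L f g"
  obtains F where "continuous_on UNIV F" "L2_eq L f F"
    "\<And>x. x \<in> {0..L} \<Longrightarrow> F L - F x = L2_inner L g (indicator {x<..})"
    "\<And>\<psi> \<psi>'. (\<And>x. (\<psi> has_real_derivative \<psi>' x) (at x)) \<Longrightarrow> continuous_on UNIV \<psi>' \<Longrightarrow>
      L2_inner L f \<psi>' + L2_inner L g \<psi> = F L * \<psi> L - F 0 * \<psi> 0"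
proof -
  note L2s = weak_deriv_L2[OF fg]
  obtain h where hm[measurable]: "h \<in> borel_measurable borel" and hi: "integrable lborel h"
    and h0: "\<And>x. x \<notin> {0<..<L} \<Longrightarrow> h x = 0"
    and "AE x in lebesgue_on {0<..<L}. g x = h x"
    and heq: "\<And>k :: real \<Rightarrow> real. k \<in> borel_measurable borel \<Longrightarrow>
      (LINT x|lebesgue_on {0<..<L}. g x * k x) = (LINT x|lborel. h x * k x)"
    by (rule borel_version[OF _ L2_integrable[OF L2s(2)]]) (simp, rule that, assumption+)
  define G where "G x = (LINT s|lborel. h s * indicator {..x} s)" for x
  have Gc: "continuous_on UNIV G" unfolding G_def by (rule continuous_indefinite_integral[OF hi])
  have [measurable]: "G \<in> borel_measurable borel" by (rule borel_measurable_continuous_onI[OF Gc])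
  have GL2: "G \<in> L2 L" by (rule L2_continuous[OF Gc])
  have G0: "G 0 = 0"
  proof -
    have "h s * indicator {..0} s = 0" for s using h0[of s] by (auto simp: indicator_def)
    then show ?thesis unfolding G_def by (simp only: integral_zero)
  qed
  have GL: "G L = L2_inner L g (\<lambda>x. 1)"
  proof -
    have "G L = (LINT s|lborel. h s * 1)"
      unfolding G_def using h0 by (intro Bochner_Integration.integral_cong) (auto simp: indicator_def)
    then show ?thesis using heq[of "\<lambda>x. 1"] by (simp add: L2_inner_def)
  qed
  have parts: "L2_inner L G \<psi>' = G L * \<psi> L - L2_inner L g \<psi>"
    if \<psi>: "\<And>x. (\<psi> has_real_derivative \<psi>' x) (at x)" and \<psi>c: "continuous_on UNIV \<psi>'" for \<psi> \<psi>'
  proof -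
    have \<psi>cont: "continuous_on UNIV \<psi>" by (meson DERIV_continuous continuous_at_imp_continuous_on \<psi>)
    have [measurable]: "\<psi> \<in> borel_measurable borel" "\<psi>' \<in> borel_measurable borel"
      by (auto intro!: borel_measurable_continuous_onI \<psi>cont \<psi>c)
    have "L2_inner L G \<psi>' = (LINT x|lebesgue. indicator {0<..<L} x * (G x * \<psi>' x))"
      unfolding L2_inner_def by (subst integral_restrict_space) auto
    also have "\<dots> = (LINT x|lborel. indicator {0<..<L} x * (G x * \<psi>' x))"
      by (rule integral_completion) measurable
    also have "\<dots> = (LINT x|lborel. indicator {0..L} x * \<psi>' x * G x)"
    proof (rule integral_cong_AE)
      show "AE x in lborel. indicator {0<..<L} x * (G x * \<psi>' x) = indicator {0..L} x * \<psi>' x * G x"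
        using AE_lborel_singleton[of 0] AE_lborel_singleton[of L]
        by eventually_elim (auto simp: indicator_def)
    qed measurable
    also have "\<dots> = (LINT s|lborel. h s * (\<psi> L - \<psi> s))"
      unfolding G_def using L h0 by (intro Fubini_indefinite hi \<psi> \<psi>c) auto
    also have "\<dots> = L2_inner L g (\<lambda>s. \<psi> L - \<psi> s)"
      using heq[of "\<lambda>s. \<psi> L - \<psi> s"] by (simp add: L2_inner_def)
    also have "\<dots> = L2_inner L g (\<lambda>s. \<psi> L) - L2_inner L g \<psi>"
      by (intro L2_inner_diff_right L2_const L2_continuous \<psi>cont L2s)
    also have "L2_inner L g (\<lambda>s. \<psi> L) = G L * \<psi> L"
      using L2_inner_scale_right[of L g "\<psi> L" "\<lambda>x. 1"] by (simp add: GL)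
    finally show ?thesis .
  qed
  have "weak_deriv L G g"
    unfolding weak_deriv_def
  proof (intro conjI ballI GL2 L2s)
    fix \<phi> assume \<phi>: "\<phi> \<in> test_functions L"
    show "L2_inner L G (deriv \<phi>) = - L2_inner L g \<phi>"
      using parts[OF test_function_deriv[OF \<phi>] test_function_continuous[OF deriv_test_function[OF \<phi>]]]
        test_function_zero[OF \<phi>, of L] by simp
  qed
  from weak_deriv_diff[OF fg this] have "weak_deriv L (\<lambda>x. f x - G x) (\<lambda>x. 0)" by simp
  then obtain C where C: "L2_eq L (\<lambda>x. f x - G x) (\<lambda>x. C)"
    using du_Bois_Reymond[OF L] by blast
  define F where "F x = C + G x" for x
  have Fc: "continuous_on UNIV F" unfolding F_def by (intro continuous_intros Gc)
  have fF: "L2_eq L f F"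
    using C unfolding L2_eq_def by eventually_elim (simp add: F_def algebra_simps)
  show ?thesis
  proof (rule that[OF Fc fF])
    fix x assume x: "x \<in> {0..L}"
    have "F L - F x = (LINT s|lborel. h s * indicator {..L} s - h s * indicator {..x} s)"
      using integrable_mult_indicator[of "{..L}" lborel h] integrable_mult_indicator[of "{..x}" lborel h] hi
      by (simp add: F_def G_def mult.commute)
    also have "\<dots> = (LINT s|lborel. h s * indicator {x<..} s)"
      using x h0 by (intro Bochner_Integration.integral_cong) (auto simp: indicator_def)
    also have "\<dots> = L2_inner L g (indicator {x<..})"
      using heq[of "indicator {x<..}"] by (simp add: L2_inner_def)
    finally show "F L - F x = L2_inner L g (indicator {x<..})" .
  next
    fix \<psi> \<psi>' assume \<psi>: "\<And>x. (\<psi> has_real_derivative \<psi>' x) (at x)" and \<psi>c: "continuous_on UNIV \<psi>'"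
    have one: "L2_inner L (\<lambda>x. C) \<psi>' = C * (\<psi> L - \<psi> 0)"
      using LINT_interval_FTC[OF _ \<psi> \<psi>c, of L] L L2_inner_scale_left[of L C "\<lambda>x. 1" \<psi>']
      by (simp add: L2_inner_def)
    have "L2_inner L f \<psi>' = L2_inner L F \<psi>'"
      by (rule L2_inner_cong[OF _ _ _ fF]) (use L2s Fc \<psi>c in \<open>auto intro: L2_continuous\<close>)
    also have "\<dots> = L2_inner L (\<lambda>x. C) \<psi>' + L2_inner L G \<psi>'"
      unfolding F_def by (intro L2_inner_add_left L2_const GL2 L2_continuous \<psi>c)
    finally show "L2_inner L f \<psi>' + L2_inner L g \<psi> = F L * \<psi> L - F 0 * \<psi> 0"
      using parts[OF \<psi> \<psi>c] one by (simp add: F_def G0 algebra_simps)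
  qed
qed

text \<open>The tail integral T of N satisfies T' = - N \<ge> - K T, so exp (K x) T x is
  nondecreasing and reaches 0 at b. Hence T \<le> 0, and the hypothesis bounds N by K T.\<close>

lemma backward_Gronwall:
  fixes N :: "real \<Rightarrow> real"
  assumes N: "continuous_on UNIV N" "\<And>x. 0 \<le> N x"
    and ineq: "\<And>x. x \<in> {a..b} \<Longrightarrow> N x \<le> K * (LINT s|lborel. indicator {x..b} s * N s)" and "0 \<le> K" and x: "x \<in> {a..b}"
  shows "N x = 0"
proof -
  obtain \<Phi> where \<Phi>: "\<And>x. (\<Phi> has_real_derivative N x) (at x)"
    using antiderivative_on_line[OF N(1)] by auto
  have G: "(LINT s|lborel. indicator {x..b} s * N s) = \<Phi> b - \<Phi> x" if "x \<le> b" for x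
    using integral_FTC_Icc[of x b \<Phi> N] that \<Phi> continuous_on_subset[OF N(1)]
    by (simp add: has_real_derivative_iff_has_vector_derivative[symmetric] has_field_derivative_at_within)
  have "exp (K * x) * (\<Phi> b - \<Phi> x) \<le> exp (K * b) * (\<Phi> b - \<Phi> b)"
  proof (rule DERIV_nonneg_imp_nondecreasing[where f = "\<lambda>x. exp (K * x) * (\<Phi> b - \<Phi> x)"])
    fix y assume y: "x \<le> y" "y \<le> b"
    have "((\<lambda>x. exp (K * x) * (\<Phi> b - \<Phi> x)) has_real_derivative exp (K * y) * (K * (\<Phi> b - \<Phi> y) - N y)) (at y)"
      by (auto intro!: derivative_eq_intros \<Phi> simp: algebra_simps)
    moreover have "0 \<le> exp (K * y) * (K * (\<Phi> b - \<Phi> y) - N y)"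
      using ineq[of y] G[of y] x y by simp
    ultimately show "\<exists>d. ((\<lambda>x. exp (K * x) * (\<Phi> b - \<Phi> x)) has_real_derivative d) (at y) \<and> 0 \<le> d" by blast
  qed (use x in auto)
  then have "\<Phi> b - \<Phi> x \<le> 0" by (simp add: mult_le_0_iff)
  then have "K * (\<Phi> b - \<Phi> x) \<le> 0" using assms(4) by (simp add: mult_nonneg_nonpos)
  then show "N x = 0" using ineq[OF x] G[of x] x N(2)[of x] by simp
qed

text \<open>The hypothesis on \<open>q\<close> says that \<open>f'\<close> vanishes at \<open>L\<close>, as \<open>f\<close> itself does.\<close>

lemma unique_continuation:
  assumes L: "0 < L" and c: "c \<in> L_infty L" and f: "f \<in> H10 L" "weak_deriv L f p" "weak_deriv L p q"
    and eq: "L2_eq L (\<lambda>x. \<nu> * f x) (\<lambda>x. q x + c x * f x)"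
    and q0: "L2_inner L q (\<lambda>x. x) = 0"
  shows "L2_norm L f = 0"
proof -
  obtain F where Fc: "continuous_on UNIV F" and fF: "L2_eq L f F"
    and F: "\<And>x. x \<in> {0..L} \<Longrightarrow> F L - F x = L2_inner L p (indicator {x<..})"
    and FP: "\<And>\<psi> \<psi>'. (\<And>x. (\<psi> has_real_derivative \<psi>' x) (at x)) \<Longrightarrow> continuous_on UNIV \<psi>' \<Longrightarrow>
      L2_inner L f \<psi>' + L2_inner L p \<psi> = F L * \<psi> L - F 0 * \<psi> 0"
    using H1_representative[OF L f(2)] by metis
  obtain P where Pc: "continuous_on UNIV P" and pP: "L2_eq L p P"
    and P: "\<And>x. x \<in> {0..L} \<Longrightarrow> P L - P x = L2_inner L q (indicator {x<..})"
    and PP: "\<And>\<psi> \<psi>'. (\<And>x. (\<psi> has_real_derivative \<psi>' x) (at x)) \<Longrightarrow> continuous_on UNIV \<psi>' \<Longrightarrow>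
      L2_inner L p \<psi>' + L2_inner L q \<psi> = P L * \<psi> L - P 0 * \<psi> 0"
    using H1_representative[OF L f(3)] by metis
  have wx: "weak_deriv L (\<lambda>x. x) (\<lambda>x. 1)" by (rule weak_deriv_C1[OF L]) auto
  have w1: "weak_deriv L (\<lambda>x. 1) (\<lambda>x. 0)" by (rule weak_deriv_C1[OF L]) auto
  \<comment> \<open>The two integration-by-parts formulas for the test polynomial x differ exactly
    by the boundary term F L times L.\<close>
  have FL: "F L = 0"
    using FP[of "\<lambda>x. x" "\<lambda>x. 1"] H10_IBP[OF L f(1,2) wx] L by auto
  \<comment> \<open>Testing with x leaves P L times L; the integral of \<open>p\<close> is 0 because
    \<open>f\<close> is in \<open>H10\<close>, and the other term is \<open>q0\<close>.\<close>
  have PL: "P L = 0"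
    using PP[of "\<lambda>x. x" "\<lambda>x. 1"] H10_IBP[OF L f(1,2) w1] q0 L by auto
  obtain M where M: "AE x in lebesgue_on {0<..<L}. \<bar>c x\<bar> \<le> M"
    using c by (auto simp: L_infty_def)
  define K where "K = 1 + \<bar>\<nu>\<bar> + \<bar>M\<bar>"
  \<comment> \<open>The second order equation as a first order system: F' = P and P' = (\<nu> - c)
    F, with zero data at L. The constant \<open>K\<close> bounds both coefficients.\<close>
  define N where "N x = \<bar>F x\<bar> + \<bar>P x\<bar>" for x
  have Nc: "continuous_on UNIV N" unfolding N_def by (intro continuous_intros Fc Pc)
  have bound: "\<bar>L2_inner L r (indicator {x<..})\<bar> \<le> R * (LINT s|lborel. indicator {x..L} s * k s)"
    if r: "r \<in> L2 L" and kc: "continuous_on UNIV k" and x: "x \<in> {0..L}"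
      and rk: "AE s in lebesgue_on {0<..<L}. \<bar>r s\<bar> \<le> R * k s" for r k R x
  proof -
    have indm: "indicator {x<..} \<in> borel_measurable (lebesgue_on {0<..<L})"
    proof -
      have "indicator {x<..} \<in> borel_measurable (borel :: real measure)" by simp
      then show ?thesis by (simp add: measurable_completion measurable_restrict_space1)
    qed
    have indL2: "indicator {x<..} \<in> L2 L"
      by (rule L2_bounded[OF indm, of 1]) (auto simp: indicator_def)
    have [measurable]: "k \<in> borel_measurable borel" by (rule borel_measurable_continuous_onI[OF kc])
    have "\<bar>L2_inner L r (indicator {x<..})\<bar> \<le> (LINT s|lebesgue_on {0<..<L}. \<bar>r s * indicator {x<..} s\<bar>)"
      unfolding L2_inner_def by (rule integral_abs_bound)
    also have "\<dots> \<le> (LINT s|lebesgue_on {0<..<L}. (R * k s) * indicator {x<..} s)"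
    proof (rule integral_mono_AE)
      show "integrable (lebesgue_on {0<..<L}) (\<lambda>s. \<bar>r s * indicator {x<..} s\<bar>)"
        using L2_mult_integrable[OF r indL2] by simp
      show "integrable (lebesgue_on {0<..<L}) (\<lambda>s. (R * k s) * indicator {x<..} s)"
        by (intro L2_mult_integrable indL2 L2_scale L2_continuous kc)
      show "AE s in lebesgue_on {0<..<L}. \<bar>r s * indicator {x<..} s\<bar> \<le> (R * k s) * indicator {x<..} s"
        using rk by eventually_elim (auto simp: indicator_def)
    qed
    also have "\<dots> = (LINT s|lebesgue. indicator {0<..<L} s * (R * k s * indicator {x<..} s))"
      by (subst integral_restrict_space) auto
    also have "\<dots> = (LINT s|lborel. indicator {0<..<L} s * (R * k s * indicator {x<..} s))"
      by (rule integral_completion) measurable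
    also have "\<dots> = (LINT s|lborel. R * (indicator {x..L} s * k s))"
    proof (rule integral_cong_AE)
      show "AE s in lborel. indicator {0<..<L} s * (R * k s * indicator {x<..} s) = R * (indicator {x..L} s * k s)"
        using AE_lborel_singleton[of x] AE_lborel_singleton[of L]
        by eventually_elim (use x in \<open>auto simp: indicator_def\<close>)
    qed measurable
    finally show ?thesis by simp
  qed
  have qN: "AE s in lebesgue_on {0<..<L}. \<bar>q s\<bar> \<le> (\<bar>\<nu>\<bar> + \<bar>M\<bar>) * \<bar>F s\<bar>"
    using eq fF M unfolding L2_eq_def
  proof eventually_elim
    case (elim s)
    then have "q s = (\<nu> - c s) * F s" by (simp add: algebra_simps)
    then have "\<bar>q s\<bar> = \<bar>\<nu> - c s\<bar> * \<bar>F s\<bar>" by (simp add: abs_mult)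
    also have "\<dots> \<le> (\<bar>\<nu>\<bar> + \<bar>M\<bar>) * \<bar>F s\<bar>" using elim by (intro mult_right_mono) auto
    finally show ?case .
  qed
  have pN: "AE s in lebesgue_on {0<..<L}. \<bar>p s\<bar> \<le> 1 * \<bar>P s\<bar>"
    using pP unfolding L2_eq_def by eventually_elim simp
  have Nzero: "N x = 0" if "x \<in> {0..L}" for x
  proof (rule backward_Gronwall[where N = N and K = K, OF Nc _ _ _ that])
    fix x assume x: "x \<in> {0..L}"
    have intk: "integrable lborel (\<lambda>s. indicator {x..L} s * k s)" if "continuous_on UNIV k" for k :: "real \<Rightarrow> real"
      using borel_integrable_atLeastAtMost'[OF continuous_on_subset[OF that], of x L] by (simp add: set_integrable_def)
    have "N x \<le> 1 * (LINT s|lborel. indicator {x..L} s * \<bar>P s\<bar>) + (\<bar>\<nu>\<bar> + \<bar>M\<bar>) * (LINT s|lborel. indicator {x..L} s * \<bar>F s\<bar>)"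
      unfolding N_def
      using bound[OF weak_deriv_L2(2)[OF f(2)] _ x pN] bound[OF weak_deriv_L2(2)[OF f(3)] _ x qN]
        F[OF x] P[OF x] FL PL continuous_on_rabs[OF Fc] continuous_on_rabs[OF Pc] by auto
    also have "\<dots> \<le> K * (LINT s|lborel. indicator {x..L} s * \<bar>P s\<bar>) + K * (LINT s|lborel. indicator {x..L} s * \<bar>F s\<bar>)"
      by (intro add_mono mult_right_mono Bochner_Integration.integral_nonneg) (auto simp: K_def)
    also have "\<dots> = K * (LINT s|lborel. indicator {x..L} s * N s)"
      using intk[OF continuous_on_rabs[OF Fc]] intk[OF continuous_on_rabs[OF Pc]]
      by (simp add: N_def ring_distribs)
    finally show "N x \<le> K * (LINT s|lborel. indicator {x..L} s * N s)" .
  qed (auto simp: N_def K_def)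
  have "L2_eq L f (\<lambda>x. 0)"
    using fF AE_space[of "lebesgue_on {0<..<L}"] unfolding L2_eq_def
  proof eventually_elim
    case (elim x)
    then have "N x = 0" using Nzero[of x] by simp
    with elim show ?case by (simp add: N_def)
  qed
  then show ?thesis using L2_eq_iff_norm[of f L "\<lambda>x. 0"] weak_deriv_L2[OF f(2)] by simp
qed

section \<open>Fourier expansion and the operator $A$\<close>

text \<open>Dominated convergence for series, along a general filter and for limits zero.\<close>

lemma tannery_null:
  fixes a :: "'b \<Rightarrow> nat \<Rightarrow> real"
  assumes "\<And>k. ((\<lambda>h. a h k) \<longlongrightarrow> 0) F" "\<forall>\<^sub>F h in F. \<forall>k. \<bar>a h k\<bar> \<le> G k" "summable G" "F \<noteq> bot"
  shows "((\<lambda>h. \<Sum>k. a h k) \<longlongrightarrow> 0) F"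
proof -
  have "\<forall>\<^sub>F (k, h) in at_top \<times>\<^sub>F F. norm (a h k) \<le> G k"
    unfolding eventually_prod_filter
    by (rule exI[of _ "\<lambda>_. True"], rule exI[of _ "\<lambda>h. \<forall>k. \<bar>a h k\<bar> \<le> G k"]) (use assms(2) in auto)
  from tannerys_theorem[OF assms(1) this assms(3,4)] show ?thesis by simp
qed

locale spectral =
  fixes L :: real and c :: "real \<Rightarrow> real" and e :: "nat \<Rightarrow> real \<Rightarrow> real" and lam :: "nat \<Rightarrow> real"
  assumes L_pos: "L > 0" and c_bounded: "c \<in> L_infty L"
    and basis: "hilbert_basis L e"
    and eigen: "\<And>j. j \<ge> 1 \<Longrightarrow> A_graph L c (e j) (\<lambda>x. lam j * e j x)"
    and decreasing: "\<And>j. j \<ge> 1 \<Longrightarrow> lam (Suc j) < lam j"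
    and to_minus_infinity: "filterlim lam at_bot sequentially"
begin

text \<open>The basis is numbered from 1; the shift lets coefficient series run over all natural
  numbers.\<close>

abbreviation E :: "nat \<Rightarrow> real \<Rightarrow> real" where "E j \<equiv> e (Suc j)"
abbreviation la :: "nat \<Rightarrow> real" where "la j \<equiv> lam (Suc j)"

definition fourier :: "(real \<Rightarrow> real) \<Rightarrow> nat \<Rightarrow> real" where
  "fourier f j = L2_inner L f (E j)"

definition expand :: "(nat \<Rightarrow> real) \<Rightarrow> nat set \<Rightarrow> real \<Rightarrow> real" where
  "expand r I x = (\<Sum>j\<in>I. r j * E j x)"

lemma E_L2 [simp, intro]: "E j \<in> L2 L"
  using basis by (auto simp: hilbert_basis_def)

lemma E_orthonormal: "L2_inner L (E i) (E j) = (if i = j then 1 else 0)"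
  using basis by (auto simp: hilbert_basis_def)

lemma la_strict: "i < j \<Longrightarrow> la j < la i"
proof (induction j)
  case (Suc j)
  then show ?case using decreasing[of "Suc j"] by (cases "i = j") auto
qed simp

lemma la_le: "i \<le> j \<Longrightarrow> la j \<le> la i"
  using la_strict[of i j] by (cases "i = j") auto

lemma expand_L2 [intro]: "expand r I \<in> L2 L"
  unfolding expand_def[abs_def] by (intro L2_sum L2_scale E_L2)

lemma inner_expand:
  assumes "v \<in> L2 L"
  shows "L2_inner L (expand r I) v = (\<Sum>j\<in>I. r j * fourier v j)"
  unfolding expand_def[abs_def] fourier_def
  by (subst L2_inner_sum_left) (use assms in \<open>auto simp: L2_inner_commute[of L v]\<close>)

lemma fourier_expand: "finite I \<Longrightarrow> fourier (expand r I) k = (if k \<in> I then r k else 0)"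
proof -
  assume "finite I"
  have "fourier (expand r I) k = (\<Sum>j\<in>I. r j * fourier (E k) j)"
    unfolding fourier_def[of "expand r I"] by (rule inner_expand) auto
  also have "\<dots> = (\<Sum>j\<in>I. if j = k then r k else 0)"
    by (rule sum.cong) (auto simp: fourier_def E_orthonormal)
  finally show ?thesis using \<open>finite I\<close> by simp
qed

lemma norm_expand: "finite I \<Longrightarrow> (L2_norm L (expand r I))\<^sup>2 = (\<Sum>j\<in>I. (r j)\<^sup>2)"
  using inner_expand[OF expand_L2, of r I r I] fourier_expand[of I r]
  unfolding L2_norm_power2 by (simp add: power2_eq_square)

lemma fourier_diff: "f \<in> L2 L \<Longrightarrow> g \<in> L2 L \<Longrightarrow> fourier (\<lambda>x. f x - g x) j = fourier f j - fourier g j"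
  by (simp add: fourier_def L2_inner_diff_left)

lemma fourier_add: "f \<in> L2 L \<Longrightarrow> g \<in> L2 L \<Longrightarrow> fourier (\<lambda>x. f x + g x) j = fourier f j + fourier g j"
  by (simp add: fourier_def L2_inner_add_left)

lemma fourier_scale: "fourier (\<lambda>x. r * f x) j = r * fourier f j"
  by (simp add: fourier_def)

lemma fourier_E: "fourier (E i) j = (if i = j then 1 else 0)"
  by (simp add: fourier_def E_orthonormal)

lemma fourier_cong: "f \<in> L2 L \<Longrightarrow> g \<in> L2 L \<Longrightarrow> L2_eq L f g \<Longrightarrow> fourier f j = fourier g j"
  unfolding fourier_def by (rule L2_inner_cong) auto

text \<open>Completing the square. Only the last sum depends on \<open>r\<close>, so the Fourier
  coefficients give the best approximation among all combinations of the first N modes.\<close>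

lemma norm_diff_expand:
  assumes "f \<in> L2 L"
  shows "(L2_norm L (\<lambda>x. f x - expand r {..<N} x))\<^sup>2
    = (L2_norm L f)\<^sup>2 - (\<Sum>j<N. (fourier f j)\<^sup>2) + (\<Sum>j<N. (r j - fourier f j)\<^sup>2)"
proof -
  have "(L2_norm L (\<lambda>x. f x + (- 1) * expand r {..<N} x))\<^sup>2
      = (L2_norm L f)\<^sup>2 + 2 * L2_inner L f (\<lambda>x. (- 1) * expand r {..<N} x) + (L2_norm L (\<lambda>x. (- 1) * expand r {..<N} x))\<^sup>2"
    by (rule L2_norm_power2_add[OF assms L2_scale[OF expand_L2]])
  also have "\<dots> = (L2_norm L f)\<^sup>2 - 2 * (\<Sum>j<N. r j * fourier f j) + (\<Sum>j<N. (r j)\<^sup>2)"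
    unfolding L2_inner_scale_right L2_norm_scale L2_inner_commute[of L f] inner_expand[OF assms]
    by (simp add: norm_expand)
  also have "\<dots> = (L2_norm L f)\<^sup>2 - (\<Sum>j<N. (fourier f j)\<^sup>2) + (\<Sum>j<N. (r j - fourier f j)\<^sup>2)"
    by (simp add: power2_diff sum.distrib sum_subtractf sum_distrib_left algebra_simps)
  finally show ?thesis by simp
qed

text \<open>\<open>hilbert_basis\<close> provides only some good combination for each epsilon. By
  best approximation the Fourier sum of the same length is at least as good, and longer Fourier sums
  are better still.\<close>

lemma expansion_tendsto:
  assumes f: "f \<in> L2 L"
  shows "(\<lambda>N. L2_norm L (\<lambda>x. expand (fourier f) {..<N} x - f x)) \<longlonglongrightarrow> 0"
proof (rule LIMSEQ_I)
  fix \<epsilon> :: real assume \<epsilon>: "0 < \<epsilon>"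
  obtain N0 r where r: "L2_norm L (\<lambda>x. f x - (\<Sum>j=1..N0. r j * e j x)) < \<epsilon>"
    using basis f \<epsilon> unfolding hilbert_basis_def by blast
  have "(\<Sum>j=1..N0. r j * e j x) = expand (\<lambda>j. r (Suc j)) {..<N0} x" for x
    unfolding expand_def by (rule sum.reindex_bij_witness[of _ Suc "\<lambda>j. j - 1"]) auto
  with r have r': "L2_norm L (\<lambda>x. f x - expand (\<lambda>j. r (Suc j)) {..<N0} x) < \<epsilon>" by simp
  have "L2_norm L (\<lambda>x. expand (fourier f) {..<N} x - f x) < \<epsilon>" if "N \<ge> N0" for N
  proof -
    have "(L2_norm L (\<lambda>x. expand (fourier f) {..<N} x - f x))\<^sup>2 = (L2_norm L f)\<^sup>2 - (\<Sum>j<N. (fourier f j)\<^sup>2)"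
      using norm_diff_expand[OF f, of "fourier f" N] L2_norm_diff_commute[of L f] by simp
    also have "\<dots> \<le> (L2_norm L f)\<^sup>2 - (\<Sum>j<N0. (fourier f j)\<^sup>2)"
      using sum_mono2[of "{..<N}" "{..<N0}" "\<lambda>j. (fourier f j)\<^sup>2"] that by auto
    also have "\<dots> \<le> (L2_norm L (\<lambda>x. f x - expand (\<lambda>j. r (Suc j)) {..<N0} x))\<^sup>2"
      unfolding norm_diff_expand[OF f] by (simp add: sum_nonneg)
    finally have "L2_norm L (\<lambda>x. expand (fourier f) {..<N} x - f x) \<le> L2_norm L (\<lambda>x. f x - expand (\<lambda>j. r (Suc j)) {..<N0} x)"
      by (rule power2_le_imp_le) simp
    with r' show ?thesis by linarith
  qed
  then show "\<exists>no. \<forall>n\<ge>no. norm (L2_norm L (\<lambda>x. expand (fourier f) {..<n} x - f x) - 0) < \<epsilon>" by auto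
qed

lemma Parseval_inner:
  assumes "f \<in> L2 L" "g \<in> L2 L"
  shows "(\<lambda>j. fourier f j * fourier g j) sums L2_inner L f g"
proof -
  have "(\<lambda>N. L2_inner L (expand (fourier f) {..<N}) g) \<longlonglongrightarrow> L2_inner L f g"
    by (rule L2_inner_tendsto[OF _ assms expansion_tendsto[OF assms(1)]]) (auto intro!: always_eventually)
  then show ?thesis by (simp add: sums_def inner_expand[OF assms(2)])
qed

lemma Parseval: "f \<in> L2 L \<Longrightarrow> (\<lambda>j. (fourier f j)\<^sup>2) sums (L2_norm L f)\<^sup>2"
  using Parseval_inner[of f f] unfolding L2_norm_power2 by (simp add: power2_eq_square)

lemma fourier_square_summable: "f \<in> L2 L \<Longrightarrow> summable (\<lambda>j. (fourier f j)\<^sup>2)"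
  using Parseval by (rule sums_summable)

lemma fourier_le_norm: "f \<in> L2 L \<Longrightarrow> \<bar>fourier f j\<bar> \<le> L2_norm L f"
  using L2_Cauchy_Schwarz[of f L "E j"] L2_norm_power2[of L "E j"]
  by (simp add: fourier_def E_orthonormal power2_eq_1_iff L2_norm_def)

lemma L2_eq_of_coeff:
  assumes "f \<in> L2 L" "g \<in> L2 L" "\<And>j. fourier f j = fourier g j"
  shows "L2_eq L f g"
proof -
  have "(\<lambda>j. 0) sums (L2_norm L (\<lambda>x. f x - g x))\<^sup>2"
    using Parseval[OF L2_diff[OF assms(1,2)]] assms by (simp add: fourier_diff)
  then have "(L2_norm L (\<lambda>x. f x - g x))\<^sup>2 = 0" by (metis sums_unique2 sums_zero)
  then show ?thesis using L2_eq_iff_norm assms by simp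
qed

text \<open>Serves two series: the expansion itself with K = 1, and the expansion of the derivative,
  whose tails are controlled by the energy with K = 1 + \<open>c_bound\<close>.\<close>

lemma Cauchy_of_tail:
  fixes G :: "nat \<Rightarrow> real"
  assumes G: "summable G" "\<And>j. 0 \<le> G j" and "0 \<le> K" and "0 < \<epsilon>"
    and u: "\<And>m n. m \<le> n \<Longrightarrow> (L2_norm L (\<lambda>x. u n x - u m x))\<^sup>2 \<le> K * (\<Sum>j\<in>{m..<n}. G j)"
  shows "\<exists>N. \<forall>m\<ge>N. \<forall>n\<ge>m. L2_norm L (\<lambda>x. u n x - u m x) < \<epsilon>"
proof -
  \<comment> \<open>K may be 0, hence K + 1 in the denominator.\<close>
  have "0 < \<epsilon>\<^sup>2 / (K + 1)" using assms by simp
  then obtain N where N: "\<And>m n. m \<ge> N \<Longrightarrow> norm (sum G {m..<n}) < \<epsilon>\<^sup>2 / (K + 1)"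
    using G(1) unfolding summable_Cauchy by blast
  have "L2_norm L (\<lambda>x. u n x - u m x) < \<epsilon>" if "m \<ge> N" "n \<ge> m" for m n
  proof (rule power2_less_imp_less)
    have "sum G {m..<n} < \<epsilon>\<^sup>2 / (K + 1)" using N[OF that(1), of n] by auto
    then have "(K + 1) * sum G {m..<n} < \<epsilon>\<^sup>2" using assms(3) by (simp add: field_simps)
    moreover have "0 \<le> sum G {m..<n}" by (simp add: G sum_nonneg)
    ultimately show "(L2_norm L (\<lambda>x. u n x - u m x))\<^sup>2 < \<epsilon>\<^sup>2"
      using u[OF that(2)] by (simp add: ring_distribs)
  qed (use assms in simp)
  then show ?thesis by blast
qed

lemma expand_tail: "m \<le> n \<Longrightarrow> expand r {..<n} x - expand r {..<m} x = expand r {m..<n} x"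
  unfolding expand_def lessThan_atLeast0
  using sum.atLeastLessThan_concat[of 0 m n "\<lambda>j. r j * E j x"] by simp

lemma Riesz_Fischer:
  assumes "summable (\<lambda>j. (r j)\<^sup>2)"
  shows "\<exists>f\<in>L2 L. \<forall>j. fourier f j = r j"
proof -
  have "\<exists>f\<in>L2 L. (\<lambda>n. L2_norm L (\<lambda>x. expand r {..<n} x - f x)) \<longlonglongrightarrow> 0"
  proof (rule L2_complete)
    fix \<epsilon> :: real assume "0 < \<epsilon>"
    then show "\<exists>N. \<forall>m\<ge>N. \<forall>n\<ge>m. L2_norm L (\<lambda>x. expand r {..<n} x - expand r {..<m} x) < \<epsilon>"
      by (intro Cauchy_of_tail[OF assms, of 1]) (simp_all add: expand_tail norm_expand)
  qed auto
  then obtain f where f: "f \<in> L2 L" "(\<lambda>n. L2_norm L (\<lambda>x. expand r {..<n} x - f x)) \<longlonglongrightarrow> 0" by blast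
  have "fourier f j = r j" for j
  proof -
    have "(\<lambda>n. fourier (expand r {..<n}) j) \<longlonglongrightarrow> fourier f j"
      unfolding fourier_def by (rule L2_inner_tendsto[OF _ f(1) _ f(2)]) (auto intro!: always_eventually)
    moreover have "(\<lambda>n. fourier (expand r {..<n}) j) \<longlonglongrightarrow> r j"
      by (rule tendsto_eventually) (auto simp: fourier_expand eventually_sequentially intro!: exI[of _ "Suc j"])
    ultimately show ?thesis by (rule LIMSEQ_unique)
  qed
  with f(1) show ?thesis by blast
qed

text \<open>A right inverse of \<open>fourier\<close>, by choice because coefficients determine a
  function only almost everywhere. It is meaningful for square summable sequences and arbitrary
  otherwise.\<close>

definition synth :: "(nat \<Rightarrow> real) \<Rightarrow> real \<Rightarrow> real" where
  "synth r = (SOME f. f \<in> L2 L \<and> (\<forall>j. fourier f j = r j))"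

lemma synth:
  assumes "summable (\<lambda>j. (r j)\<^sup>2)"
  shows "synth r \<in> L2 L" "fourier (synth r) j = r j"
proof -
  have "synth r \<in> L2 L \<and> (\<forall>j. fourier (synth r) j = r j)"
    unfolding synth_def
    by (rule someI_ex[where P = "\<lambda>f. f \<in> L2 L \<and> (\<forall>j. fourier f j = r j)"])
       (use Riesz_Fischer[OF assms] in blast)
  then show "synth r \<in> L2 L" "fourier (synth r) j = r j" by auto
qed

text \<open>Parseval turns the norm into a series, and dominated convergence allows the limit in
  each mode. Strong continuity of the semigroup, its generator and continuity in time of the state
  all reduce to this.\<close>

lemma norm_tendsto_0_of_coeff:
  assumes "\<forall>\<^sub>F h in F. u h \<in> L2 L" "\<And>j. ((\<lambda>h. fourier (u h) j) \<longlongrightarrow> 0) F"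
    and "\<forall>\<^sub>F h in F. \<forall>j. \<bar>fourier (u h) j\<bar> \<le> G j" "summable (\<lambda>j. (G j)\<^sup>2)" "F \<noteq> bot"
  shows "((\<lambda>h. L2_norm L (u h)) \<longlongrightarrow> 0) F"
proof -
  have "((\<lambda>h. \<Sum>j. (fourier (u h) j)\<^sup>2) \<longlongrightarrow> 0) F"
  proof (rule tannery_null[OF _ _ assms(4,5)])
    show "((\<lambda>h. (fourier (u h) j)\<^sup>2) \<longlongrightarrow> 0) F" for j
      using tendsto_power[OF assms(2)[of j], of 2] by simp
    show "\<forall>\<^sub>F h in F. \<forall>j. \<bar>(fourier (u h) j)\<^sup>2\<bar> \<le> (G j)\<^sup>2"
      using assms(3) by eventually_elim (metis abs_ge_zero abs_power2 power2_abs power_mono)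
  qed
  then have "((\<lambda>h. sqrt (\<Sum>j. (fourier (u h) j)\<^sup>2)) \<longlongrightarrow> sqrt 0) F" by (rule tendsto_real_sqrt)
  moreover have "\<forall>\<^sub>F h in F. sqrt (\<Sum>j. (fourier (u h) j)\<^sup>2) = L2_norm L (u h)"
    using assms(1)
  proof eventually_elim
    case (elim h)
    then show ?case using sums_unique[OF Parseval[OF elim], symmetric] by simp
  qed
  ultimately show ?thesis by (auto intro: Lim_transform_eventually)
qed

section \<open>The operator A in Fourier coordinates\<close>

definition E1 :: "nat \<Rightarrow> real \<Rightarrow> real" where
  "E1 j = (SOME p. \<exists>q. weak_deriv L (E j) p \<and> weak_deriv L p q \<and> L2_eq L (\<lambda>x. la j * E j x) (\<lambda>x. q x + c x * E j x))"

definition E2 :: "nat \<Rightarrow> real \<Rightarrow> real" where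
  "E2 j = (SOME q. weak_deriv L (E1 j) q \<and> L2_eq L (\<lambda>x. la j * E j x) (\<lambda>x. q x + c x * E j x))"

lemma E_H10: "E j \<in> H10 L"
  using eigen[of "Suc j"] by (simp add: A_graph_def)

lemma E1_E2:
  "weak_deriv L (E j) (E1 j)" "weak_deriv L (E1 j) (E2 j)"
  "L2_eq L (\<lambda>x. la j * E j x) (\<lambda>x. E2 j x + c x * E j x)"
proof -
  have "\<exists>p q. weak_deriv L (E j) p \<and> weak_deriv L p q \<and> L2_eq L (\<lambda>x. la j * E j x) (\<lambda>x. q x + c x * E j x)"
    using eigen[of "Suc j"] by (auto simp: A_graph_def)
  then have 1: "\<exists>q. weak_deriv L (E j) (E1 j) \<and> weak_deriv L (E1 j) q \<and> L2_eq L (\<lambda>x. la j * E j x) (\<lambda>x. q x + c x * E j x)"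
    unfolding E1_def by (rule someI_ex)
  then show "weak_deriv L (E j) (E1 j)" by blast
  from 1 have "\<exists>q. weak_deriv L (E1 j) q \<and> L2_eq L (\<lambda>x. la j * E j x) (\<lambda>x. q x + c x * E j x)" by blast
  then have "weak_deriv L (E1 j) (E2 j) \<and> L2_eq L (\<lambda>x. la j * E j x) (\<lambda>x. E2 j x + c x * E j x)"
    unfolding E2_def by (rule someI_ex)
  then show "weak_deriv L (E1 j) (E2 j)" "L2_eq L (\<lambda>x. la j * E j x) (\<lambda>x. E2 j x + c x * E j x)" by auto
qed

lemma E2_L2 [simp, intro]: "E2 j \<in> L2 L" and E1_L2 [simp, intro]: "E1 j \<in> L2 L"
  using weak_deriv_L2[OF E1_E2(2)] by auto

lemma c_mult_L2 [intro]: "f \<in> L2 L \<Longrightarrow> (\<lambda>x. c x * f x) \<in> L2 L"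
  by (rule L_infty_mult_L2[OF c_bounded])

lemma inner_c_mult: "L2_inner L (\<lambda>x. c x * f x) g = L2_inner L f (\<lambda>x. c x * g x)"
  by (simp add: L2_inner_def mult_ac)

text \<open>The eigenvalue equation tested with \<open>v\<close>, the potential being moved over to
  \<open>v\<close>. With v = x it yields the control coefficient, with v a finite expansion the
  energy identity.\<close>

lemma inner_E2:
  assumes "v \<in> L2 L"
  shows "L2_inner L (E2 j) v = la j * fourier v j - L2_inner L (\<lambda>x. c x * v x) (E j)"
proof -
  have "L2_inner L (\<lambda>x. la j * E j x) v = L2_inner L (\<lambda>x. E2 j x + c x * E j x) v"
    by (rule L2_inner_cong[OF _ _ assms E1_E2(3)]) (intro L2_add L2_scale c_mult_L2 E2_L2 E_L2)+
  also have "\<dots> = L2_inner L (E2 j) v + L2_inner L (\<lambda>x. c x * E j x) v"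
    by (intro L2_inner_add_left c_mult_L2 E2_L2 E_L2 assms)
  finally show ?thesis
    using L2_inner_commute[of L v "E j"] L2_inner_commute[of L "\<lambda>x. c x * v x" "E j"]
      inner_c_mult[of "E j" v] by (simp add: fourier_def)
qed

text \<open>The operator is symmetric, so eigenfunctions diagonalise its graph.\<close>

lemma A_graph_coeff:
  assumes A: "A_graph L c f g" and g: "g \<in> L2 L"
  shows "fourier g j = la j * fourier f j"
proof -
  obtain p q where f: "f \<in> H10 L" "weak_deriv L f p" "weak_deriv L p q" and gq: "L2_eq L g (\<lambda>x. q x + c x * f x)"
    using A by (auto simp: A_graph_def)
  note L2s = weak_deriv_L2[OF f(2)] weak_deriv_L2[OF f(3)]
  have "fourier g j = L2_inner L (\<lambda>x. q x + c x * f x) (E j)"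
    unfolding fourier_def by (rule L2_inner_cong[OF g _ _ gq]) (intro L2_add c_mult_L2 E_L2 L2s)+
  also have "\<dots> = L2_inner L q (E j) + L2_inner L (\<lambda>x. c x * f x) (E j)"
    by (intro L2_inner_add_left c_mult_L2 E_L2 L2s)
  \<comment> \<open>Two integrations by parts: this one uses the boundary condition of
    \<open>E j\<close>, the next one that of \<open>f\<close>.\<close>
  also have "L2_inner L q (E j) = - L2_inner L (E1 j) p"
    using H10_IBP[OF L_pos E_H10 E1_E2(1) f(3), of j] by (simp add: L2_inner_commute)
  also have "- L2_inner L (E1 j) p = L2_inner L (E2 j) f"
    using H10_IBP[OF L_pos f(1,2) E1_E2(2), of j] by (simp add: L2_inner_commute)
  finally show ?thesis using inner_E2[OF L2s(1), of j] by simp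
qed

lemma expand_deriv: "weak_deriv L (expand r I) (\<lambda>x. \<Sum>j\<in>I. r j * E1 j x)"
  unfolding expand_def[abs_def] by (intro weak_deriv_sum weak_deriv_scale E1_E2)

lemma expand_deriv_L2 [simp, intro]: "(\<lambda>x. \<Sum>j\<in>I. r j * E1 j x) \<in> L2 L"
  by (rule weak_deriv_L2(2)[OF expand_deriv])

lemma expand_deriv2: "weak_deriv L (\<lambda>x. \<Sum>j\<in>I. r j * E1 j x) (\<lambda>x. \<Sum>j\<in>I. r j * E2 j x)"
  by (intro weak_deriv_sum weak_deriv_scale E1_E2)

lemma expand_H10: "expand r I \<in> H10 L"
  unfolding expand_def[abs_def] by (rule H10_sum[OF L_pos E_H10])

definition c_bound :: real where
  "c_bound = (SOME M. 0 \<le> M \<and> (\<forall>f\<in>L2 L. L2_norm L (\<lambda>x. c x * f x) \<le> M * L2_norm L f))"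

lemma c_bound: "0 \<le> c_bound" "f \<in> L2 L \<Longrightarrow> L2_norm L (\<lambda>x. c x * f x) \<le> c_bound * L2_norm L f"
proof -
  have "0 \<le> c_bound \<and> (\<forall>f\<in>L2 L. L2_norm L (\<lambda>x. c x * f x) \<le> c_bound * L2_norm L f)"
    unfolding c_bound_def by (rule someI_ex) (use L2_norm_mult_L_infty[OF c_bounded] in auto)
  then show "0 \<le> c_bound" "f \<in> L2 L \<Longrightarrow> L2_norm L (\<lambda>x. c x * f x) \<le> c_bound * L2_norm L f" by auto
qed

text \<open>Integrating by parts once, the squared norm of p' equals the pairing of p with c p minus
  the sum of la j (r j)^2. The first term is bounded through \<open>c_bound\<close>, the second
  through |la j|; the weight 1 + |la j| covers both.\<close>

lemma energy_expand:
  assumes "finite I"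
  shows "(L2_norm L (\<lambda>x. \<Sum>j\<in>I. r j * E1 j x))\<^sup>2 \<le> (1 + c_bound) * (\<Sum>j\<in>I. (1 + \<bar>la j\<bar>) * (r j)\<^sup>2)"
proof -
  let ?p = "expand r I" and ?p' = "\<lambda>x. \<Sum>j\<in>I. r j * E1 j x" and ?p'' = "\<lambda>x. \<Sum>j\<in>I. r j * E2 j x"
  have "(L2_norm L ?p')\<^sup>2 = - L2_inner L ?p ?p''"
    using H10_IBP[OF L_pos expand_H10 expand_deriv expand_deriv2] by (simp add: L2_norm_power2)
  also have "L2_inner L ?p ?p'' = (\<Sum>j\<in>I. r j * L2_inner L (E2 j) ?p)"
    by (subst L2_inner_sum_right) (auto simp: L2_inner_commute)
  also have "\<dots> = (\<Sum>j\<in>I. r j * (la j * r j - L2_inner L (\<lambda>x. c x * ?p x) (E j)))"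
    using assms by (intro sum.cong refl) (simp add: inner_E2[OF expand_L2] fourier_expand)
  also have "\<dots> = (\<Sum>j\<in>I. la j * (r j)\<^sup>2) - (\<Sum>j\<in>I. r j * fourier (\<lambda>x. c x * ?p x) j)"
    by (simp add: fourier_def algebra_simps sum_subtractf power2_eq_square)
  also have "(\<Sum>j\<in>I. r j * fourier (\<lambda>x. c x * ?p x) j) = L2_inner L ?p (\<lambda>x. c x * ?p x)"
    by (rule inner_expand[symmetric]) auto
  finally have eq: "(L2_norm L ?p')\<^sup>2 = L2_inner L ?p (\<lambda>x. c x * ?p x) - (\<Sum>j\<in>I. la j * (r j)\<^sup>2)" by simp
  have "L2_inner L ?p (\<lambda>x. c x * ?p x) \<le> L2_norm L ?p * (c_bound * L2_norm L ?p)"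
    using L2_Cauchy_Schwarz[OF expand_L2 c_mult_L2[OF expand_L2], of r I r I]
      mult_left_mono[OF c_bound(2)[OF expand_L2, of r I] L2_norm_nonneg[of L ?p]] by linarith
  also have "\<dots> = c_bound * (\<Sum>j\<in>I. (r j)\<^sup>2)" using norm_expand[OF assms, of r] by (simp add: power2_eq_square)
  finally have 1: "L2_inner L ?p (\<lambda>x. c x * ?p x) \<le> c_bound * (\<Sum>j\<in>I. (r j)\<^sup>2)" .
  have 2: "(\<Sum>j\<in>I. - la j * (r j)\<^sup>2) \<le> (\<Sum>j\<in>I. (1 + \<bar>la j\<bar>) * (r j)\<^sup>2)"
    by (intro sum_mono mult_right_mono) auto
  have 3: "c_bound * (\<Sum>j\<in>I. (r j)\<^sup>2) \<le> c_bound * (\<Sum>j\<in>I. (1 + \<bar>la j\<bar>) * (r j)\<^sup>2)"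
    by (intro mult_left_mono sum_mono c_bound) (simp add: algebra_simps)
  from 1 2 3 eq show ?thesis by (simp add: ring_distribs sum_negf)
qed

text \<open>The energy estimate applied to blocks of the series shows that the differentiated
  partial sums are Cauchy; closedness identifies their limit as the weak derivative. The convergence
  itself is exported because the second derivative is found by testing the partial sums.\<close>

lemma H10_of_coeff:
  assumes f: "f \<in> L2 L" and summ: "summable (\<lambda>j. (1 + \<bar>la j\<bar>) * (fourier f j)\<^sup>2)"
  obtains p where "weak_deriv L f p" "f \<in> H10 L"
    "(\<lambda>n. L2_norm L (\<lambda>x. (\<Sum>j<n. fourier f j * E1 j x) - p x)) \<longlonglongrightarrow> 0"
    "(L2_norm L p)\<^sup>2 \<le> (1 + c_bound) * (\<Sum>j. (1 + \<bar>la j\<bar>) * (fourier f j)\<^sup>2)"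
proof -
  let ?G = "\<lambda>j. (1 + \<bar>la j\<bar>) * (fourier f j)\<^sup>2"
  let ?u = "\<lambda>n x. \<Sum>j<n. fourier f j * E1 j x"
  have "\<exists>p\<in>L2 L. (\<lambda>n. L2_norm L (\<lambda>x. ?u n x - p x)) \<longlonglongrightarrow> 0"
  proof (rule L2_complete)
    fix \<epsilon> :: real assume "0 < \<epsilon>"
    then show "\<exists>N. \<forall>m\<ge>N. \<forall>n\<ge>m. L2_norm L (\<lambda>x. ?u n x - ?u m x) < \<epsilon>"
    proof (intro Cauchy_of_tail[OF summ, of "1 + c_bound"])
      fix m n :: nat assume "m \<le> n"
      then have "?u n x - ?u m x = (\<Sum>j\<in>{m..<n}. fourier f j * E1 j x)" for x
        unfolding lessThan_atLeast0
        using sum.atLeastLessThan_concat[of 0 m n "\<lambda>j. fourier f j * E1 j x"] by simp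
      then show "(L2_norm L (\<lambda>x. ?u n x - ?u m x))\<^sup>2 \<le> (1 + c_bound) * sum ?G {m..<n}"
        using energy_expand[of "{m..<n}" "fourier f"] by simp
    qed (use c_bound in auto)
  qed simp
  then obtain p where p: "p \<in> L2 L" "(\<lambda>n. L2_norm L (\<lambda>x. ?u n x - p x)) \<longlonglongrightarrow> 0" by blast
  have fp: "weak_deriv L f p"
    by (rule weak_deriv_closed[OF expand_deriv f p(1) expansion_tendsto[OF f] p(2)])
  moreover have "f \<in> H10 L"
    by (rule H10_limit[OF L_pos fp expand_H10 expand_deriv expansion_tendsto[OF f] p(2)])
  moreover have "(L2_norm L p)\<^sup>2 \<le> (1 + c_bound) * suminf ?G"
  proof (rule LIMSEQ_le_const2)
    show "(\<lambda>n. (L2_norm L (?u n))\<^sup>2) \<longlonglongrightarrow> (L2_norm L p)\<^sup>2"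
      by (intro tendsto_power L2_norm_tendsto[OF _ p]) simp
    have "(L2_norm L (?u n))\<^sup>2 \<le> (1 + c_bound) * suminf ?G" for n
    proof -
      have "(L2_norm L (?u n))\<^sup>2 \<le> (1 + c_bound) * sum ?G {..<n}"
        by (rule energy_expand) simp
      also have "\<dots> \<le> (1 + c_bound) * suminf ?G"
        by (intro mult_left_mono sum_le_suminf summ) (use c_bound in auto)
      finally show ?thesis .
    qed
    then show "\<exists>N. \<forall>n\<ge>N. (L2_norm L (?u n))\<^sup>2 \<le> (1 + c_bound) * suminf ?G" by blast
  qed
  ultimately show ?thesis using p(2) that by blast
qed

text \<open>In the constant 2 + \<open>c_bound\<close>, the function contributes 1 and its
  derivative 1 + \<open>c_bound\<close>.\<close>

lemma H1_norm_of_coeff: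
  assumes f: "f \<in> L2 L" and summ: "summable (\<lambda>j. (1 + \<bar>la j\<bar>) * (fourier f j)\<^sup>2)"
  shows "f \<in> H1 L" "H1_norm L f \<le> sqrt ((2 + c_bound) * (\<Sum>j. (1 + \<bar>la j\<bar>) * (fourier f j)\<^sup>2))"
proof -
  obtain p where p: "weak_deriv L f p" "(L2_norm L p)\<^sup>2 \<le> (1 + c_bound) * (\<Sum>j. (1 + \<bar>la j\<bar>) * (fourier f j)\<^sup>2)"
    by (rule H10_of_coeff[OF assms]) (rule that)
  show "f \<in> H1 L" by (rule weak_deriv_H1[OF p(1)])
  have "(L2_norm L f)\<^sup>2 = (\<Sum>j. (fourier f j)\<^sup>2)" by (rule sums_unique[OF Parseval[OF f]])
  also have "\<dots> \<le> (\<Sum>j. (1 + \<bar>la j\<bar>) * (fourier f j)\<^sup>2)"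
    by (intro suminf_le fourier_square_summable f summ) (simp add: algebra_simps)
  finally show "H1_norm L f \<le> sqrt ((2 + c_bound) * (\<Sum>j. (1 + \<bar>la j\<bar>) * (fourier f j)\<^sup>2))"
    unfolding H1_norm_eq[OF p(1)] using p(2) by (intro real_sqrt_le_mono) (simp add: ring_distribs)
qed

text \<open>Converse of \<open>A_graph_coeff\<close>: the domain contains every function whose
  coefficients allow it. Thus the diagonal semigroup constructed below has A itself as its
  generator, not a proper extension of A.\<close>

lemma A_graph_of_coeff:
  assumes f: "f \<in> L2 L" and g: "g \<in> L2 L" and eq: "\<And>j. fourier g j = la j * fourier f j"
  shows "A_graph L c f g"
proof -
  have "summable (\<lambda>j. 2 * (fourier f j)\<^sup>2 + (fourier g j)\<^sup>2)"
    by (intro summable_add summable_mult fourier_square_summable f g)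
  then have summ: "summable (\<lambda>j. (1 + \<bar>la j\<bar>) * (fourier f j)\<^sup>2)"
  proof (rule summable_comparison_test')
    fix j
    \<comment> \<open>The energy weight is dominated by the weights of \<open>f\<close> and
      \<open>g\<close>, which are square summable.\<close>
    have "\<bar>la j\<bar> \<le> 1 + (la j)\<^sup>2"
      using zero_le_power2[of "\<bar>la j\<bar> - 1"] abs_ge_zero[of "la j"] unfolding power2_diff by simp
    then have "(1 + \<bar>la j\<bar>) * (fourier f j)\<^sup>2 \<le> (2 + (la j)\<^sup>2) * (fourier f j)\<^sup>2"
      by (intro mult_right_mono) auto
    then show "norm ((1 + \<bar>la j\<bar>) * (fourier f j)\<^sup>2) \<le> 2 * (fourier f j)\<^sup>2 + (fourier g j)\<^sup>2"
      by (simp add: eq power_mult_distrib algebra_simps)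
  qed
  obtain p where fp: "weak_deriv L f p" and f0: "f \<in> H10 L"
    and lim: "(\<lambda>n. L2_norm L (\<lambda>x. (\<Sum>j<n. fourier f j * E1 j x) - p x)) \<longlonglongrightarrow> 0"
    by (rule H10_of_coeff[OF f summ]) (rule that)
  \<comment> \<open>The equation A f = g leaves no other candidate for the second derivative. It is
    verified by letting n tend to infinity in the identity for partial sums, where Parseval
    identifies the right-hand side.\<close>
  define q where "q x = g x - c x * f x" for x
  have qL2: "q \<in> L2 L" unfolding q_def[abs_def] by (intro L2_diff c_mult_L2 f g)
  have "weak_deriv L p q"
    unfolding weak_deriv_def
  proof (intro conjI ballI qL2 weak_deriv_L2(2)[OF fp])
    fix \<phi> assume \<phi>: "\<phi> \<in> test_functions L"
    note \<phi>L2 = test_function_L2[OF \<phi>] test_function_L2[OF deriv_test_function[OF \<phi>]]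
    let ?cf = "\<lambda>x. c x * \<phi> x"
    have cf: "?cf \<in> L2 L" using \<phi>L2 by auto
    have lim1: "(\<lambda>n. L2_inner L (\<lambda>x. \<Sum>j<n. fourier f j * E1 j x) (deriv \<phi>)) \<longlonglongrightarrow> L2_inner L p (deriv \<phi>)"
      by (rule L2_inner_tendsto[OF _ weak_deriv_L2(2)[OF fp] \<phi>L2(2) lim]) simp
    have partial: "L2_inner L (\<lambda>x. \<Sum>j<n. fourier f j * E1 j x) (deriv \<phi>)
        = - ((\<Sum>j<n. fourier g j * fourier \<phi> j) - (\<Sum>j<n. fourier f j * fourier ?cf j))" for n
    proof -
      have "L2_inner L (\<lambda>x. \<Sum>j<n. fourier f j * E1 j x) (deriv \<phi>) = - L2_inner L (\<lambda>x. \<Sum>j<n. fourier f j * E2 j x) \<phi>"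
        by (rule weak_deriv_test[OF expand_deriv2 \<phi>])
      also have "L2_inner L (\<lambda>x. \<Sum>j<n. fourier f j * E2 j x) \<phi> = (\<Sum>j<n. fourier f j * L2_inner L (E2 j) \<phi>)"
        by (subst L2_inner_sum_left) (use \<phi>L2 in auto)
      also have "\<dots> = (\<Sum>j<n. fourier g j * fourier \<phi> j - fourier f j * fourier ?cf j)"
        by (intro sum.cong refl) (simp add: inner_E2[OF \<phi>L2(1)] eq fourier_def[of ?cf] right_diff_distrib mult.assoc mult.left_commute)
      finally show ?thesis by (simp add: sum_subtractf)
    qed
    have lim2: "(\<lambda>n. - ((\<Sum>j<n. fourier g j * fourier \<phi> j) - (\<Sum>j<n. fourier f j * fourier ?cf j)))
        \<longlonglongrightarrow> - (L2_inner L g \<phi> - L2_inner L f ?cf)"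
      using Parseval_inner[OF g \<phi>L2(1)] Parseval_inner[OF f cf]
      by (intro tendsto_intros) (auto simp: sums_def)
    have "L2_inner L q \<phi> = L2_inner L g \<phi> - L2_inner L f ?cf"
      unfolding q_def[abs_def] using f g \<phi>L2 by (subst L2_inner_diff_left) (auto simp: inner_c_mult)
    then show "L2_inner L p (deriv \<phi>) = - L2_inner L q \<phi>"
      using LIMSEQ_unique[OF lim1[unfolded partial] lim2] by simp
  qed
  with f0 fp show ?thesis unfolding A_graph_def
    by (intro conjI exI[of _ p] exI[of _ q]) (auto simp: L2_eq_def q_def)
qed

lemma control_coeff_nonzero: "fourier (a_fun L c) j + la j * fourier (b_fun L) j \<noteq> 0"
proof
  assume zero: "fourier (a_fun L c) j + la j * fourier (b_fun L) j = 0"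
  have x: "(\<lambda>x::real. x) \<in> L2 L" by (rule L2_continuous) auto
  have a: "fourier (a_fun L c) j = L2_inner L (\<lambda>x. c x * x) (E j) / L"
    using L2_inner_scale_left[of L "1 / L" "\<lambda>x. c x * x" "E j"]
    by (simp add: fourier_def a_fun_def[abs_def] mult_ac)
  have b: "fourier (b_fun L) j = - fourier (\<lambda>x. x) j / L"
    using L2_inner_scale_left[of L "- 1 / L" "\<lambda>x. x" "E j"]
    by (simp add: fourier_def b_fun_def[abs_def])
  have "L2_inner L (E2 j) (\<lambda>x. x) = 0"
    using inner_E2[OF x, of j] zero L_pos by (simp add: a b field_simps)
  then have "L2_norm L (E j) = 0"
    by (rule unique_continuation[OF L_pos c_bounded E_H10 E1_E2])
  then show False using E_orthonormal[of j j] by (simp add: L2_norm_def)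
qed

end

section \<open>The semigroup generated by $A$\<close>

text \<open>Uniform in h, this is the majorant behind the generator computation. Both signs of
  \<open>l\<close> rest on 1 + x \<le> exp x; the factor exp |m| absorbs exp (l h) when
  \<open>l\<close> is nonnegative, with \<open>m\<close> the largest eigenvalue in the
  application.\<close>

lemma exp_difference_bound:
  fixes l h m :: real
  assumes "0 < h" "h \<le> 1" "l \<le> m"
  shows "\<bar>(exp (l * h) - 1) / h\<bar> \<le> \<bar>l\<bar> * exp \<bar>m\<bar>"
proof (cases "0 \<le> l")
  case True
  have "exp (l * h) - 1 = exp (l * h) * (1 - exp (- (l * h)))" by (simp add: exp_minus field_simps)
  also have "\<dots> \<le> exp (l * h) * (l * h)"
    using exp_ge_add_one_self[of "- (l * h)"] by (intro mult_left_mono) auto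
  also have "\<dots> \<le> exp \<bar>m\<bar> * (l * h)"
  proof (rule mult_right_mono)
    have "l * h \<le> l * 1" using True assms by (intro mult_left_mono) auto
    then show "exp (l * h) \<le> exp \<bar>m\<bar>" using assms by simp
  qed (use True assms in simp)
  finally have "exp (l * h) - 1 \<le> (l * exp \<bar>m\<bar>) * h" by (simp add: mult_ac)
  moreover have "0 \<le> exp (l * h) - 1" using True assms by simp
  ultimately show ?thesis using True assms by (simp add: divide_le_eq)
next
  case False
  have "1 - exp (l * h) \<le> - l * h" using exp_ge_add_one_self[of "l * h"] by linarith
  moreover have "exp (l * h) \<le> 1" using False assms by (simp add: mult_nonpos_nonneg)
  ultimately have "\<bar>exp (l * h) - 1\<bar> \<le> \<bar>l\<bar> * h" using False by simp
  then have "\<bar>(exp (l * h) - 1) / h\<bar> \<le> \<bar>l\<bar>" using assms by (simp add: divide_le_eq)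
  also have "\<dots> \<le> \<bar>l\<bar> * exp \<bar>m\<bar>" by (simp add: mult_le_cancel_left1)
  finally show ?thesis .
qed

lemma exp_difference_quotient: "((\<lambda>h. (exp (l * h) - 1) / h) \<longlongrightarrow> l) (at_right (0::real))"
proof -
  have "((\<lambda>h. exp (l * h)) has_real_derivative l) (at 0)"
    by (auto intro!: derivative_eq_intros)
  then have "((\<lambda>h. (exp (l * h) - 1) / h) \<longlongrightarrow> l) (at 0)" by (simp add: DERIV_def)
  then show ?thesis by (rule filterlim_mono[OF _ order_refl at_le]) simp
qed

text \<open>The derivative at \<open>0\<close> controls \<open>\<sigma> (t / n)\<close>, and \<open>\<sigma> t\<close> is its \<open>n\<close>-th power.\<close>

lemma multiplicative_eq_exp:
  fixes \<sigma> :: "real \<Rightarrow> real"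
  assumes mult: "\<And>s t. 0 \<le> s \<Longrightarrow> 0 \<le> t \<Longrightarrow> \<sigma> (s + t) = \<sigma> s * \<sigma> t"
    and one: "\<sigma> 0 = 1" and deriv: "((\<lambda>h. (\<sigma> h - 1) / h) \<longlongrightarrow> l) (at_right 0)" and t: "0 \<le> t"
  shows "\<sigma> t = exp (l * t)"
proof (cases "t = 0")
  case False
  with t have t: "0 < t" by simp
  \<comment> \<open>Dividing out the expected exponential reduces the claim to derivative 0, where
    the answer is the constant 1.\<close>
  define \<tau> where "\<tau> t = exp (- (l * t)) * \<sigma> t" for t
  have \<tau>m: "\<tau> (s + t) = \<tau> s * \<tau> t" if "0 \<le> s" "0 \<le> t" for s t
    using mult[OF that] by (simp add: \<tau>_def exp_add[symmetric] algebra_simps)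
  have \<tau>p: "\<tau> (real n * s) = \<tau> s ^ n" if "0 \<le> s" for n s
  proof (induction n)
    case (Suc n)
    then show ?case using \<tau>m[of s "real n * s"] that by (simp add: algebra_simps)
  qed (simp add: \<tau>_def one)
  have "((\<lambda>h. exp (- (l * h)) * ((\<sigma> h - 1) / h) + (exp (- l * h) - 1) / h) \<longlongrightarrow> exp (- (l * 0)) * l + - l) (at_right 0)"
    by (intro tendsto_intros deriv exp_difference_quotient)
  moreover have "exp (- (l * h)) * ((\<sigma> h - 1) / h) + (exp (- l * h) - 1) / h = (\<tau> h - 1) / h" for h
    by (cases "h = 0") (simp_all add: \<tau>_def field_simps)
  ultimately have \<tau>d: "((\<lambda>h. (\<tau> h - 1) / h) \<longlongrightarrow> 0) (at_right 0)" by simp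
  have bounds: "1 - \<epsilon> * t \<le> \<tau> t \<and> \<tau> t \<le> exp (\<epsilon> * t)" if \<epsilon>: "0 < \<epsilon>" for \<epsilon>
  proof -
    have "\<forall>\<^sub>F h in at_right 0. \<bar>(\<tau> h - 1) / h\<bar> < \<epsilon>"
      using tendstoD[OF \<tau>d \<epsilon>] by (simp add: dist_real_def)
    then obtain d where d: "0 < d" "\<And>h. 0 < h \<Longrightarrow> h < d \<Longrightarrow> \<bar>(\<tau> h - 1) / h\<bar> < \<epsilon>"
      by (auto simp: eventually_at_right_field)
    \<comment> \<open>The number of steps is large enough that h = t / n lies in the range of the
      derivative estimate and that eps h \<le> 1, as Bernoulli's inequality demands.\<close>
    obtain n where n: "t / min d (1 / \<epsilon>) < real n" using reals_Archimedean2 by blast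
    have mp: "0 < min d (1 / \<epsilon>)" using d \<epsilon> by simp
    have npos: "0 < real n" using n t mp by (meson divide_nonneg_pos le_less_trans less_imp_le)
    define h where "h = t / real n"
    have h1: "h < min d (1 / \<epsilon>)"
      using n mp unfolding h_def pos_divide_less_eq[OF npos] pos_divide_less_eq[OF mp] by (simp only: mult.commute)
    have h0: "0 < h" and nh: "real n * h = t" using t npos by (auto simp: h_def)
    have "\<bar>\<tau> h - 1\<bar> \<le> \<epsilon> * h"
      using d(2)[of h] h0 h1 by (simp add: abs_divide divide_less_eq)
    then have lo: "1 - \<epsilon> * h \<le> \<tau> h" and hi: "\<tau> h \<le> 1 + \<epsilon> * h" by auto
    have eh: "\<epsilon> * h \<le> 1" using h1 \<epsilon> by (simp add: field_simps)
    have \<tau>n: "\<tau> t = \<tau> h ^ n" using \<tau>p[of h n] h0 nh by simp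
    have "1 - \<epsilon> * t = 1 + real n * (- (\<epsilon> * h))" using nh by (simp add: algebra_simps)
    also have "\<dots> \<le> (1 + - (\<epsilon> * h)) ^ n" by (rule Bernoulli_inequality) (use eh in simp)
    also have "\<dots> \<le> \<tau> h ^ n" using lo eh by (intro power_mono) auto
    finally have "1 - \<epsilon> * t \<le> \<tau> t" by (simp add: \<tau>n)
    moreover have "\<tau> h ^ n \<le> exp (\<epsilon> * h) ^ n"
      using hi lo eh exp_ge_add_one_self[of "\<epsilon> * h"] by (intro power_mono) linarith+
    then have "\<tau> t \<le> exp (\<epsilon> * t)" using nh by (simp add: \<tau>n exp_of_nat_mult[symmetric] algebra_simps)
    ultimately show ?thesis by simp
  qed
  have "\<tau> t = 1"
  proof (rule antisym)
    have ev: "\<forall>\<^sub>F \<epsilon> in at_right 0. (0::real) < \<epsilon>" by (rule eventually_at_right_less)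
    have up: "\<forall>\<^sub>F \<epsilon> in at_right 0. \<tau> t \<le> exp (\<epsilon> * t)"
      using ev by eventually_elim (use bounds in blast)
    have lo: "\<forall>\<^sub>F \<epsilon> in at_right 0. 1 - \<epsilon> * t \<le> \<tau> t"
      using ev by eventually_elim (use bounds in blast)
    have "((\<lambda>\<epsilon>. exp (\<epsilon> * t)) \<longlongrightarrow> exp (0 * t)) (at_right 0)" by (intro tendsto_intros)
    from tendsto_lowerbound[OF this up] show "\<tau> t \<le> 1" by simp
    have "((\<lambda>\<epsilon>. 1 - \<epsilon> * t) \<longlongrightarrow> 1 - 0 * t) (at_right 0)" by (intro tendsto_intros)
    from tendsto_upperbound[OF this lo] show "1 \<le> \<tau> t" by simp
  qed
  then show ?thesis by (simp add: \<tau>_def exp_minus field_simps)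
qed (simp add: one)

context spectral
begin

definition sg :: "real \<Rightarrow> (real \<Rightarrow> real) \<Rightarrow> real \<Rightarrow> real" where
  "sg t f = synth (\<lambda>j. exp (la j * t) * fourier f j)"

lemma exp_la_bound: "0 \<le> t \<Longrightarrow> exp (la j * t) \<le> exp (\<bar>la 0\<bar> * t)"
  using la_le[of 0 j] by (auto intro!: mult_right_mono)

lemma summable_of_bound:
  assumes "f \<in> L2 L" "\<And>j. \<bar>r j\<bar> \<le> K * \<bar>fourier f j\<bar>"
  shows "summable (\<lambda>j. (r j)\<^sup>2)"
proof (rule summable_comparison_test')
  show "summable (\<lambda>j. K\<^sup>2 * (fourier f j)\<^sup>2)" by (intro summable_mult fourier_square_summable assms)
  fix j
  have "\<bar>r j\<bar>\<^sup>2 \<le> (K * \<bar>fourier f j\<bar>)\<^sup>2" using assms(2)[of j] by (intro power_mono) auto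
  then show "norm ((r j)\<^sup>2) \<le> K\<^sup>2 * (fourier f j)\<^sup>2" by (simp add: power_mult_distrib)
qed

lemma
  assumes "0 \<le> t" "f \<in> L2 L"
  shows sg_L2: "sg t f \<in> L2 L" and fourier_sg: "fourier (sg t f) j = exp (la j * t) * fourier f j"
proof -
  have "summable (\<lambda>j. (exp (la j * t) * fourier f j)\<^sup>2)"
    by (rule summable_of_bound[OF assms(2), of _ "exp (\<bar>la 0\<bar> * t)"], unfold abs_mult abs_exp_cancel)
       (intro mult_right_mono exp_la_bound assms abs_ge_zero)
  from synth[OF this] show "sg t f \<in> L2 L" "fourier (sg t f) j = exp (la j * t) * fourier f j"
    by (auto simp: sg_def)
qed

lemma sg_norm:
  assumes "0 \<le> t" "f \<in> L2 L"
  shows "L2_norm L (sg t f) \<le> exp (\<bar>la 0\<bar> * t) * L2_norm L f"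
proof (rule power2_le_imp_le)
  have "(L2_norm L (sg t f))\<^sup>2 = (\<Sum>j. (fourier (sg t f) j)\<^sup>2)"
    by (rule sums_unique[OF Parseval[OF sg_L2[OF assms]]])
  also have "\<dots> \<le> (\<Sum>j. (exp (\<bar>la 0\<bar> * t))\<^sup>2 * (fourier f j)\<^sup>2)"
  proof (intro suminf_le fourier_square_summable sg_L2 assms summable_mult)
    fix j
    have "(exp (la j * t))\<^sup>2 \<le> (exp (\<bar>la 0\<bar> * t))\<^sup>2" using exp_la_bound[OF assms(1)] by (intro power_mono) auto
    then show "(fourier (sg t f) j)\<^sup>2 \<le> (exp (\<bar>la 0\<bar> * t))\<^sup>2 * (fourier f j)\<^sup>2"
      by (simp add: fourier_sg[OF assms] power_mult_distrib mult_right_mono)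
  qed
  also have "\<dots> = (exp (\<bar>la 0\<bar> * t))\<^sup>2 * (L2_norm L f)\<^sup>2"
    using suminf_mult[OF fourier_square_summable[OF assms(2)]] sums_unique[OF Parseval[OF assms(2)]] by simp
  finally show "(L2_norm L (sg t f))\<^sup>2 \<le> (exp (\<bar>la 0\<bar> * t) * L2_norm L f)\<^sup>2"
    by (simp add: power_mult_distrib)
qed simp

lemma C0_semigroup_sg: "C0_semigroup L sg"
  unfolding C0_semigroup_def
proof (intro conjI allI ballI impI)
  fix t :: real and f assume t: "0 \<le> t" and f: "f \<in> L2 L"
  show "sg t f \<in> L2 L" by (rule sg_L2[OF t f])
  {
    fix g p q assume g: "g \<in> L2 L"
    have pq: "(\<lambda>x. p * f x + q * g x) \<in> L2 L" by (intro L2_add L2_scale f g)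
    show "L2_eq L (sg t (\<lambda>x. p * f x + q * g x)) (\<lambda>x. p * sg t f x + q * sg t g x)"
      by (rule L2_eq_of_coeff)
         (use t f g pq in \<open>simp_all add: sg_L2 L2_add L2_scale fourier_sg fourier_add fourier_scale algebra_simps\<close>)
  }
  show "L2_eq L (sg (s + t) f) (sg s (sg t f))" if "0 \<le> s" for s
    by (rule L2_eq_of_coeff)
       (use that t f in \<open>simp_all add: sg_L2 fourier_sg exp_add ring_distribs\<close>)
next
  fix t :: real assume t: "0 \<le> t"
  show "\<exists>M. \<forall>f\<in>L2 L. L2_norm L (sg t f) \<le> M * L2_norm L f" using sg_norm[OF t] by blast
next
  fix f assume f: "f \<in> L2 L"
  show "L2_eq L (sg 0 f) f"
    by (rule L2_eq_of_coeff) (use f in \<open>simp_all add: sg_L2 fourier_sg\<close>)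
  have ev: "\<forall>\<^sub>F t in at_right (0::real). 0 < t \<and> t < 1" by (auto simp: eventually_at_right_field intro: exI[of _ 1])
  show "((\<lambda>t. L2_norm L (\<lambda>x. sg t f x - f x)) \<longlongrightarrow> 0) (at_right 0)"
  proof (rule norm_tendsto_0_of_coeff[where G = "\<lambda>j. (exp \<bar>la 0\<bar> + 1) * \<bar>fourier f j\<bar>"])
    show "\<forall>\<^sub>F t in at_right 0. (\<lambda>x. sg t f x - f x) \<in> L2 L"
      using ev by eventually_elim (use f in \<open>auto intro!: L2_diff sg_L2\<close>)
    show "((\<lambda>t. fourier (\<lambda>x. sg t f x - f x) j) \<longlongrightarrow> 0) (at_right 0)" for j
    proof (rule Lim_transform_eventually)
      have "((\<lambda>t. exp (la j * t) * fourier f j - fourier f j) \<longlongrightarrow> exp (la j * 0) * fourier f j - fourier f j) (at_right 0)"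
        by (intro tendsto_intros)
      then show "((\<lambda>t. exp (la j * t) * fourier f j - fourier f j) \<longlongrightarrow> 0) (at_right 0)" by simp
      show "\<forall>\<^sub>F t in at_right 0. exp (la j * t) * fourier f j - fourier f j = fourier (\<lambda>x. sg t f x - f x) j"
        using ev by eventually_elim (simp add: fourier_diff sg_L2 fourier_sg f)
    qed
    show "\<forall>\<^sub>F t in at_right 0. \<forall>j. \<bar>fourier (\<lambda>x. sg t f x - f x) j\<bar> \<le> (exp \<bar>la 0\<bar> + 1) * \<bar>fourier f j\<bar>"
      using ev
    proof (eventually_elim, intro allI)
      fix t :: real and j assume t: "0 < t \<and> t < 1"
      have "\<bar>la 0\<bar> * t \<le> \<bar>la 0\<bar> * 1" using t by (intro mult_left_mono) auto
      then have "exp (la j * t) \<le> exp \<bar>la 0\<bar>"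
        using order_trans[OF exp_la_bound[of t j], of "exp \<bar>la 0\<bar>"] t by simp
      then have "\<bar>exp (la j * t) - 1\<bar> \<le> exp \<bar>la 0\<bar> + 1"
        using exp_gt_zero[of "la j * t"] by linarith
      then have "\<bar>exp (la j * t) - 1\<bar> * \<bar>fourier f j\<bar> \<le> (exp \<bar>la 0\<bar> + 1) * \<bar>fourier f j\<bar>"
        by (intro mult_right_mono) auto
      moreover have "fourier (\<lambda>x. sg t f x - f x) j = (exp (la j * t) - 1) * fourier f j"
        using t f by (simp add: fourier_diff sg_L2 fourier_sg algebra_simps)
      ultimately show "\<bar>fourier (\<lambda>x. sg t f x - f x) j\<bar> \<le> (exp \<bar>la 0\<bar> + 1) * \<bar>fourier f j\<bar>"
        by (simp add: abs_mult)
    qed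
    show "summable (\<lambda>j. ((exp \<bar>la 0\<bar> + 1) * \<bar>fourier f j\<bar>)\<^sup>2)"
      by (simp add: power_mult_distrib summable_mult fourier_square_summable f)
  qed simp
qed

lemma quotient_coeff:
  assumes "0 < h" "sh \<in> L2 L" "f \<in> L2 L" "g \<in> L2 L"
  shows "fourier (\<lambda>x. (sh x - f x) / h - g x) j = (fourier sh j - fourier f j) / h - fourier g j"
    "(\<lambda>x. (sh x - f x) / h - g x) \<in> L2 L"
proof -
  have sf: "(\<lambda>x. sh x - f x) \<in> L2 L" by (intro L2_diff assms)
  have d: "(\<lambda>x. (1 / h) * (sh x - f x)) \<in> L2 L" by (rule L2_scale[OF sf])
  have e: "(\<lambda>x. (1 / h) * (sh x - f x) - g x) = (\<lambda>x. (sh x - f x) / h - g x)" by simp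
  show "(\<lambda>x. (sh x - f x) / h - g x) \<in> L2 L"
    using L2_diff[OF d assms(4)] unfolding e .
  show "fourier (\<lambda>x. (sh x - f x) / h - g x) j = (fourier sh j - fourier f j) / h - fourier g j"
    using fourier_diff[OF d assms(4), of j] fourier_diff[OF assms(2,3), of j]
      fourier_scale[of "1 / h" "\<lambda>x. sh x - f x" j] unfolding e by simp
qed

text \<open>In each mode the difference quotient tends to la j times the coefficient of
  \<open>f\<close>. Convergence in norm forces g to have these coefficients; conversely they give
  convergence by domination. The two coefficient lemmas translate this into membership in the
  graph.\<close>

lemma generated_by_A_sg: "generated_by_A L c sg"
  unfolding generated_by_A_def
proof (intro ballI iffI)
  fix f g assume f: "f \<in> L2 L" and g: "g \<in> L2 L"
  let ?u = "\<lambda>h x. (sg h f x - f x) / h - g x"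
  have ev: "\<forall>\<^sub>F h in at_right (0::real). 0 < h \<and> h < 1" by (auto simp: eventually_at_right_field intro: exI[of _ 1])
  have uL2: "?u h \<in> L2 L" and cf: "fourier (?u h) j = (exp (la j * h) - 1) / h * fourier f j - fourier g j" if "0 < h" for h j
    using quotient_coeff(2)[OF that sg_L2[OF _ f] f g] quotient_coeff(1)[OF that sg_L2[OF _ f] f g, of h j]
      fourier_sg[OF _ f, of h j] that
    by (simp_all add: diff_divide_distrib algebra_simps)
  have lim: "((\<lambda>h. fourier (?u h) j) \<longlongrightarrow> la j * fourier f j - fourier g j) (at_right 0)" for j
  proof (rule Lim_transform_eventually)
    show "((\<lambda>h. (exp (la j * h) - 1) / h * fourier f j - fourier g j) \<longlongrightarrow> la j * fourier f j - fourier g j) (at_right 0)"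
      by (intro tendsto_intros exp_difference_quotient)
    show "\<forall>\<^sub>F h in at_right 0. (exp (la j * h) - 1) / h * fourier f j - fourier g j = fourier (?u h) j"
      using ev by eventually_elim (simp add: cf)
  qed
  {
    assume "A_graph L c f g"
    then have eq: "fourier g j = la j * fourier f j" for j by (rule A_graph_coeff[OF _ g])
    show "((\<lambda>h. L2_norm L (?u h)) \<longlongrightarrow> 0) (at_right 0)"
    \<comment> \<open>The quotient is bounded by a multiple of |la j| |f_j|, which is |g_j|: square
      summable although |la j| is unbounded.\<close>
    proof (rule norm_tendsto_0_of_coeff[where G = "\<lambda>j. (exp \<bar>la 0\<bar> + 1) * \<bar>fourier g j\<bar>"])
      show "\<forall>\<^sub>F h in at_right 0. ?u h \<in> L2 L" using ev by eventually_elim (simp add: uL2)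
      show "((\<lambda>h. fourier (?u h) j) \<longlongrightarrow> 0) (at_right 0)" for j using lim[of j] by (simp add: eq)
      show "summable (\<lambda>j. ((exp \<bar>la 0\<bar> + 1) * \<bar>fourier g j\<bar>)\<^sup>2)"
        by (simp add: power_mult_distrib summable_mult fourier_square_summable g)
      show "\<forall>\<^sub>F h in at_right 0. \<forall>j. \<bar>fourier (?u h) j\<bar> \<le> (exp \<bar>la 0\<bar> + 1) * \<bar>fourier g j\<bar>"
        using ev
      proof (eventually_elim, intro allI)
        fix h :: real and j assume h: "0 < h \<and> h < 1"
        have "\<bar>(exp (la j * h) - 1) / h\<bar> \<le> \<bar>la j\<bar> * exp \<bar>la 0\<bar>"
          using h la_le[of 0 j] by (intro exp_difference_bound) auto
        then have "\<bar>(exp (la j * h) - 1) / h\<bar> * \<bar>fourier f j\<bar> \<le> (\<bar>la j\<bar> * exp \<bar>la 0\<bar>) * \<bar>fourier f j\<bar>"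
          by (intro mult_right_mono) auto
        also have "\<dots> = exp \<bar>la 0\<bar> * \<bar>fourier g j\<bar>" by (simp add: eq abs_mult)
        finally have "\<bar>(exp (la j * h) - 1) / h * fourier f j\<bar> \<le> exp \<bar>la 0\<bar> * \<bar>fourier g j\<bar>"
          by (simp only: abs_mult)
        then show "\<bar>fourier (?u h) j\<bar> \<le> (exp \<bar>la 0\<bar> + 1) * \<bar>fourier g j\<bar>"
          using h abs_triangle_ineq4[of "(exp (la j * h) - 1) / h * fourier f j" "fourier g j"]
          unfolding cf[OF conjunct1[OF h]] ring_distribs by linarith
      qed
    qed simp
  }
  {
    assume l0: "((\<lambda>h. L2_norm L (?u h)) \<longlongrightarrow> 0) (at_right 0)"
    have "fourier g j = la j * fourier f j" for j
    proof -
      have "((\<lambda>h. fourier (?u h) j) \<longlongrightarrow> 0) (at_right 0)"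
      proof (rule Lim_null_comparison[OF _ l0])
        show "\<forall>\<^sub>F h in at_right 0. norm (fourier (?u h) j) \<le> L2_norm L (?u h)"
          using ev by eventually_elim (use fourier_le_norm[OF uL2] in auto)
      qed
      from tendsto_unique[OF _ this lim] show ?thesis by simp
    qed
    then show "A_graph L c f g" by (rule A_graph_of_coeff[OF f g])
  }
qed

text \<open>Uniqueness: the semigroup preserves the eigenspaces of its generator.\<close>

lemma fourier_semigroup:
  assumes S: "C0_semigroup L S" and gen: "generated_by_A L c S" and t: "0 \<le> t" and f: "f \<in> L2 L"
  shows "fourier (S t f) j = exp (la j * t) * fourier f j"
proof -
  have SL2: "\<And>t f. 0 \<le> t \<Longrightarrow> f \<in> L2 L \<Longrightarrow> S t f \<in> L2 L"
    and lin: "\<And>t f g p q. 0 \<le> t \<Longrightarrow> f \<in> L2 L \<Longrightarrow> g \<in> L2 L \<Longrightarrow>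
      L2_eq L (S t (\<lambda>x. p * f x + q * g x)) (\<lambda>x. p * S t f x + q * S t g x)"
    and bdd: "\<And>t. 0 \<le> t \<Longrightarrow> \<exists>M. \<forall>f\<in>L2 L. L2_norm L (S t f) \<le> M * L2_norm L f"
    and S0: "\<And>f. f \<in> L2 L \<Longrightarrow> L2_eq L (S 0 f) f"
    and Sadd: "\<And>s t f. 0 \<le> s \<Longrightarrow> 0 \<le> t \<Longrightarrow> f \<in> L2 L \<Longrightarrow> L2_eq L (S (s + t) f) (S s (S t f))"
    using S unfolding C0_semigroup_def by auto
  have cadd: "fourier (S (s + t) f) k = fourier (S s (S t f)) k" if "0 \<le> s" "0 \<le> t" "f \<in> L2 L" for s t f k
    by (intro fourier_cong SL2 Sadd that) (use that in auto)
  have clin: "fourier (S t (\<lambda>x. p * f x + q * g x)) k = p * fourier (S t f) k + q * fourier (S t g) k"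
    if "0 \<le> t" "f \<in> L2 L" "g \<in> L2 L" for t f g p q k
  proof -
    have "fourier (S t (\<lambda>x. p * f x + q * g x)) k = fourier (\<lambda>x. p * S t f x + q * S t g x) k"
      by (intro fourier_cong SL2 lin that L2_add L2_scale)
    then show ?thesis using that by (simp add: fourier_add fourier_scale SL2 L2_scale)
  qed
  have cscale: "fourier (S t (\<lambda>x. p * f x)) k = p * fourier (S t f) k" if "0 \<le> t" "f \<in> L2 L" for t f p k
    using clin[OF that that(2), of p 0] by simp
  \<comment> \<open>Up to equality almost everywhere, the difference quotient of
    \<open>S t f\<close> is \<open>S t\<close> applied to that of \<open>f\<close>, and
    \<open>S t\<close> is bounded. So \<open>S t\<close> maps the graph of A into itself.\<close>
  have inv: "A_graph L c (S t f) (S t g)" if fg: "A_graph L c f g" and f: "f \<in> L2 L" and g: "g \<in> L2 L" and t: "0 \<le> t" for f g t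
  proof -
    obtain M where M: "\<And>f. f \<in> L2 L \<Longrightarrow> L2_norm L (S t f) \<le> M * L2_norm L f" using bdd[OF t] by blast
    let ?v = "\<lambda>h x. (S h f x - f x) / h - g x"
    let ?w = "\<lambda>h x. (S h (S t f) x - S t f x) / h - S t g x"
    have l0: "((\<lambda>h. L2_norm L (?v h)) \<longlongrightarrow> 0) (at_right 0)"
      using gen f g fg unfolding generated_by_A_def by blast
    have "((\<lambda>h. L2_norm L (?w h)) \<longlongrightarrow> 0) (at_right 0)"
    proof (rule Lim_null_comparison)
      show "((\<lambda>h. M * L2_norm L (?v h)) \<longlongrightarrow> 0) (at_right 0)" using tendsto_mult_right_zero[OF l0] .
      show "\<forall>\<^sub>F h in at_right 0. norm (L2_norm L (?w h)) \<le> M * L2_norm L (?v h)"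
        using eventually_at_right_less[of 0]
      proof eventually_elim
        case (elim h)
        have h: "0 \<le> h" using elim by simp
        note vL2 = quotient_coeff(2)[OF elim SL2[OF h f] f g]
        note wL2 = quotient_coeff(2)[OF elim SL2[OF h SL2[OF t f]] SL2[OF t f] SL2[OF t g]]
        have "L2_eq L (S t (?v h)) (?w h)"
        proof (rule L2_eq_of_coeff[OF SL2[OF t vL2] wL2])
          fix k
          have r: "?v h = (\<lambda>x. 1 * ((1 / h) * S h f x + (- 1 / h) * f x) + (- 1) * g x)"
            by (rule ext) (simp add: diff_divide_distrib)
          have "fourier (S t (?v h)) k = 1 * fourier (S t (\<lambda>x. (1 / h) * S h f x + (- 1 / h) * f x)) k + (- 1) * fourier (S t g) k"
            unfolding r by (intro clin t g L2_add L2_scale SL2 h f)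
          also have "fourier (S t (\<lambda>x. (1 / h) * S h f x + (- 1 / h) * f x)) k
              = (1 / h) * fourier (S t (S h f)) k + (- 1 / h) * fourier (S t f) k"
            by (intro clin t SL2 h f)
          also have "fourier (S t (S h f)) k = fourier (S h (S t f)) k"
            using cadd[OF t h f, of k] cadd[OF h t f, of k] by (simp add: add.commute)
          finally show "fourier (S t (?v h)) k = fourier (?w h) k"
            using quotient_coeff(1)[OF elim SL2[OF h SL2[OF t f]] SL2[OF t f] SL2[OF t g], of k]
            by (simp add: diff_divide_distrib)
        qed
        then have "L2_norm L (?w h) = L2_norm L (S t (?v h))"
          by (rule L2_norm_cong[OF SL2[OF t vL2] wL2, symmetric])
        then show ?case using M[OF vL2] by simp
      qed
    qed
    then show ?thesis using gen SL2[OF t f] SL2[OF t g] unfolding generated_by_A_def by blast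
  qed
  \<comment> \<open>\<open>S t\<close> sends an eigenfunction into the eigenspace of the same
    eigenvalue, and the eigenvalues are distinct.\<close>
  have diag: "fourier (S t (E i)) k = 0" if "i \<noteq> k" "0 \<le> t" for i k t
  proof -
    have "A_graph L c (S t (E i)) (S t (\<lambda>x. la i * E i x))"
      using eigen[of "Suc i"] by (intro inv that E_L2 L2_scale) auto
    then have "fourier (S t (\<lambda>x. la i * E i x)) k = la k * fourier (S t (E i)) k"
      by (rule A_graph_coeff) (intro SL2 that L2_scale E_L2)
    then have "(la i - la k) * fourier (S t (E i)) k = 0" using cscale[OF that(2) E_L2, of "la i" i k] by (simp add: algebra_simps)
    moreover have "la i \<noteq> la k" using la_strict[of i k] la_strict[of k i] that by (cases "i < k") auto
    ultimately show ?thesis by simp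
  qed
  \<comment> \<open>The scalar by which \<open>S t\<close> acts on mode j. Boundedness of
    \<open>S t\<close> extends the action from finite sums to all of L^2, and the semigroup law
    makes it multiplicative.\<close>
  define \<sigma> where "\<sigma> t = fourier (S t (E j)) j" for t
  have general: "fourier (S t f) j = fourier f j * \<sigma> t" if t: "0 \<le> t" and f: "f \<in> L2 L" for t f
  proof -
    obtain M where M: "\<And>f. f \<in> L2 L \<Longrightarrow> L2_norm L (S t f) \<le> M * L2_norm L f" using bdd[OF t] by blast
    let ?p = "\<lambda>N. expand (fourier f) {..<N}"
    have part: "fourier (S t (?p N)) j = (if j < N then fourier f j * \<sigma> t else 0)" for N
    proof (induction N)
      case 0
      have "?p 0 = (\<lambda>x. 0 * E j x)" by (simp add: expand_def fun_eq_iff)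
      then show ?case using cscale[OF t E_L2, of 0 j j] by simp
    next
      case (Suc N)
      have "?p (Suc N) = (\<lambda>x. 1 * ?p N x + fourier f N * E N x)" by (simp add: expand_def fun_eq_iff)
      then have "fourier (S t (?p (Suc N))) j = 1 * fourier (S t (?p N)) j + fourier f N * fourier (S t (E N)) j"
        using clin[OF t expand_L2 E_L2, of 1 "fourier f" "{..<N}" "fourier f N" N j] by simp
      then show ?case using Suc diag[of N j t] t by (cases "N = j") (auto simp: \<sigma>_def)
    qed
    have "(\<lambda>N. fourier (S t f) j - fourier (S t (?p N)) j) \<longlonglongrightarrow> 0"
    proof (rule Lim_null_comparison)
      show "(\<lambda>N. M * L2_norm L (\<lambda>x. ?p N x - f x)) \<longlonglongrightarrow> 0"
        by (rule tendsto_mult_right_zero[OF expansion_tendsto[OF f]])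
      show "\<forall>\<^sub>F N in sequentially. norm (fourier (S t f) j - fourier (S t (?p N)) j) \<le> M * L2_norm L (\<lambda>x. ?p N x - f x)"
      proof (rule always_eventually, rule allI)
        fix N
        have d: "(\<lambda>x. 1 * f x + (- 1) * ?p N x) \<in> L2 L" by (intro L2_add L2_scale f expand_L2)
        have "fourier (S t f) j - fourier (S t (?p N)) j = fourier (S t (\<lambda>x. 1 * f x + (- 1) * ?p N x)) j"
          using clin[OF t f expand_L2, of 1 "-1" "fourier f" "{..<N}" j] by simp
        then have "norm (fourier (S t f) j - fourier (S t (?p N)) j) \<le> L2_norm L (S t (\<lambda>x. 1 * f x + (- 1) * ?p N x))"
          using fourier_le_norm[OF SL2[OF t d], of j] by simp
        also have "\<dots> \<le> M * L2_norm L (\<lambda>x. 1 * f x + (- 1) * ?p N x)" by (rule M[OF d])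
        finally show "norm (fourier (S t f) j - fourier (S t (?p N)) j) \<le> M * L2_norm L (\<lambda>x. ?p N x - f x)"
          using L2_norm_diff_commute[of L f "?p N"] by simp
      qed
    qed
    moreover have "(\<lambda>N. fourier (S t f) j - fourier (S t (?p N)) j) \<longlonglongrightarrow> fourier (S t f) j - fourier f j * \<sigma> t"
      by (rule tendsto_eventually) (auto simp: part eventually_sequentially intro!: exI[of _ "Suc j"])
    ultimately show ?thesis using LIMSEQ_unique by fastforce
  qed
  have "\<sigma> t = exp (la j * t)"
  proof (rule multiplicative_eq_exp[OF _ _ _ t])
    show "\<sigma> (s + t) = \<sigma> s * \<sigma> t" if "0 \<le> s" "0 \<le> t" for s t
      using cadd[OF that E_L2, of j j] general[OF that(1) SL2[OF that(2) E_L2], of j] by (simp add: \<sigma>_def)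
    show one: "\<sigma> 0 = 1"
      using fourier_cong[OF SL2[OF _ E_L2] E_L2 S0[OF E_L2], of j j] by (simp add: \<sigma>_def fourier_E)
    have "A_graph L c (E j) (\<lambda>x. la j * E j x)" using eigen[of "Suc j"] by simp
    then have l0: "((\<lambda>h. L2_norm L (\<lambda>x. (S h (E j) x - E j x) / h - la j * E j x)) \<longlongrightarrow> 0) (at_right 0)"
      using gen L2_scale[OF E_L2, of "la j" j] unfolding generated_by_A_def by auto
    have "((\<lambda>h. (\<sigma> h - 1) / h - la j) \<longlongrightarrow> 0) (at_right 0)"
    proof (rule Lim_null_comparison[OF _ l0])
      show "\<forall>\<^sub>F h in at_right 0. norm ((\<sigma> h - 1) / h - la j) \<le> L2_norm L (\<lambda>x. (S h (E j) x - E j x) / h - la j * E j x)"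
        using eventually_at_right_less[of 0]
      proof eventually_elim
        case (elim h)
        have h: "0 \<le> h" using elim by simp
        note q = quotient_coeff[OF elim SL2[OF h E_L2[of j]] E_L2[of j] L2_scale[OF E_L2[of j], of "la j"]]
        have "fourier (\<lambda>x. (S h (E j) x - E j x) / h - la j * E j x) j = (\<sigma> h - 1) / h - la j"
          using q(1)[of j] elim by (simp add: \<sigma>_def fourier_E fourier_scale)
        then show ?case using fourier_le_norm[OF q(2), of j] elim by simp
      qed
    qed
    then show "((\<lambda>h. (\<sigma> h - 1) / h) \<longlongrightarrow> la j) (at_right 0)" by (rule LIM_zero_cancel)
  qed
  then show ?thesis using general[OF t f] by simp
qed

end

section \<open>The finite-dimensional system\<close>

text \<open>\<open>A\<^sub>1\<close> is an arrowhead matrix: a first column on top of a diagonal.\<close>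

definition arrow :: "nat \<Rightarrow> (nat \<Rightarrow> real) \<Rightarrow> (nat \<Rightarrow> real) \<Rightarrow> real mat" where
  "arrow n a l = mat (n + 1) (n + 1)
     (\<lambda>(i, j). if i = 0 then 0 else if j = 0 then a i else if i = j then l i else 0)"

lemma arrow_carrier [simp]: "arrow n a l \<in> carrier_mat (n + 1) (n + 1)"
  by (simp add: arrow_def)

lemma arrow_smult: "t \<cdot>\<^sub>m arrow n a l = arrow n (\<lambda>i. t * a i) (\<lambda>i. t * l i)"
  by (rule eq_matI) (auto simp: arrow_def)

text \<open>Stated from the first power on: the zeroth power is the identity, whose corner entry 1
  does not fit the pattern.\<close>

lemma arrow_power:
  "arrow n a l ^\<^sub>m Suc k = mat (n + 1) (n + 1)
     (\<lambda>(i, j). if i = 0 then 0 else if j = 0 then a i * l i ^ k else if i = j then l i ^ Suc k else 0)"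
proof (induction k)
  case 0
  have one: "arrow n a l ^\<^sub>m Suc 0 = arrow n a l"
    using left_mult_one_mat[OF arrow_carrier, of n a l] by (simp add: arrow_def)
  show ?case unfolding one by (rule eq_matI) (auto simp: arrow_def)
next
  case (Suc k)
  let ?B = "\<lambda>k. mat (n + 1) (n + 1)
     (\<lambda>(i, j). if i = 0 then 0 else if j = 0 then a i * l i ^ k else if i = j then l i ^ Suc k else 0)"
  have "?B k * arrow n a l = ?B (Suc k)"
  proof (rule eq_matI)
    fix i j assume "i < dim_row (?B (Suc k))" "j < dim_col (?B (Suc k))"
    then have ij: "i < n + 1" "j < n + 1" by auto
    have "(?B k * arrow n a l) $$ (i, j) = (\<Sum>m<n + 1. ?B k $$ (i, m) * arrow n a l $$ (m, j))"
      using ij by (simp add: scalar_prod_def arrow_def lessThan_atLeast0)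
    also have "\<dots> = (\<Sum>m<n + 1. if m = i then l i ^ Suc k * arrow n a l $$ (i, j) * (if i = 0 then 0 else 1) else 0)"
      by (rule sum.cong) (use ij in \<open>auto simp: arrow_def\<close>)
    also have "\<dots> = ?B (Suc k) $$ (i, j)"
      using ij by (auto simp: arrow_def)
    finally show "(?B k * arrow n a l) $$ (i, j) = ?B (Suc k) $$ (i, j)" .
  qed (auto simp: arrow_def)
  then show ?case using Suc by simp
qed

text \<open>\<open>exp_int l t\<close> is \<open>\<integral>\<^sub>0\<^sup>t e\<^bsup>l s\<^esup> ds\<close>.\<close>

definition exp_int :: "real \<Rightarrow> real \<Rightarrow> real" where
  "exp_int l t = (if l = 0 then t else (exp (l * t) - 1) / l)"

lemma exp_int_deriv: "(exp_int l has_real_derivative exp (l * t)) (at t)"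
  unfolding exp_int_def[abs_def] by (cases "l = 0") (auto intro!: derivative_eq_intros)

lemma exp_int_mult: "l * exp_int l t = exp (l * t) - 1"
  by (simp add: exp_int_def)

lemma exp_int_zero [simp]: "exp_int l 0 = 0"
  by (simp add: exp_int_def)

lemma exp_int_add: "exp_int l (s + t) = exp_int l s + exp (l * s) * exp_int l t"
  by (auto simp: exp_int_def ring_distribs exp_add field_simps)

text \<open>This is the first column of the exponential series: the k-th power contributes the
  exponent k - 1 of the eigenvalue, so the terms are those of an integrated exponential. For l = 0
  only k = 1 survives.\<close>

lemma exp_int_sums:
  "(\<lambda>k. (if k = 0 then 0 else (t * a) * (t * l) ^ (k - 1)) / fact k) sums (a * exp_int l t)"
proof (cases "l = 0")
  case True
  have "(\<lambda>k. if k = 1 then t * a else 0) sums (t * a)" by (rule sums_single)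
  moreover have "(\<lambda>k. if k = 1 then t * a else 0)
      = (\<lambda>k. (if k = 0 then 0 else (t * a) * (t * l) ^ (k - 1)) / fact k)"
  proof
    fix k show "(if k = 1 then t * a else 0) = (if k = 0 then 0 else (t * a) * (t * l) ^ (k - 1)) / fact k"
      using True by (cases k; cases "k - 1") auto
  qed
  ultimately show ?thesis using True by (simp add: exp_int_def mult.commute)
next
  case False
  have "(\<lambda>k. (t * l) ^ k / fact k) sums exp (t * l)"
    using exp_converges[of "t * l"] by (simp add: divide_inverse mult.commute)
  moreover have "(\<lambda>k. if k = 0 then 1 else 0) sums (1::real)" by (rule sums_single)
  ultimately have "(\<lambda>k. (a / l) * ((t * l) ^ k / fact k - (if k = 0 then 1 else 0))) sums ((a / l) * (exp (t * l) - 1))"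
    by (intro sums_mult sums_diff)
  moreover have "(a / l) * ((t * l) ^ k / fact k - (if k = 0 then 1 else 0))
      = (if k = 0 then 0 else (t * a) * (t * l) ^ (k - 1)) / fact k" for k
    using False by (cases k) auto
  ultimately show ?thesis using False by (simp add: exp_int_def mult.commute)
qed

text \<open>The powers are explicit, so the series is summed entry by entry; from here on the matrix
  exponential appears only in this closed form.\<close>

lemma mat_exp_arrow:
  "mat_exp (t \<cdot>\<^sub>m arrow n a l) = mat (n + 1) (n + 1)
     (\<lambda>(i, j). if i = 0 then (if j = 0 then 1 else 0)
        else if j = 0 then a i * exp_int (l i) t else if i = j then exp (l i * t) else 0)"
proof (rule eq_matI)
  let ?R = "mat (n + 1) (n + 1)
     (\<lambda>(i, j). if i = 0 then (if j = 0 then 1 else 0)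
        else if j = 0 then a i * exp_int (l i) t else if i = j then exp (l i * t) else 0)"
  fix i j assume "i < dim_row ?R" "j < dim_col ?R"
  then have ij: "i < n + 1" "j < n + 1" by auto
  let ?A = "arrow n (\<lambda>i. t * a i) (\<lambda>i. t * l i)"
  have p: "(?A ^\<^sub>m k) $$ (i, j) = (if k = 0 then (if i = j then 1 else 0)
      else if i = 0 then 0 else if j = 0 then (t * a i) * (t * l i) ^ (k - 1)
      else if i = j then (t * l i) ^ k else 0)" for k
  proof (cases k)
    case 0
    then show ?thesis using ij by (simp add: arrow_def)
  next
    case (Suc m)
    then show ?thesis using ij by (simp only: arrow_power) simp
  qed
  have "(\<lambda>k. (?A ^\<^sub>m k) $$ (i, j) / fact k) sums ?R $$ (i, j)"
  proof -
    consider "i = 0" "j = 0" | "i = 0" "j \<noteq> 0" | "i \<noteq> 0" "j = 0" | "i \<noteq> 0" "i = j" | "i \<noteq> 0" "j \<noteq> 0" "i \<noteq> j" by blast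
    then show ?thesis
    proof cases
      case 1
      have "(\<lambda>k. if k = 0 then 1 else 0) sums (1::real)" by (rule sums_single)
      moreover have "(?A ^\<^sub>m k) $$ (i, j) / fact k = (if k = 0 then 1 else 0)" for k
        unfolding p using 1 by simp
      ultimately show ?thesis using 1 by simp
    next
      case 2
      have "(?A ^\<^sub>m k) $$ (i, j) / fact k = 0" for k
        unfolding p using 2 by simp
      then show ?thesis using 2 ij by simp
    next
      case 3
      have "(?A ^\<^sub>m k) $$ (i, j) / fact k = (if k = 0 then 0 else (t * a i) * (t * l i) ^ (k - 1)) / fact k" for k
        unfolding p using 3 by simp
      then show ?thesis using 3 ij exp_int_sums[of t "a i" "l i"] by simp
    next
      case 4
      have "(?A ^\<^sub>m k) $$ (i, j) / fact k = (t * l i) ^ k / fact k" for k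
        unfolding p using 4 by simp
      then show ?thesis using 4 ij exp_converges[of "t * l i"] by (simp add: divide_inverse mult.commute)
    next
      case 5
      have "(?A ^\<^sub>m k) $$ (i, j) / fact k = 0" for k
        unfolding p using 5 by simp
      then show ?thesis using 5 ij by simp
    qed
  qed
  then have "(\<Sum>k. (?A ^\<^sub>m k) $$ (i, j) / fact k) = ?R $$ (i, j)" by (rule sums_unique[symmetric])
  then show "mat_exp (t \<cdot>\<^sub>m arrow n a l) $$ (i, j) = ?R $$ (i, j)"
    using ij unfolding arrow_smult by (simp add: mat_exp_def arrow_def)
qed (auto simp: mat_exp_def arrow_def)

text \<open>Entry i of exp (t A_1) B_1. Entry 0 stays 1 because the first row of A_1
  vanishes.\<close>

definition kap :: "(nat \<Rightarrow> real) \<Rightarrow> (nat \<Rightarrow> real) \<Rightarrow> (nat \<Rightarrow> real) \<Rightarrow> nat \<Rightarrow> real \<Rightarrow> real" where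
  "kap a b l i t = (if i = 0 then 1 else a i * exp_int (l i) t + b i * exp (l i * t))"

definition bcol :: "nat \<Rightarrow> (nat \<Rightarrow> real) \<Rightarrow> real mat" where
  "bcol n b = mat (n + 1) 1 (\<lambda>(i, j). if i = 0 then 1 else b i)"

lemma mat_exp_bcol:
  "mat_exp (t \<cdot>\<^sub>m arrow n a l) * bcol n b = mat (n + 1) 1 (\<lambda>(i, j). kap a b l i t)"
proof (rule eq_matI)
  fix i j assume "i < dim_row (mat (n + 1) 1 (\<lambda>(i, j). kap a b l i t))" "j < dim_col (mat (n + 1) 1 (\<lambda>(i, j). kap a b l i t))"
  then have ij: "i < n + 1" "j = 0" by auto
  let ?f = "\<lambda>k. (if i = 0 then (if k = 0 then 1 else 0)
        else if k = 0 then a i * exp_int (l i) t else if i = k then exp (l i * t) else 0) * (if k = 0 then 1 else b k)"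
  have "(mat_exp (t \<cdot>\<^sub>m arrow n a l) * bcol n b) $$ (i, j) = (\<Sum>k<n + 1. ?f k)"
    using ij by (simp add: mat_exp_arrow bcol_def scalar_prod_def lessThan_atLeast0)
  also have "\<dots> = (\<Sum>k\<in>{0, i}. ?f k)"
    by (rule sum.mono_neutral_right) (use ij in auto)
  also have "\<dots> = kap a b l i t" by (cases "i = 0") (auto simp: kap_def)
  finally show "(mat_exp (t \<cdot>\<^sub>m arrow n a l) * bcol n b) $$ (i, j) = mat (n + 1) 1 (\<lambda>(i, j). kap a b l i t) $$ (i, j)"
    using ij by simp
qed (auto simp: mat_exp_def arrow_def bcol_def)

text \<open>A_1 commutes with its exponential, so in each row the controllability number of the
  delayed input vector is that of B_1 times a positive factor. Controllability therefore does not
  depend on the delay.\<close>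

lemma kap_control:
  assumes "i \<noteq> 0"
  shows "l i * kap a b l i t + a i = exp (l i * t) * (a i + l i * b i)"
proof -
  have "l i * kap a b l i t + a i = a i * (l i * exp_int (l i) t) + a i + l i * b i * exp (l i * t)"
    using assms by (simp add: kap_def algebra_simps)
  also have "\<dots> = exp (l i * t) * (a i + l i * b i)"
    unfolding exp_int_mult by (simp add: algebra_simps)
  finally show ?thesis .
qed

section \<open>Pole placement\<close>

text \<open>The matrix determinant lemma, with \<open>v\<close> in the role of the inverse of P
  applied to beta. One bordered matrix is multiplied by two unipotent triangular matrices, and each
  product is block triangular.\<close>

lemma det_rank_one_update:
  fixes P \<beta> K v :: "real mat"
  assumes P: "P \<in> carrier_mat N N" and \<beta>: "\<beta> \<in> carrier_mat N 1" and K: "K \<in> carrier_mat 1 N"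
    and v: "v \<in> carrier_mat N 1" and Pv: "P * v = \<beta>"
  shows "det (P - \<beta> * K) = det P * (1 - (K * v) $$ (0, 0))"
proof -
  let ?F = "four_block_mat P \<beta> K (1\<^sub>m 1)"
  let ?U = "four_block_mat (1\<^sub>m N) (0\<^sub>m N 1) (- K) (1\<^sub>m 1)"
  let ?V = "four_block_mat (1\<^sub>m N) (- v) (0\<^sub>m 1 N) (1\<^sub>m 1)"
  note carriers = P \<beta> K v one_carrier_mat[of N] one_carrier_mat[of 1] zero_carrier_mat[of N 1] zero_carrier_mat[of 1 N]
  have mK: "- K \<in> carrier_mat 1 N" and mv: "- v \<in> carrier_mat N 1" using K v by simp_all
  have F: "?F \<in> carrier_mat (N + 1) (N + 1)" and U: "?U \<in> carrier_mat (N + 1) (N + 1)"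
    and V: "?V \<in> carrier_mat (N + 1) (N + 1)" by (intro four_block_carrier_mat carriers)+
  have dU: "det ?U = 1"
    using det_four_block_mat_upper_right_zero[OF carriers(5) refl mK carriers(6)] by simp
  have dV: "det ?V = 1"
    using det_four_block_mat_lower_left_zero[OF carriers(5) mv refl carriers(6)] by simp
  have FU: "?F * ?U = four_block_mat (P - \<beta> * K) \<beta> (0\<^sub>m 1 N) (1\<^sub>m 1)"
  proof -
    have "P * 1\<^sub>m N + \<beta> * (- K) = P - \<beta> * K" using P \<beta> K by (intro eq_matI) auto
    moreover have "P * 0\<^sub>m N 1 + \<beta> * 1\<^sub>m 1 = \<beta>" using P \<beta> by simp
    moreover have "K * 1\<^sub>m N + 1\<^sub>m 1 * (- K) = 0\<^sub>m 1 N" using K by (intro eq_matI) auto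
    moreover have "K * 0\<^sub>m N 1 + 1\<^sub>m 1 * 1\<^sub>m 1 = 1\<^sub>m 1" using K by simp
    ultimately show ?thesis
      using mult_four_block_mat[OF P \<beta> K carriers(6) carriers(5) carriers(7) mK carriers(6)] by simp
  qed
  have FV: "?F * ?V = four_block_mat P (0\<^sub>m N 1) K (1\<^sub>m 1 - K * v)"
  proof -
    have "P * 1\<^sub>m N + \<beta> * 0\<^sub>m 1 N = P" using P \<beta> by simp
    moreover have "P * (- v) + \<beta> * 1\<^sub>m 1 = 0\<^sub>m N 1" using P \<beta> v Pv by (intro eq_matI) auto
    moreover have "K * 1\<^sub>m N + 1\<^sub>m 1 * 0\<^sub>m 1 N = K" using K by simp
    moreover have "K * (- v) + 1\<^sub>m 1 * 1\<^sub>m 1 = 1\<^sub>m 1 - K * v" using K v by (intro eq_matI) auto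
    ultimately show ?thesis
      using mult_four_block_mat[OF P \<beta> K carriers(6) carriers(5) mv carriers(8) carriers(6)] by simp
  qed
  have PK: "P - \<beta> * K \<in> carrier_mat N N" and Kv: "1\<^sub>m 1 - K * v \<in> carrier_mat 1 1" using carriers by auto
  have "det (P - \<beta> * K) = det (?F * ?U)"
    unfolding FU using det_four_block_mat_lower_left_zero[OF PK \<beta> refl carriers(6)] by simp
  also have "\<dots> = det (?F * ?V)" unfolding det_mult[OF F U] det_mult[OF F V] dU dV ..
  also have "\<dots> = det P * det (1\<^sub>m 1 - K * v)"
    unfolding FV by (rule det_four_block_mat_upper_right_zero[OF P refl K Kv])
  also have "det (1\<^sub>m 1 - K * v) = 1 - (K * v) $$ (0, 0)"
    using K v by (subst det_single[OF Kv]) auto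
  finally show ?thesis .
qed

text \<open>The feedback is a rank one perturbation of the triangular matrix x - A_1. For x off its
  spectrum the determinant lemma applies, and clearing denominators leaves an expression that is
  polynomial in x and affine in the gain.\<close>

lemma char_poly_arrow_feedback:
  assumes K: "K \<in> carrier_mat 1 (n + 1)" and \<beta>: "\<beta> \<in> carrier_mat (n + 1) 1" "\<beta> $$ (0, 0) = 1"
    and x: "x \<noteq> 0" "\<And>i. i \<in> {1..n} \<Longrightarrow> x \<noteq> l i"
  shows "poly (char_poly (arrow n a l + \<beta> * K)) x
    = x * (\<Prod>i\<in>{1..n}. x - l i)
      - K $$ (0, 0) * (\<Prod>i\<in>{1..n}. x - l i)
      - (\<Sum>i\<in>{1..n}. K $$ (0, i) * (x * \<beta> $$ (i, 0) + a i) * (\<Prod>j\<in>{1..n} - {i}. x - l j))"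
proof -
  let ?N = "n + 1"
  define P where "P = mat ?N ?N (\<lambda>(i, j). if i = j then (if i = 0 then x else x - l i) else if j = 0 then - a i else 0)"
  \<comment> \<open>Forward substitution in P v = beta: row 0 gives 1 / x, and every other row
    involves only v_0 and v_i.\<close>
  define v where "v = mat ?N 1 (\<lambda>(i, j). if i = 0 then 1 / x else (\<beta> $$ (i, 0) + a i / x) / (x - l i))"
  let ?M = "arrow n a l + \<beta> * K"
  have M: "?M \<in> carrier_mat ?N ?N" using K \<beta> by auto
  have P: "P \<in> carrier_mat ?N ?N" and v: "v \<in> carrier_mat ?N 1" by (auto simp: P_def v_def)
  have Pv: "P * v = \<beta>"
  proof (rule eq_matI)
    fix i j assume "i < dim_row \<beta>" "j < dim_col \<beta>"
    then have ij: "i < ?N" "j = 0" using \<beta> by auto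
    have "(P * v) $$ (i, j) = (\<Sum>k<?N. P $$ (i, k) * v $$ (k, 0))"
      using ij by (simp add: P_def v_def scalar_prod_def lessThan_atLeast0)
    also have "\<dots> = (\<Sum>k\<in>{0, i}. P $$ (i, k) * v $$ (k, 0))"
      by (rule sum.mono_neutral_right) (use ij in \<open>auto simp: P_def\<close>)
    also have "\<dots> = \<beta> $$ (i, j)"
    proof (cases "i = 0")
      case False
      then have "x - l i \<noteq> 0" using x(2)[of i] ij by auto
      then show ?thesis using False ij x by (simp add: P_def v_def field_simps)
    qed (use ij \<beta> x in \<open>simp add: P_def v_def\<close>)
    finally show "(P * v) $$ (i, j) = \<beta> $$ (i, j)" .
  qed (use \<beta> in \<open>auto simp: P_def v_def\<close>)
  have "poly (char_poly ?M) x = det (- char_matrix ?M x)"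
    by (rule char_poly_matrix[OF M])
  also have "- char_matrix ?M x = P - \<beta> * K"
    using K \<beta> by (intro eq_matI) (auto simp: char_matrix_def P_def arrow_def)
  also have "det (P - \<beta> * K) = det P * (1 - (K * v) $$ (0, 0))"
    by (rule det_rank_one_update[OF P \<beta>(1) K v Pv])
  also have "det P = x * (\<Prod>i\<in>{1..n}. x - l i)"
  proof -
    have "det P = prod_list (diag_mat P)"
      by (rule det_lower_triangular[OF _ P]) (auto simp: P_def)
    also have "\<dots> = (\<Prod>i<?N. P $$ (i, i))"
      unfolding prod_list_diag_prod lessThan_atLeast0 carrier_matD(1)[OF P] ..
    also have "\<dots> = P $$ (0, 0) * (\<Prod>i\<in>{1..n}. P $$ (i, i))"
      using prod.lessThan_Suc_shift[of "\<lambda>i. P $$ (i, i)" n]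
      by (simp add: prod.atLeast1_atMost_eq)
    also have "\<dots> = x * (\<Prod>i\<in>{1..n}. x - l i)"
      by (intro arg_cong2[of _ _ _ _ "(*)"] prod.cong) (auto simp: P_def)
    finally show ?thesis .
  qed
  also have "(K * v) $$ (0, 0) = K $$ (0, 0) / x + (\<Sum>i\<in>{1..n}. K $$ (0, i) * ((\<beta> $$ (i, 0) + a i / x) / (x - l i)))"
  proof -
    have "(K * v) $$ (0, 0) = (\<Sum>k<?N. K $$ (0, k) * v $$ (k, 0))"
      using K by (simp add: v_def scalar_prod_def lessThan_atLeast0)
    also have "\<dots> = K $$ (0, 0) * v $$ (0, 0) + (\<Sum>i\<in>{1..n}. K $$ (0, i) * v $$ (i, 0))"
      using sum.lessThan_Suc_shift[of "\<lambda>k. K $$ (0, k) * v $$ (k, 0)" n]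
      by (simp add: sum.atLeast1_atMost_eq)
    also have "\<dots> = K $$ (0, 0) / x + (\<Sum>i\<in>{1..n}. K $$ (0, i) * ((\<beta> $$ (i, 0) + a i / x) / (x - l i)))"
      by (intro arg_cong2[of _ _ _ _ "(+)"] sum.cong) (auto simp: v_def)
    finally show ?thesis .
  qed
  also have "x * (\<Prod>i\<in>{1..n}. x - l i) * (1 - (K $$ (0, 0) / x + (\<Sum>i\<in>{1..n}. K $$ (0, i) * ((\<beta> $$ (i, 0) + a i / x) / (x - l i)))))
    = x * (\<Prod>i\<in>{1..n}. x - l i) - K $$ (0, 0) * (\<Prod>i\<in>{1..n}. x - l i)
      - (\<Sum>i\<in>{1..n}. x * (\<Prod>i\<in>{1..n}. x - l i) * (K $$ (0, i) * ((\<beta> $$ (i, 0) + a i / x) / (x - l i))))"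
    using x(1) by (simp add: ring_distribs sum_distrib_left)
  also have "(\<Sum>i\<in>{1..n}. x * (\<Prod>i\<in>{1..n}. x - l i) * (K $$ (0, i) * ((\<beta> $$ (i, 0) + a i / x) / (x - l i))))
      = (\<Sum>i\<in>{1..n}. K $$ (0, i) * (x * \<beta> $$ (i, 0) + a i) * (\<Prod>j\<in>{1..n} - {i}. x - l j))"
  proof (rule sum.cong[OF refl])
    have cancel: "x * (d * pr) * (k * ((be + al / x) / d)) = k * (x * be + al) * pr" if "d \<noteq> 0" for d pr k be al
      using that x(1) by (simp add: field_simps)
    fix i assume i: "i \<in> {1..n}"
    then have d: "x - l i \<noteq> 0" using x(2)[of i] by auto
    have eq: "(\<Prod>i\<in>{1..n}. x - l i) = (x - l i) * (\<Prod>j\<in>{1..n} - {i}. x - l j)"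
      using i by (intro prod.remove) auto
    show "x * (\<Prod>i\<in>{1..n}. x - l i) * (K $$ (0, i) * ((\<beta> $$ (i, 0) + a i / x) / (x - l i)))
        = K $$ (0, i) * (x * \<beta> $$ (i, 0) + a i) * (\<Prod>j\<in>{1..n} - {i}. x - l j)"
      unfolding eq by (rule cancel[OF d])
  qed
  finally show ?thesis .
qed

text \<open>By the formula for the characteristic polynomial, the gain must expand q = x lp - (x +
  1)^(n + 1), of degree at most n, in the polynomials lp and (a_i + x beta_i) times lp without its
  i-th factor. This is an interpolation problem at the distinct nodes l_i, and \<open>ctrl\<close>
  makes it solvable.\<close>

lemma pole_placement:
  assumes \<beta>: "\<beta> \<in> carrier_mat (n + 1) 1" "\<beta> $$ (0, 0) = (1::real)"
    and inj: "inj_on l {1..n}" and ctrl: "\<And>i. i \<in> {1..n} \<Longrightarrow> l i * \<beta> $$ (i, 0) + a i \<noteq> 0"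
  shows "\<exists>K\<in>carrier_mat 1 (n + 1). char_poly (arrow n a l + \<beta> * K) = [:1, 1:] ^ (n + 1)"
proof -
  define lp where "lp I = (\<Prod>i\<in>I. [:- l i, 1:])" for I
  have deglp: "degree (lp I) = card I" and lclp: "lead_coeff (lp I) = 1" if "finite I" for I
  proof -
    show "degree (lp I) = card I" unfolding lp_def by (subst degree_prod_eq_sum_degree) auto
    show "lead_coeff (lp I) = 1" unfolding lp_def by (simp add: lead_coeff_prod)
  qed
  have polylp: "poly (lp I) x = (\<Prod>i\<in>I. x - l i)" for I x by (simp add: lp_def poly_prod)
  let ?I = "{1..n}"
  define q where "q = [:0, 1:] * lp ?I - [:1, 1:] ^ (n + 1)"
  have d1: "degree ([:0, 1:] * lp ?I) = n + 1"
    using deglp[of ?I] lclp[of ?I] by (subst degree_mult_eq) auto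
  have l1: "lead_coeff ([:0, 1:] * lp ?I) = 1"
    using lclp[of ?I] by (simp only: lead_coeff_mult) simp
  have d2: "degree ([:1, 1:] ^ (n + 1) :: real poly) = n + 1" by (subst degree_power_eq) auto
  have l2: "lead_coeff ([:1, 1:] ^ (n + 1) :: real poly) = 1" by (simp only: lead_coeff_power) simp
  have degq: "degree q \<le> n"
  proof (rule degree_le, intro allI impI)
    fix i assume "n < i"
    show "Polynomial.coeff q i = 0"
    proof (cases "i = n + 1")
      case True
      then show ?thesis using l1 l2 d1 d2 by (simp add: q_def)
    next
      case False
      then have "degree q < i"
        unfolding q_def using \<open>n < i\<close> d1 d2 by (intro degree_diff_less) auto
      then show ?thesis by (rule coeff_eq_0)
    qed
  qed
  \<comment> \<open>At x = l i only the i-th summand survives; injectivity of \<open>l\<close> and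
    \<open>ctrl\<close> keep the denominator nonzero.\<close>
  define k where "k i = poly q (l i) / ((l i * \<beta> $$ (i, 0) + a i) * poly (lp (?I - {i})) (l i))" for i
  define r where "r = q - (\<Sum>i\<in>?I. Polynomial.smult (k i) ([:a i, \<beta> $$ (i, 0):] * lp (?I - {i})))"
  have degr: "degree r \<le> n"
    unfolding r_def
  proof (intro degree_diff_le degq degree_sum_le finite_atLeastAtMost)
    fix i assume "i \<in> ?I"
    have "degree ([:a i, \<beta> $$ (i, 0):] * lp (?I - {i})) \<le> 1 + card (?I - {i})"
      using degree_mult_le[of "[:a i, \<beta> $$ (i, 0):]" "lp (?I - {i})"] deglp[of "?I - {i}"]
        degree_pCons_le[of "a i" "[:\<beta> $$ (i, 0):]"] by simp
    also have "\<dots> = n" using \<open>i \<in> ?I\<close> by simp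
    finally show "degree (Polynomial.smult (k i) ([:a i, \<beta> $$ (i, 0):] * lp (?I - {i}))) \<le> n"
      using degree_smult_le order_trans by blast
  qed
  have rootr: "poly r (l m) = 0" if m: "m \<in> ?I" for m
  proof -
    have "(\<Sum>i\<in>?I. k i * ((a i + l m * \<beta> $$ (i, 0)) * poly (lp (?I - {i})) (l m)))
        = (\<Sum>i\<in>?I. if i = m then poly q (l m) else 0)"
    proof (rule sum.cong[OF refl])
      fix i assume i: "i \<in> ?I"
      show "k i * ((a i + l m * \<beta> $$ (i, 0)) * poly (lp (?I - {i})) (l m)) = (if i = m then poly q (l m) else 0)"
      proof (cases "i = m")
        case True
        have "l i - l j \<noteq> 0" if "j \<in> ?I - {i}" for j
          using inj_onD[OF inj, of i j] i that by auto
        then have "poly (lp (?I - {i})) (l i) \<noteq> 0"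
          unfolding polylp by (subst prod_zero_iff) auto
        then show ?thesis using True ctrl[OF i] by (simp add: k_def add.commute)
      next
        case False
        then have "poly (lp (?I - {i})) (l m) = 0" using m by (auto simp: polylp)
        then show ?thesis using False by simp
      qed
    qed
    also have "\<dots> = poly q (l m)" using m by simp
    finally show ?thesis by (simp add: r_def poly_sum algebra_simps)
  qed
  \<comment> \<open>The remainder vanishes at all n nodes and has degree at most n, so it is a
    multiple of the monic \<open>lp\<close>; its coefficient of degree n is the factor.\<close>
  define k0 where "k0 = Polynomial.coeff r n"
  define s where "s = r - Polynomial.smult k0 (lp ?I)"
  have "s = 0"
  proof (rule ccontr)
    assume s0: "s \<noteq> 0"
    have "degree s \<le> n"
      unfolding s_def using degr deglp[of ?I] by (intro degree_diff_le) (auto intro: order_trans[OF degree_smult_le])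
    moreover have "Polynomial.coeff s n = 0" using lclp[of ?I] deglp[of ?I] by (simp add: s_def k0_def)
    then have "degree s \<noteq> n" using s0 by auto
    ultimately have "degree s < n" by simp
    moreover have "poly (lp ?I) (l m) = 0" if "m \<in> ?I" for m using that by (auto simp: polylp)
    then have "l ` ?I \<subseteq> {x. poly s x = 0}" using rootr by (auto simp: s_def)
    then have "card (l ` ?I) \<le> card {x. poly s x = 0}" using poly_roots_finite[OF s0] by (intro card_mono)
    then have "n \<le> card {x. poly s x = 0}" using card_image[OF inj] by simp
    moreover have "card {x. poly s x = 0} \<le> degree s" by (rule card_poly_roots_bound[OF s0])
    ultimately show False by simp
  qed
  then have req: "r = Polynomial.smult k0 (lp ?I)" by (simp add: s_def)
  define K where "K = mat 1 (n + 1) (\<lambda>(i, j). if j = 0 then k0 else k j)"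
  have K: "K \<in> carrier_mat 1 (n + 1)" by (simp add: K_def)
  let ?p = "char_poly (arrow n a l + \<beta> * K)"
  \<comment> \<open>The formula is available only off the spectrum of the arrow matrix. Two
    polynomials that agree outside a finite set are equal.\<close>
  have agree: "poly ?p x = poly ([:1, 1:] ^ (n + 1)) x" if x: "x \<notin> insert 0 (l ` ?I)" for x
  proof -
    have "poly ?p x = x * (\<Prod>i\<in>?I. x - l i) - k0 * (\<Prod>i\<in>?I. x - l i)
      - (\<Sum>i\<in>?I. K $$ (0, i) * (x * \<beta> $$ (i, 0) + a i) * (\<Prod>j\<in>?I - {i}. x - l j))"
      using x by (subst char_poly_arrow_feedback[OF K \<beta>]) (auto simp: K_def)
    also have "(\<Sum>i\<in>?I. K $$ (0, i) * (x * \<beta> $$ (i, 0) + a i) * (\<Prod>j\<in>?I - {i}. x - l j))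
        = (\<Sum>i\<in>?I. k i * ((a i + x * \<beta> $$ (i, 0)) * poly (lp (?I - {i})) x))"
      by (rule sum.cong) (auto simp: K_def polylp)
    also have "\<dots> = poly q x - poly r x"
      by (simp add: r_def poly_sum algebra_simps)
    also have "poly r x = k0 * (\<Prod>i\<in>?I. x - l i)" by (simp add: req polylp)
    also have "poly q x = x * (\<Prod>i\<in>?I. x - l i) - poly ([:1, 1:] ^ (n + 1)) x"
      by (simp add: q_def polylp)
    finally show ?thesis by simp
  qed
  have "?p - [:1, 1:] ^ (n + 1) = 0"
  proof (rule ccontr)
    assume "?p - [:1, 1:] ^ (n + 1) \<noteq> 0"
    then have "finite {x. poly (?p - [:1, 1:] ^ (n + 1)) x = 0}" by (rule poly_roots_finite)
    moreover have "- insert 0 (l ` ?I) \<subseteq> {x. poly (?p - [:1, 1:] ^ (n + 1)) x = 0}"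
      using agree by (auto simp del: power_Suc)
    ultimately have "finite (- insert 0 (l ` ?I))" by (rule finite_subset[rotated])
    then have "finite (UNIV :: real set)"
      by (metis finite.emptyI finite_imageI finite_insert finite_atLeastAtMost finite_compl)
    then show False using infinite_UNIV_char_0 by blast
  qed
  then show ?thesis using K by (intro bexI[of _ K]) auto
qed

section \<open>The closed-loop ordinary differential equation\<close>

text \<open>The solution of x' = - x + f inherits the slower rate 1/2 of its forcing without a
  polynomial factor, so the estimate can be iterated along a triangular system at the same
  rate.\<close>

lemma scalar_decay:
  fixes x f :: "real \<Rightarrow> real"
  assumes deriv: "\<And>t. t \<ge> t0 \<Longrightarrow> (x has_real_derivative (f t - x t)) (at t within {t0..})"
    and f: "\<And>t. t \<ge> t0 \<Longrightarrow> \<bar>f t\<bar> \<le> F * exp (- t / 2)" and t: "t \<ge> t0"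
  shows "\<bar>x t\<bar> \<le> (\<bar>x t0\<bar> * exp (t0 / 2) + 2 * F) * exp (- t / 2)"
proof -
  have F0: "0 \<le> F" using order_trans[OF abs_ge_zero f[of t0]] by (simp add: zero_le_mult_iff)
  have upper: "x t \<le> (\<bar>x t0\<bar> * exp (t0 / 2) + 2 * F) * exp (- t / 2)"
    if deriv: "\<And>t. t \<ge> t0 \<Longrightarrow> (x has_real_derivative (f t - x t)) (at t within {t0..})"
      and f: "\<And>t. t \<ge> t0 \<Longrightarrow> \<bar>f t\<bar> \<le> F * exp (- t / 2)" for x f :: "real \<Rightarrow> real"
  proof -
    \<comment> \<open>Nondecreasing by the bound on \<open>f\<close>; the coefficient 2 F comes from
      integrating F exp (s / 2).\<close>
    let ?y = "\<lambda>t. 2 * F * exp (t / 2) - exp t * x t"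
    have dy: "(?y has_real_derivative (F * exp (t / 2) - exp t * f t)) (at t within {t0..})" if "t \<ge> t0" for t
      by (auto intro!: derivative_eq_intros deriv that simp: algebra_simps)
    have "?y t0 \<le> ?y t"
    proof (rule DERIV_nonneg_imp_increasing_open[OF t])
      fix s assume s: "t0 < s" "s < t"
      have "(?y has_real_derivative (F * exp (s / 2) - exp s * f s)) (at s)"
        using dy[of s] s at_within_interior[of s "{t0..}"] by simp
      moreover have "exp s * f s \<le> exp s * (F * exp (- s / 2))" using f[of s] s by (intro mult_left_mono) auto
      then have "exp s * f s \<le> F * exp (s / 2)" by (simp add: exp_add[symmetric] mult_ac)
      ultimately show "\<exists>y. (?y has_real_derivative y) (at s) \<and> 0 \<le> y" by (intro exI conjI) auto
    next
      show "continuous_on {t0..t} ?y"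
        using has_field_derivative_subset[OF dy, of _ "{t0..t}"]
        by (intro DERIV_continuous_on) auto
    qed
    then have "exp t * x t \<le> exp t0 * x t0 + 2 * F * exp (t / 2)"
      using mult_nonneg_nonneg[OF F0 exp_ge_zero[of "t0 / 2"]] by linarith
    also have "\<dots> \<le> exp t0 * \<bar>x t0\<bar> + 2 * F * exp (t / 2)" by simp
    also have "exp t0 * \<bar>x t0\<bar> \<le> exp (t0 / 2) * exp (t / 2) * \<bar>x t0\<bar>"
      using t by (intro mult_right_mono) (auto simp: exp_add[symmetric])
    finally have "exp t * x t \<le> (\<bar>x t0\<bar> * exp (t0 / 2) + 2 * F) * exp (t / 2)" by (simp add: algebra_simps)
    then have le: "exp (- t) * (exp t * x t) \<le> exp (- t) * ((\<bar>x t0\<bar> * exp (t0 / 2) + 2 * F) * exp (t / 2))"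
      by (rule mult_left_mono) simp
    have "x t = exp (- t) * (exp t * x t)" by (simp add: exp_minus)
    also note le
    also have "exp (- t) * ((\<bar>x t0\<bar> * exp (t0 / 2) + 2 * F) * exp (t / 2))
        = (\<bar>x t0\<bar> * exp (t0 / 2) + 2 * F) * (exp (- t) * exp (t / 2))" by (simp only: mult_ac)
    also have "exp (- t) * exp (t / 2) = exp (- t / 2)" by (simp add: exp_add[symmetric])
    finally show ?thesis .
  qed
  have "x t \<le> (\<bar>x t0\<bar> * exp (t0 / 2) + 2 * F) * exp (- t / 2)" by (rule upper[OF deriv f])
  moreover have "- x t \<le> (\<bar>- x t0\<bar> * exp (t0 / 2) + 2 * F) * exp (- t / 2)"
    by (rule upper[where f = "\<lambda>t. - f t"]) (use f in \<open>auto intro!: derivative_eq_intros deriv\<close>)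
  ultimately show ?thesis by (simp add: abs_le_iff)
qed

lemma triangular_sum:
  fixes T :: "nat \<Rightarrow> nat \<Rightarrow> real"
  assumes "\<And>i j. i < N \<Longrightarrow> j < i \<Longrightarrow> T i j = 0" "i < N"
  shows "(\<Sum>j<N. T i j * W j) = T i i * W i + (\<Sum>j\<in>{i<..<N}. T i j * W j)"
proof -
  have "(\<Sum>j<N. T i j * W j) = (\<Sum>j\<in>{i..<N}. T i j * W j)"
    by (rule sum.mono_neutral_right) (use assms in auto)
  also have "{i..<N} = insert i {i<..<N}" using assms(2) by auto
  finally show ?thesis by simp
qed

text \<open>Row i is driven only by later rows, so the induction runs from the last row upwards with
  \<open>scalar_decay\<close> at each row.\<close>

lemma triangular_decay:
  fixes T :: "nat \<Rightarrow> nat \<Rightarrow> real" and W :: "nat \<Rightarrow> real \<Rightarrow> real"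
  assumes tri: "\<And>i j. i < N \<Longrightarrow> j < i \<Longrightarrow> T i j = 0" and diag: "\<And>i. i < N \<Longrightarrow> T i i = - 1"
    and W: "\<And>i t. i < N \<Longrightarrow> t \<ge> t0 \<Longrightarrow> (W i has_real_derivative (\<Sum>j<N. T i j * W j t)) (at t within {t0..})"
  shows "i < N \<Longrightarrow> \<exists>C. \<forall>t\<ge>t0. \<bar>W i t\<bar> \<le> C * exp (- t / 2)"
proof (induction "N - i" arbitrary: i rule: less_induct)
  case less
  let ?f = "\<lambda>t. \<Sum>j\<in>{i<..<N}. T i j * W j t"
  have "\<exists>C. \<forall>t\<ge>t0. \<bar>W j t\<bar> \<le> C * exp (- t / 2)" if "j \<in> {i<..<N}" for j
    using less(1)[of j] that less(2) by auto
  then obtain C where C: "\<And>j t. j \<in> {i<..<N} \<Longrightarrow> t \<ge> t0 \<Longrightarrow> \<bar>W j t\<bar> \<le> C j * exp (- t / 2)" by metis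
  have f: "\<bar>?f t\<bar> \<le> (\<Sum>j\<in>{i<..<N}. \<bar>T i j\<bar> * C j) * exp (- t / 2)" if "t \<ge> t0" for t
  proof -
    have "\<bar>?f t\<bar> \<le> (\<Sum>j\<in>{i<..<N}. \<bar>T i j\<bar> * \<bar>W j t\<bar>)" by (rule order_trans[OF sum_abs]) (simp add: abs_mult)
    also have "\<dots> \<le> (\<Sum>j\<in>{i<..<N}. \<bar>T i j\<bar> * (C j * exp (- t / 2)))"
      by (intro sum_mono mult_left_mono C that) auto
    finally show ?thesis by (simp add: sum_distrib_left sum_distrib_right mult_ac)
  qed
  have "(W i has_real_derivative (?f t - W i t)) (at t within {t0..})" if "t \<ge> t0" for t
    using W[OF less(2) that] triangular_sum[of N T i "\<lambda>j. W j t", OF tri less(2)] diag[OF less(2)] by simp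
  from scalar_decay[OF this f] show ?case by blast
qed

text \<open>Back substitution: once the rows below are solved, the next row is a scalar equation
  with known continuous forcing.\<close>

lemma triangular_solution:
  fixes T :: "nat \<Rightarrow> nat \<Rightarrow> real"
  assumes tri: "\<And>i j. i < N \<Longrightarrow> j < i \<Longrightarrow> T i j = 0" and diag: "\<And>i. i < N \<Longrightarrow> T i i = - 1"
  shows "\<exists>W. \<forall>i<N. W i t0 = w i \<and> (\<forall>t. (W i has_real_derivative (\<Sum>j<N. T i j * W j t)) (at t))"
proof -
  have "\<exists>W. \<forall>i<N. N - k \<le> i \<longrightarrow> W i t0 = w i \<and> (\<forall>t. (W i has_real_derivative (\<Sum>j<N. T i j * W j t)) (at t))" for k
  proof (induction k)
    case 0
    show ?case by auto
  next
    case (Suc k)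
    then obtain W where W: "\<And>i. i < N \<Longrightarrow> N - k \<le> i \<Longrightarrow> W i t0 = w i"
      "\<And>i t. i < N \<Longrightarrow> N - k \<le> i \<Longrightarrow> (W i has_real_derivative (\<Sum>j<N. T i j * W j t)) (at t)" by blast
    show ?case
    proof (cases "k < N")
      case False
      then show ?thesis using W by (intro exI[of _ W]) auto
    next
      case True
      define m where "m = N - Suc k"
      have m: "m < N" "Suc m = N - k" using True by (auto simp: m_def)
      let ?f = "\<lambda>t. \<Sum>j\<in>{m<..<N}. T m j * W j t"
      have "continuous_on UNIV (W j)" if "j \<in> {m<..<N}" for j
        using W(2)[of j] that m by (auto intro!: continuous_at_imp_continuous_on DERIV_isCont)
      then have "continuous_on UNIV (\<lambda>t. exp t * ?f t)" by (intro continuous_intros) auto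
      then obtain G where G: "\<And>t. (G has_real_derivative exp t * ?f t) (at t)"
        using antiderivative_on_line by blast
      \<comment> \<open>Variation of constants for x' = - x + f with the prescribed value at
        t0.\<close>
      define x where "x t = exp (- t) * (exp t0 * w m + G t - G t0)" for t
      have x: "(x has_real_derivative (- x t + ?f t)) (at t)" for t
        unfolding x_def by (auto intro!: derivative_eq_intros G simp: exp_minus field_simps)
      define V where "V = W(m := x)"
      have Vj: "V j = W j" if "j \<noteq> m" for j using that by (simp add: V_def)
      have sumV: "(\<Sum>j<N. T i j * V j t) = T i i * V i t + (\<Sum>j\<in>{i<..<N}. T i j * W j t)" if "i < N" "m \<le> i" for i t
      proof -
        have "(\<Sum>j\<in>{i<..<N}. T i j * V j t) = (\<Sum>j\<in>{i<..<N}. T i j * W j t)"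
          by (rule sum.cong) (use that in \<open>auto simp: V_def\<close>)
        then show ?thesis using triangular_sum[of N T i "\<lambda>j. V j t", OF tri that(1)] by simp
      qed
      have "V i t0 = w i \<and> (\<forall>t. (V i has_real_derivative (\<Sum>j<N. T i j * V j t)) (at t))" if i: "i < N" "N - Suc k \<le> i" for i
      proof (cases "i = m")
        case True
        have "x t0 = w m" by (simp add: x_def exp_add[symmetric] mult.assoc[symmetric])
        then show ?thesis using x sumV[OF i(1)] True diag[OF m(1)] by (simp add: V_def)
      next
        case False
        then have i': "N - k \<le> i" "m \<le> i" using i m by auto
        show ?thesis
          using W[OF i(1) i'(1)] sumV[OF i(1) i'(2)] triangular_sum[of N T i "\<lambda>j. W j _", OF tri i(1)] Vj[OF False]
          by simp
      qed
      then show ?thesis by blast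
    qed
  qed
  from this[of N] show ?thesis by simp
qed

text \<open>The characteristic polynomial splits over the reals, so a real Schur decomposition
  exists, and its diagonal can only contain -1. The matrix identities are given entrywise for use
  with families of functions.\<close>

lemma triangular_form:
  fixes M :: "real mat"
  assumes M: "M \<in> carrier_mat N N" and cp: "char_poly M = [:1, 1:] ^ N"
  obtains T P Q where "\<And>i j. i < N \<Longrightarrow> j < i \<Longrightarrow> T i j = 0" "\<And>i. i < N \<Longrightarrow> T i i = (- 1::real)"
    "\<And>i k. i < N \<Longrightarrow> k < N \<Longrightarrow> (\<Sum>j<N. Q i j * M $$ (j, k)) = (\<Sum>j<N. T i j * Q j k)"
    "\<And>i k. i < N \<Longrightarrow> k < N \<Longrightarrow> (\<Sum>j<N. M $$ (i, j) * P j k) = (\<Sum>j<N. P i j * T j k)"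
    "\<And>i k. i < N \<Longrightarrow> k < N \<Longrightarrow> (\<Sum>j<N. P i j * Q j k) = (if i = k then 1 else 0)"
proof -
  have "char_poly M = (\<Prod>a\<leftarrow>replicate N (- 1). [:- a, 1:])"
    using cp by (simp add: prod_list_replicate)
  from schur_decomposition_exists[OF M this] obtain B where
    B: "B \<in> carrier_mat N N" "upper_triangular B" "similar_mat M B" by blast
  obtain P Q where PQ: "P \<in> carrier_mat N N" "Q \<in> carrier_mat N N" "P * Q = 1\<^sub>m N" "Q * P = 1\<^sub>m N" "M = P * B * Q"
    using B(3) M unfolding similar_mat_def similar_mat_wit_def Let_def by auto
  have BQ: "B * Q \<in> carrier_mat N N" and PB: "P * B \<in> carrier_mat N N" using PQ B(1) by auto
  have QM: "Q * M = B * Q"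
    unfolding PQ(5) assoc_mult_mat[OF PQ(1) B(1) PQ(2)] assoc_mult_mat[OF PQ(2,1) BQ, symmetric]
    by (simp only: PQ(4) left_mult_one_mat[OF BQ])
  have MP: "M * P = P * B"
    unfolding PQ(5) assoc_mult_mat[OF PB PQ(2,1)] by (simp only: PQ(4) right_mult_one_mat[OF PB])
  have diag: "B $$ (i, i) = - 1" if i: "i < N" for i
  proof -
    have "char_poly B = [:1, 1:] ^ N" using char_poly_similar[OF B(3)] cp by simp
    moreover have "char_poly B = (\<Prod>a\<leftarrow>diag_mat B. [:- a, 1:])"
      by (rule char_poly_upper_triangular[OF B(1,2)])
    moreover have "B $$ (i, i) \<in> set (diag_mat B)" using i B(1) by (auto simp: diag_mat_def)
    then have "poly (\<Prod>a\<leftarrow>diag_mat B. [:- a, 1:]) (B $$ (i, i)) = 0"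
      by (force simp: poly_prod_list prod_list_zero_iff)
    ultimately have "poly ([:1, 1:] ^ N) (B $$ (i, i)) = 0" by simp
    then show ?thesis by (simp add: poly_power)
  qed
  have mult: "(\<Sum>j<N. X $$ (i, j) * Y $$ (j, k)) = (X * Y) $$ (i, k)"
    if "X \<in> carrier_mat N N" "Y \<in> carrier_mat N N" "i < N" "k < N" for X Y :: "real mat" and i k
    using that by (simp add: scalar_prod_def lessThan_atLeast0)
  show ?thesis
  proof (rule that[of "\<lambda>i j. B $$ (i, j)" "\<lambda>i j. Q $$ (i, j)" "\<lambda>i j. P $$ (i, j)"])
    show "B $$ (i, j) = 0" if "i < N" "j < i" for i j using B(1,2) that by auto
  qed (auto simp: diag mult PQ(1-3) M B(1) QM MP)
qed

text \<open>In the coordinates W = Q Z the system is triangular; returning by P costs only a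
  constant.\<close>

lemma stable_decay:
  fixes M :: "real mat"
  assumes M: "M \<in> carrier_mat N N" and cp: "char_poly M = [:1, 1:] ^ N"
    and Z: "\<And>i t. i < N \<Longrightarrow> t \<ge> t0 \<Longrightarrow> (Z i has_real_derivative (\<Sum>j<N. M $$ (i, j) * Z j t)) (at t within {t0..})"
  shows "\<exists>C. \<forall>i<N. \<forall>t\<ge>t0. \<bar>Z i t\<bar> \<le> C * exp (- t / 2)"
proof (rule triangular_form[OF M cp])
  fix T P Q
  assume tri: "\<And>i j. i < N \<Longrightarrow> j < i \<Longrightarrow> T i j = 0" and diag: "\<And>i. i < N \<Longrightarrow> T i i = (- 1::real)"
    and QM: "\<And>i k. i < N \<Longrightarrow> k < N \<Longrightarrow> (\<Sum>j<N. Q i j * M $$ (j, k)) = (\<Sum>j<N. T i j * Q j k)"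
    and PQ: "\<And>i k. i < N \<Longrightarrow> k < N \<Longrightarrow> (\<Sum>j<N. P i j * Q j k) = (if i = k then 1 else 0)"
  define W where "W i t = (\<Sum>j<N. Q i j * Z j t)" for i t
  have "(W i has_real_derivative (\<Sum>j<N. T i j * W j t)) (at t within {t0..})" if i: "i < N" and t: "t \<ge> t0" for i t
  proof -
    have "(W i has_real_derivative (\<Sum>j<N. Q i j * (\<Sum>k<N. M $$ (j, k) * Z k t))) (at t within {t0..})"
      unfolding W_def by (intro DERIV_sum DERIV_cmult Z t) auto
    also have "(\<Sum>j<N. Q i j * (\<Sum>k<N. M $$ (j, k) * Z k t)) = (\<Sum>k<N. (\<Sum>j<N. Q i j * M $$ (j, k)) * Z k t)"
      unfolding sum_distrib_left sum_distrib_right by (subst sum.swap) (simp add: mult_ac)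
    also have "\<dots> = (\<Sum>k<N. (\<Sum>j<N. T i j * Q j k) * Z k t)"
      by (intro sum.cong refl) (simp add: QM i)
    also have "\<dots> = (\<Sum>j<N. T i j * W j t)"
      unfolding sum_distrib_left sum_distrib_right W_def by (subst sum.swap) (simp add: mult_ac)
    finally show ?thesis .
  qed
  from triangular_decay[OF tri diag this] have "\<forall>i<N. \<exists>C. \<forall>t\<ge>t0. \<bar>W i t\<bar> \<le> C * exp (- t / 2)" by blast
  then obtain C where C: "\<And>i t. i < N \<Longrightarrow> t \<ge> t0 \<Longrightarrow> \<bar>W i t\<bar> \<le> C i * exp (- t / 2)" by metis
  have ZW: "Z i t = (\<Sum>j<N. P i j * W j t)" if i: "i < N" for i t
  proof -
    have "(\<Sum>j<N. P i j * W j t) = (\<Sum>k<N. (\<Sum>j<N. P i j * Q j k) * Z k t)"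
      unfolding W_def sum_distrib_left sum_distrib_right by (subst sum.swap) (simp add: mult_ac)
    also have "\<dots> = (\<Sum>k<N. if k = i then Z k t else 0)"
      by (intro sum.cong refl) (auto simp: PQ i)
    finally show ?thesis using i by simp
  qed
  define K where "K = (\<Sum>i<N. \<Sum>j<N. \<bar>P i j\<bar> * \<bar>C j\<bar>)"
  have "\<bar>Z i t\<bar> \<le> K * exp (- t / 2)" if i: "i < N" and t: "t \<ge> t0" for i t
  proof -
    have "\<bar>Z i t\<bar> \<le> (\<Sum>j<N. \<bar>P i j\<bar> * \<bar>W j t\<bar>)"
      unfolding ZW[OF i] by (rule order_trans[OF sum_abs]) (simp add: abs_mult)
    also have "\<dots> \<le> (\<Sum>j<N. \<bar>P i j\<bar> * (\<bar>C j\<bar> * exp (- t / 2)))"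
    proof (intro sum_mono mult_left_mono)
      fix j assume "j \<in> {..<N}"
      then have "\<bar>W j t\<bar> \<le> C j * exp (- t / 2)" using C t by simp
      also have "\<dots> \<le> \<bar>C j\<bar> * exp (- t / 2)" by (intro mult_right_mono) auto
      finally show "\<bar>W j t\<bar> \<le> \<bar>C j\<bar> * exp (- t / 2)" .
    qed simp
    also have "\<dots> = (\<Sum>j<N. \<bar>P i j\<bar> * \<bar>C j\<bar>) * exp (- t / 2)" by (simp add: sum_distrib_left sum_distrib_right mult_ac)
    also have "\<dots> \<le> K * exp (- t / 2)"
      unfolding K_def using i
      by (intro mult_right_mono member_le_sum[of i "{..<N}" "\<lambda>i. \<Sum>j<N. \<bar>P i j\<bar> * \<bar>C j\<bar>"]) (auto intro: sum_nonneg)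
    finally show ?thesis .
  qed
  then show ?thesis by blast
qed

lemma stable_solution:
  fixes M :: "real mat"
  assumes M: "M \<in> carrier_mat N N" and cp: "char_poly M = [:1, 1:] ^ N"
  shows "\<exists>Z. \<forall>i<N. Z i t0 = z i \<and> (\<forall>t. (Z i has_real_derivative (\<Sum>j<N. M $$ (i, j) * Z j t)) (at t))"
proof (rule triangular_form[OF M cp])
  fix T P Q
  assume tri: "\<And>i j. i < N \<Longrightarrow> j < i \<Longrightarrow> T i j = 0" and diag: "\<And>i. i < N \<Longrightarrow> T i i = (- 1::real)"
    and MP: "\<And>i k. i < N \<Longrightarrow> k < N \<Longrightarrow> (\<Sum>j<N. M $$ (i, j) * P j k) = (\<Sum>j<N. P i j * T j k)"
    and PQ: "\<And>i k. i < N \<Longrightarrow> k < N \<Longrightarrow> (\<Sum>j<N. P i j * Q j k) = (if i = k then 1 else 0)"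
  obtain W where W0: "\<And>i. i < N \<Longrightarrow> W i t0 = (\<Sum>k<N. Q i k * z k)"
    and W: "\<And>i t. i < N \<Longrightarrow> (W i has_real_derivative (\<Sum>j<N. T i j * W j t)) (at t)"
    using triangular_solution[of N T t0 "\<lambda>i. \<Sum>k<N. Q i k * z k", OF tri diag] by blast
  define Z where "Z i t = (\<Sum>j<N. P i j * W j t)" for i t
  have "Z i t0 = z i" if i: "i < N" for i
  proof -
    have "Z i t0 = (\<Sum>k<N. (\<Sum>j<N. P i j * Q j k) * z k)"
      unfolding Z_def sum_distrib_right
      by (subst sum.swap) (simp add: W0 sum_distrib_left mult_ac)
    also have "\<dots> = (\<Sum>k<N. if k = i then z k else 0)"
      by (intro sum.cong refl) (auto simp: PQ i)
    finally show ?thesis using i by simp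
  qed
  moreover have "(Z i has_real_derivative (\<Sum>j<N. M $$ (i, j) * Z j t)) (at t)" if i: "i < N" for i t
  proof -
    have "(Z i has_real_derivative (\<Sum>j<N. P i j * (\<Sum>k<N. T j k * W k t))) (at t)"
      unfolding Z_def by (intro DERIV_sum DERIV_cmult W) auto
    also have "(\<Sum>j<N. P i j * (\<Sum>k<N. T j k * W k t)) = (\<Sum>k<N. (\<Sum>j<N. P i j * T j k) * W k t)"
      unfolding sum_distrib_left sum_distrib_right by (subst sum.swap) (simp add: mult_ac)
    also have "\<dots> = (\<Sum>k<N. (\<Sum>j<N. M $$ (i, j) * P j k) * W k t)"
      by (intro sum.cong refl) (simp add: MP i)
    also have "\<dots> = (\<Sum>j<N. M $$ (i, j) * Z j t)"
      unfolding sum_distrib_left sum_distrib_right Z_def by (subst sum.swap) (simp add: mult_ac)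
    finally show ?thesis .
  qed
  ultimately show ?thesis by blast
qed

text \<open>A root of multiplicity N exhausts a monic polynomial of degree N. So the multiplicity
  demanded of an admissible gain determines the whole characteristic polynomial.\<close>

lemma char_poly_of_order:
  fixes M :: "real mat"
  assumes "M \<in> carrier_mat N N" "Polynomial.order (- 1) (char_poly M) = N"
  shows "char_poly M = [:1, 1:] ^ N"
proof -
  have deg: "degree (char_poly M) = N" and monic: "monic (char_poly M)"
    using degree_monic_char_poly[OF assms(1)] by auto
  have "[:- (- 1), 1:] ^ N dvd char_poly M" using order_1[of "- 1" "char_poly M"] assms(2) by simp
  then obtain q where q: "char_poly M = [:1, 1:] ^ N * q" by (auto simp: dvd_def)
  have nz: "char_poly M \<noteq> 0" using monic by auto
  have "degree (char_poly M) = N + degree q"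
    using nz unfolding q by (subst degree_mult_eq) (auto simp: degree_power_eq)
  then have "degree q = 0" using deg by simp
  then obtain k where k: "q = [:k:]" by (metis degree_eq_zeroE)
  have "lead_coeff (char_poly M) = k" unfolding q k lead_coeff_mult by (simp add: lead_coeff_power)
  then have "k = 1" using monic by simp
  then show ?thesis using q k by simp
qed

lemma order_of_char_poly: "char_poly M = [:1, 1:] ^ N \<Longrightarrow> Polynomial.order (- 1 :: real) (char_poly M) = N"
  using order_power_n_n[of "- 1 :: real" N] by simp

section \<open>The system driven by a given control\<close>

lemma LINT_Icc_FTC:
  fixes G g :: "real \<Rightarrow> real"
  assumes "p \<le> q" "\<And>x. (G has_real_derivative g x) (at x)" "continuous_on UNIV g"
  shows "(LINT s|lebesgue_on {p..q}. g s) = G q - G p" "integrable (lebesgue_on {p..q}) g"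
proof -
  have "set_integrable lborel {p..q} g"
    by (rule borel_integrable_atLeastAtMost') (rule continuous_on_subset[OF assms(3)], simp)
  then have "integrable lborel (\<lambda>x. indicator {p..q} x *\<^sub>R g x)" by (simp add: set_integrable_def)
  then have "integrable lebesgue (\<lambda>x. indicator {p..q} x *\<^sub>R g x)"
    using borel_measurable_continuous_onI[OF assms(3)] by (subst integrable_completion) auto
  then show int: "integrable (lebesgue_on {p..q}) g"
    by (subst integrable_restrict_space) auto
  have "(g has_integral (G q - G p)) {p..q}"
    using assms by (intro fundamental_theorem_of_calculus)
      (auto simp: has_real_derivative_iff_has_vector_derivative[symmetric] intro: has_field_derivative_at_within)
  then show "(LINT s|lebesgue_on {p..q}. g s) = G q - G p"
    using lebesgue_integral_eq_integral[OF int] by (simp add: integral_unique)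
qed

text \<open>The control jumps from 0 to a continuous function. Taking the maximum of
  \<open>q\<close> and \<open>p'\<close> keeps the formula correct when the interval ends before the
  jump.\<close>

lemma LINT_cutoff:
  fixes f g G :: "real \<Rightarrow> real"
  assumes p: "p \<le> p'" and f: "\<And>s. f s = (if s < p' then 0 else g s)"
    and G: "\<And>x. (G has_real_derivative g x) (at x)" and g: "continuous_on UNIV g"
  shows "(LINT s|lebesgue_on {p..q}. f s) = G (max q p') - G p'" "integrable (lebesgue_on {p..q}) f"
proof -
  let ?q = "max q p'"
  note base = LINT_Icc_FTC[of p' ?q G g, OF _ G g]
  \<comment> \<open>At the jump itself the two sides can differ, namely if q < p', where the right
    interval degenerates to that point.\<close>
  have eqf: "indicator {p..q} s *\<^sub>R f s = indicator {p'..?q} s *\<^sub>R g s" if "s \<noteq> p'" for s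
    using p f[of s] that by (auto simp: indicator_def)
  have ae: "AE s in lebesgue. indicator {p..q} s *\<^sub>R f s = indicator {p'..?q} s *\<^sub>R g s"
    using AE_completion[OF AE_lborel_singleton[of p']] by eventually_elim (rule eqf)
  have gm [measurable]: "g \<in> borel_measurable borel" by (rule borel_measurable_continuous_onI[OF g])
  have fm [measurable]: "f \<in> borel_measurable borel"
  proof -
    have "f = (\<lambda>s. if s < p' then 0 else g s)" using f by auto
    also have "\<dots> \<in> borel_measurable borel" by measurable
    finally show ?thesis .
  qed
  have lf: "(\<lambda>s. indicator {p..q} s *\<^sub>R f s) \<in> borel_measurable lebesgue"
    and lg: "(\<lambda>s. indicator {p'..?q} s *\<^sub>R g s) \<in> borel_measurable lebesgue"
    by (rule measurable_completion, measurable)+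
  have "integrable lebesgue (\<lambda>s. indicator {p'..?q} s *\<^sub>R g s)"
    using base(2)[OF max.cobounded2] by (subst (asm) integrable_restrict_space) auto
  then have "integrable lebesgue (\<lambda>s. indicator {p..q} s *\<^sub>R f s)"
    using integrable_cong_AE[OF lf lg ae] by simp
  then show "integrable (lebesgue_on {p..q}) f" by (subst integrable_restrict_space) auto
  have "(LINT s|lebesgue_on {p..q}. f s) = (LINT s|lebesgue. indicator {p..q} s *\<^sub>R f s)"
    by (subst integral_restrict_space) auto
  also have "\<dots> = (LINT s|lebesgue. indicator {p'..?q} s *\<^sub>R g s)" by (rule integral_cong_AE[OF lf lg ae])
  also have "\<dots> = (LINT s|lebesgue_on {p'..?q}. g s)" by (subst integral_restrict_space) auto
  finally show "(LINT s|lebesgue_on {p..q}. f s) = G (max q p') - G p'" using base(1)[OF max.cobounded2] by simp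
qed

lemma LINT_Icc_bound:
  fixes f :: "real \<Rightarrow> real"
  assumes "integrable (lebesgue_on {p..q}) f" "p \<le> q" "\<And>s. s \<in> {p..q} \<Longrightarrow> \<bar>f s\<bar> \<le> B"
  shows "\<bar>LINT s|lebesgue_on {p..q}. f s\<bar> \<le> (q - p) * B"
proof -
  have "\<bar>LINT s|lebesgue_on {p..q}. f s\<bar> \<le> (LINT s|lebesgue_on {p..q}. \<bar>f s\<bar>)" by (rule integral_abs_bound)
  also have "\<dots> \<le> (LINT s|lebesgue_on {p..q}. B)"
  proof (rule integral_mono)
    show "integrable (lebesgue_on {p..q}) (\<lambda>s. B)"
      by (intro finite_measure.integrable_const finite_measure_lebesgue_on) auto
  qed (use assms in auto)
  also have "\<dots> = (q - p) * B" using assms(2) by (simp add: measure_restrict_space)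
  finally show ?thesis .
qed

text \<open>\<open>al\<close> is a continuous function on the line that agrees with the control from
  D on, and \<open>A\<close> is its primitive. The same setting serves a given solution, whose
  control is extended, and the construction of one, where the signal comes from the equation for
  Z.\<close>

locale control_signal =
  fixes D :: real and al A :: "real \<Rightarrow> real"
  assumes D_pos: "0 < D" and al_cont: "continuous_on UNIV al"
    and A_deriv: "\<And>t. (A has_real_derivative al t) (at t)" and A_D: "A D = 0"
begin

definition cut :: "real \<Rightarrow> real" where "cut t = (if t < D then 0 else al t)"

text \<open>This is u_D: the control starts at D and acts after a further delay D, so u_D vanishes
  up to time 2 D and equals A (t - D) afterwards.\<close>

definition uu :: "real \<Rightarrow> real" where "uu t = A (max (t - D) D)"

text \<open>The variation-of-constants integral from D, chosen as a primitive on the whole line so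
  that it can be differentiated everywhere.\<close>

definition J :: "real \<Rightarrow> real \<Rightarrow> real \<Rightarrow> real \<Rightarrow> real" where
  "J l a b = (SOME F. F D = 0 \<and> (\<forall>s. (F has_real_derivative exp (- l * s) * (a * A s + b * al s)) (at s)))"

text \<open>The solution of w' = l w + a u_D + b \<alpha>(t - D) with w(0) = y, written with the
  time shift carried out.\<close>

definition modal :: "real \<Rightarrow> real \<Rightarrow> real \<Rightarrow> real \<Rightarrow> real \<Rightarrow> real" where
  "modal l a b y t = exp (l * t) * y + exp (l * (t - D)) * J l a b (max (t - D) D)"

text \<open>The Artstein transform of \<open>modal\<close>, in which the delay disappears.\<close>

definition zed :: "real \<Rightarrow> real \<Rightarrow> real \<Rightarrow> real \<Rightarrow> real \<Rightarrow> real" where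
  "zed l a b y t = exp (l * t) * y + a * exp_int l (- D) * A t + exp (l * (t - D)) * J l a b t"

lemma A_cont: "continuous_on UNIV A"
  by (meson A_deriv DERIV_continuous continuous_at_imp_continuous_on)

lemma J: "J l a b D = 0" "(J l a b has_real_derivative exp (- l * s) * (a * A s + b * al s)) (at s)"
proof -
  have "continuous_on UNIV (\<lambda>s. exp (- l * s) * (a * A s + b * al s))"
    by (intro continuous_intros A_cont al_cont)
  then obtain F where F: "\<And>s. (F has_real_derivative exp (- l * s) * (a * A s + b * al s)) (at s)"
    using antiderivative_on_line by blast
  have "J l a b D = 0 \<and> (\<forall>s. (J l a b has_real_derivative exp (- l * s) * (a * A s + b * al s)) (at s))"
    unfolding J_def
  proof (rule someI[of _ "\<lambda>s. F s - F D"], intro conjI allI)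
    show "((\<lambda>s. F s - F D) has_real_derivative exp (- l * s) * (a * A s + b * al s)) (at s)" for s
      by (rule DERIV_cong[OF DERIV_diff[OF F DERIV_const]]) simp
  qed simp
  then show "J l a b D = 0" "(J l a b has_real_derivative exp (- l * s) * (a * A s + b * al s)) (at s)" by auto
qed

lemma J_cont: "continuous_on UNIV (J l a b)"
  by (meson J(2) DERIV_continuous continuous_at_imp_continuous_on)

lemma uu_cont: "continuous_on UNIV uu"
  unfolding uu_def by (intro continuous_on_compose2[OF A_cont] continuous_intros) auto

lemma modal_cont: "continuous_on UNIV (modal l a b y)"
  unfolding modal_def[abs_def] by (intro continuous_intros continuous_on_compose2[OF J_cont]) auto

lemma cut_integrable: "integrable (lebesgue_on {- D..t}) cut"
  using D_pos by (intro LINT_cutoff(2)[where p' = D and g = al and G = A] A_deriv al_cont) (auto simp: cut_def)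

lemma shift_deriv: "(F has_real_derivative f (s - D)) (at (s - D)) \<Longrightarrow> ((\<lambda>s. F (s - D)) has_real_derivative f (s - D)) (at (s::real))"
  using DERIV_shift[of F "f (s - D)" s "- D"] by simp

lemma uu_eq_LINT: "uu t = (LINT s|lebesgue_on {0..t}. cut (s - D))"
proof -
  have "(LINT s|lebesgue_on {0..t}. cut (s - D)) = A (max t (2 * D) - D) - A (2 * D - D)"
    using D_pos
    by (intro LINT_cutoff(1)[where g = "\<lambda>s. al (s - D)"] shift_deriv A_deriv continuous_on_compose2[OF al_cont] continuous_intros)
       (auto simp: cut_def)
  moreover have "max t (2 * D) - D = max (t - D) D" by auto
  ultimately show ?thesis by (simp add: uu_def A_D)
qed

text \<open>Shifting by D moves the jump to 2 D. Before that time both inputs vanish, u_D because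
  \<open>A D = 0\<close>, so the integrand has the form treated by
  \<open>LINT_cutoff\<close>.\<close>

lemma
  shows modal_eq_LINT: "modal l a b y t = exp (l * t) * y
      + (LINT s|lebesgue_on {0..t}. exp (l * (t - s)) * (a * uu s + b * cut (s - D)))"
    and modal_integrable: "integrable (lebesgue_on {0..t}) (\<lambda>s. exp (l * (t - s)) * (a * uu s + b * cut (s - D)))"
proof -
  let ?G = "\<lambda>s. exp (l * (t - D)) * J l a b (s - D)"
  let ?g = "\<lambda>s. exp (l * (t - s)) * (a * A (s - D) + b * al (s - D))"
  have G: "(?G has_real_derivative ?g s) (at s)" for s
  proof -
    have "(?G has_real_derivative exp (l * (t - D)) * (exp (- l * (s - D)) * (a * A (s - D) + b * al (s - D)))) (at s)"
      by (intro DERIV_cmult shift_deriv J)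
    moreover have "exp (l * (t - D)) * exp (- l * (s - D)) = exp (l * (t - s))"
      by (simp add: exp_add[symmetric] algebra_simps)
    ultimately show ?thesis by (simp add: mult.assoc[symmetric])
  qed
  have gc: "continuous_on UNIV ?g"
    by (intro continuous_intros continuous_on_compose2[OF A_cont] continuous_on_compose2[OF al_cont]) auto
  have f: "exp (l * (t - s)) * (a * uu s + b * cut (s - D)) = (if s < 2 * D then 0 else ?g s)" for s
    using A_D by (auto simp: uu_def cut_def max_def)
  note cutoff = LINT_cutoff[where p = 0 and p' = "2 * D" and q = t, OF _ f G gc]
  show "integrable (lebesgue_on {0..t}) (\<lambda>s. exp (l * (t - s)) * (a * uu s + b * cut (s - D)))"
    using cutoff(2) D_pos by simp
  have "max t (2 * D) - D = max (t - D) D" by auto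
  then show "modal l a b y t = exp (l * t) * y
      + (LINT s|lebesgue_on {0..t}. exp (l * (t - s)) * (a * uu s + b * cut (s - D)))"
    using cutoff(1) D_pos by (simp add: modal_def J)
qed

text \<open>Identifies the integral in the feedback law with the difference between the Artstein
  transform and the state, row by row; the closed formula for \<open>zed\<close> rests on
  it.\<close>

lemma delay_eq_zed:
  assumes t: "D \<le> t"
  shows "(LINT s|lebesgue_on {max (t - D) D..t}. (a * exp_int l (t - D - s) + b * exp (l * (t - D - s))) * cut s)
    = zed l a b y t - modal l a b y t"
proof -
  let ?r = "t - D" let ?m = "max (t - D) D"
  \<comment> \<open>Integrating the \<open>exp_int\<close> term by parts trades \<open>al\<close>
    for \<open>A\<close> and produces the integrand of \<open>J\<close>.\<close>
  let ?G = "\<lambda>s. a * (exp_int l (?r - s) * A s) + exp (l * ?r) * J l a b s"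
  let ?g = "\<lambda>s. (a * exp_int l (?r - s) + b * exp (l * (?r - s))) * al s"
  have E: "((\<lambda>s. exp_int l (?r - s)) has_real_derivative - exp (l * (?r - s))) (at s)" for s
    by (rule DERIV_cong[OF DERIV_chain2[OF exp_int_deriv]]) (auto intro!: derivative_eq_intros)
  have Ec: "continuous_on UNIV (\<lambda>s. exp_int l (?r - s))"
    by (intro continuous_at_imp_continuous_on ballI DERIV_isCont[OF E])
  have G: "(?G has_real_derivative ?g s) (at s)" for s
  proof -
    have "(?G has_real_derivative a * (- exp (l * (?r - s)) * A s + al s * exp_int l (?r - s))
        + exp (l * ?r) * (exp (- l * s) * (a * A s + b * al s))) (at s)"
      by (intro DERIV_add DERIV_cmult DERIV_mult' DERIV_mult E A_deriv J)
    moreover have eq: "exp (l * ?r) * exp (- l * s) = exp (l * (?r - s))"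
      by (simp add: exp_add[symmetric] algebra_simps)
    have "exp (l * ?r) * (exp (- l * s) * (a * A s + b * al s)) = exp (l * (?r - s)) * (a * A s + b * al s)"
      unfolding mult.assoc[symmetric] eq ..
    ultimately show ?thesis by (elim DERIV_cong) (simp add: algebra_simps)
  qed
  have "(LINT s|lebesgue_on {?m..t}. (a * exp_int l (t - D - s) + b * exp (l * (t - D - s))) * cut s)
      = (LINT s|lebesgue_on {?m..t}. ?g s)"
    by (rule Bochner_Integration.integral_cong) (auto simp: cut_def)
  also have "\<dots> = ?G t - ?G ?m"
    using t D_pos by (intro LINT_Icc_FTC G continuous_intros Ec al_cont) auto
  \<comment> \<open>Either the window starts at t - D, where \<open>exp_int\<close> is taken at 0,
    or it starts at D, where \<open>A\<close> vanishes.\<close>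
  also have "exp_int l (?r - ?m) * A ?m = 0" using A_D by (auto simp: max_def)
  finally show ?thesis by (simp add: zed_def modal_def)
qed

lemma delay_eq_zed_0:
  assumes t: "D \<le> t"
  shows "(LINT s|lebesgue_on {max (t - D) D..t}. cut s) = A t - uu t"
proof -
  have "(LINT s|lebesgue_on {max (t - D) D..t}. cut s) = (LINT s|lebesgue_on {max (t - D) D..t}. al s)"
    by (rule Bochner_Integration.integral_cong) (auto simp: cut_def)
  also have "\<dots> = A t - A (max (t - D) D)"
    using t D_pos by (intro LINT_Icc_FTC A_deriv al_cont) auto
  finally show ?thesis by (simp add: uu_def)
qed

lemma zed_D: "zed l a b y D = exp (l * D) * y"
  by (simp add: zed_def A_D J)

text \<open>Input and integral are now taken at the same time t, so no delay remains: the
  coefficient of \<open>al\<close> is the entry of exp (- D A_1) B_1. The identity for l times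
  \<open>exp_int\<close> supplies the coupling a A.\<close>

lemma zed_deriv:
  "(zed l a b y has_real_derivative
     l * zed l a b y t + a * A t + (a * exp_int l (- D) + b * exp (l * (- D))) * al t) (at t)"
proof -
  have "(zed l a b y has_real_derivative l * exp (l * t) * y + a * exp_int l (- D) * al t
      + (l * exp (l * (t - D)) * J l a b t + exp (l * (t - D)) * (exp (- l * t) * (a * A t + b * al t)))) (at t)"
    unfolding zed_def[abs_def]
    by (rule derivative_eq_intros A_deriv J refl | simp add: algebra_simps)+
  moreover have "exp (l * (t - D)) * exp (- l * t) = exp (l * (- D))"
    by (simp add: exp_add[symmetric] algebra_simps)
  then have "exp (l * (t - D)) * (exp (- l * t) * (a * A t + b * al t)) = exp (l * (- D)) * (a * A t + b * al t)"
    by (simp only: mult.assoc[symmetric])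
  moreover have "l * (a * exp_int l (- D) * A t) = a * (exp (l * (- D)) - 1) * A t"
  proof -
    have "l * (a * exp_int l (- D) * A t) = a * (l * exp_int l (- D)) * A t" by (simp only: mult_ac)
    then show ?thesis unfolding exp_int_mult .
  qed
  ultimately show ?thesis
    by (elim DERIV_cong) (simp add: zed_def algebra_simps)
qed

text \<open>The transform is a predictor: exp (D A_1) Z(t - D) is the state at time t. Decay of Z
  thus passes directly to the low modes.\<close>

lemma modal_late:
  assumes "2 * D \<le> t"
  shows "modal l a b y t = exp (l * D) * (zed l a b y (t - D) - a * exp_int l (- D) * A (t - D))"
proof -
  have "exp (l * t) = exp (l * D) * exp (l * (t - D))"
    "exp (l * (t - D)) = exp (l * D) * exp (l * (t - D - D))"
    by (simp_all add: exp_add[symmetric] algebra_simps)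
  moreover have "max (t - D) D = t - D" using assms by simp
  ultimately show ?thesis by (simp add: modal_def zed_def algebra_simps)
qed

text \<open>Since rho is at most half of |l|, the exponent k = - l - rho in the convolution is at
  least |l| / 2. The resulting factor 1 / |l| in the forced part later compensates the energy
  weight.\<close>

lemma modal_decay:
  assumes bnd: "\<And>s. s \<ge> D \<Longrightarrow> \<bar>A s\<bar> \<le> F * exp (- \<rho> * s)" "\<And>s. s \<ge> D \<Longrightarrow> \<bar>al s\<bar> \<le> F * exp (- \<rho> * s)"
    and \<rho>: "0 < \<rho>" "2 * \<rho> \<le> - l" and t: "2 * D \<le> t"
  shows "\<bar>modal l a b y t\<bar> \<le> exp (l * t) * \<bar>y\<bar> + 2 * F * (\<bar>a\<bar> + \<bar>b\<bar>) / \<bar>l\<bar> * exp (- \<rho> * (t - D))"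
proof -
  define r where "r = t - D"
  have r: "D \<le> r" using t by (simp add: r_def)
  define k where "k = - l - \<rho>"
  have k: "0 < k" "\<bar>l\<bar> / 2 \<le> k" using \<rho> by (auto simp: k_def)
  define F' where "F' = F * (\<bar>a\<bar> + \<bar>b\<bar>)"
  have "0 \<le> F * exp (- \<rho> * D)" using order_trans[OF abs_ge_zero bnd(1)[of D]] by simp
  then have F0: "0 \<le> F" by (simp add: zero_le_mult_iff)
  then have F'0: "0 \<le> F'" by (simp add: F'_def)
  have f: "\<bar>a * A s + b * al s\<bar> \<le> F' * exp (- \<rho> * s)" if "s \<ge> D" for s
  proof -
    have "\<bar>a * A s + b * al s\<bar> \<le> \<bar>a\<bar> * \<bar>A s\<bar> + \<bar>b\<bar> * \<bar>al s\<bar>"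
      by (rule order_trans[OF abs_triangle_ineq]) (simp add: abs_mult)
    also have "\<dots> \<le> \<bar>a\<bar> * (F * exp (- \<rho> * s)) + \<bar>b\<bar> * (F * exp (- \<rho> * s))"
      by (intro add_mono mult_left_mono bnd that) auto
    finally show ?thesis by (simp add: F'_def algebra_simps)
  qed
  have J': "\<bar>exp (- l * s) * (a * A s + b * al s)\<bar> \<le> F' * exp (k * s)" if "s \<ge> D" for s
  proof -
    have "\<bar>exp (- l * s) * (a * A s + b * al s)\<bar> \<le> exp (- l * s) * (F' * exp (- \<rho> * s))"
      unfolding abs_mult using f[OF that] by (auto intro!: mult_left_mono)
    also have "\<dots> = F' * exp (k * s)" by (simp add: k_def exp_add[symmetric] algebra_simps)
    finally show ?thesis .
  qed
  \<comment> \<open>Both signs are treated at once: F' exp (k s) / k is a primitive of the majorant,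
    so its difference from the signed \<open>J\<close> is nondecreasing.\<close>
  have bound: "\<sigma> * J l a b r \<le> F' * exp (k * r) / k" if \<sigma>: "\<sigma> = 1 \<or> \<sigma> = -1" for \<sigma> :: real
  proof -
    let ?h = "\<lambda>s. F' * exp (k * s) / k - \<sigma> * J l a b s"
    have "?h D \<le> ?h r"
    proof (rule DERIV_nonneg_imp_nondecreasing[OF r])
      fix s assume s: "D \<le> s" "s \<le> r"
      have "(?h has_real_derivative F' * exp (k * s) - \<sigma> * (exp (- l * s) * (a * A s + b * al s))) (at s)"
        using k by (auto intro!: derivative_eq_intros J(2))
      moreover have "0 \<le> F' * exp (k * s) - \<sigma> * (exp (- l * s) * (a * A s + b * al s))"
        using J'[OF s(1)] \<sigma> by (auto simp: abs_le_iff)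
      ultimately show "\<exists>y. (?h has_real_derivative y) (at s) \<and> 0 \<le> y" by blast
    qed
    moreover have "0 \<le> F' * exp (k * D) / k" using F'0 k by simp
    ultimately show ?thesis by (simp add: J)
  qed
  have Jr: "\<bar>J l a b r\<bar> \<le> F' * exp (k * r) / k"
    using bound[of 1] bound[of "-1"] by (simp add: abs_le_iff)
  have "exp (l * r) * \<bar>J l a b r\<bar> \<le> exp (l * r) * (F' * exp (k * r) / k)"
    by (intro mult_left_mono Jr) simp
  also have "\<dots> = F' / k * (exp (l * r) * exp (k * r))" by simp
  also have "exp (l * r) * exp (k * r) = exp (- \<rho> * r)" by (simp add: k_def exp_add[symmetric] algebra_simps)
  also have "F' / k * exp (- \<rho> * r) \<le> F' / (\<bar>l\<bar> / 2) * exp (- \<rho> * r)"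
    using k F'0 \<rho> by (intro mult_right_mono divide_left_mono mult_pos_pos) auto
  finally have main: "exp (l * r) * \<bar>J l a b r\<bar> \<le> F' / (\<bar>l\<bar> / 2) * exp (- \<rho> * r)" .
  have m: "max (t - D) D = r" using r by (simp add: r_def)
  have "\<bar>modal l a b y t\<bar> \<le> exp (l * t) * \<bar>y\<bar> + exp (l * r) * \<bar>J l a b r\<bar>"
    unfolding modal_def m by (rule order_trans[OF abs_triangle_ineq]) (simp add: abs_mult r_def)
  also have "\<dots> \<le> exp (l * t) * \<bar>y\<bar> + F' / (\<bar>l\<bar> / 2) * exp (- \<rho> * r)" using main by simp
  also have "F' / (\<bar>l\<bar> / 2) = 2 * F * (\<bar>a\<bar> + \<bar>b\<bar>) / \<bar>l\<bar>" by (simp add: F'_def)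
  finally show ?thesis unfolding r_def .
qed

end

section \<open>Mild solutions in Fourier coordinates\<close>

context spectral
begin

abbreviation n :: nat where "n \<equiv> num_nonneg lam"

definition av :: "nat \<Rightarrow> real" where "av i = L2_inner L (a_fun L c) (e i)"

definition bv :: "nat \<Rightarrow> real" where "bv i = L2_inner L (b_fun L) (e i)"

lemma a_fun_L2: "a_fun L c \<in> L2 L"
proof -
  have "(\<lambda>x. c x * (x / L)) \<in> L2 L"
    using L_pos by (intro c_mult_L2 L2_continuous continuous_intros) auto
  then show ?thesis by (simp add: a_fun_def[abs_def] mult.commute)
qed

lemma b_fun_L2: "b_fun L \<in> L2 L"
  unfolding b_fun_def[abs_def] using L_pos by (intro L2_continuous continuous_intros) auto

text \<open>The eigenvalues tend to minus infinity and decrease, so the nonnegative ones occupy a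
  finite initial segment; its cardinality is its last index.\<close>

lemma nonneg_indices: "{j. 1 \<le> j \<and> 0 \<le> lam j} = {1..n}"
proof -
  let ?S = "{j. 1 \<le> j \<and> 0 \<le> lam j}"
  have "\<forall>\<^sub>F j in sequentially. lam j < 0"
    using to_minus_infinity unfolding filterlim_at_bot_dense by blast
  then obtain N where N: "\<And>j. j \<ge> N \<Longrightarrow> lam j < 0" by (auto simp: eventually_sequentially)
  have "?S \<subseteq> {..<N}"
  proof
    fix j assume "j \<in> ?S"
    then show "j \<in> {..<N}" using N[of j] by (cases "j < N") auto
  qed
  then have fin: "finite ?S" by (rule finite_subset) simp
  have mono: "lam j \<le> lam i" if "1 \<le> i" "i \<le> j" for i j
    using la_le[of "i - 1" "j - 1"] that by simp
  show ?thesis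
  proof (cases "?S = {}")
    case True
    then show ?thesis unfolding num_nonneg_def by (simp only: True) simp
  next
    case False
    have m: "Max ?S \<in> ?S" by (rule Max_in[OF fin False])
    have "?S = {1..Max ?S}"
    proof
      show "?S \<subseteq> {1..Max ?S}" using Max_ge[OF fin] by auto
      show "{1..Max ?S} \<subseteq> ?S"
      proof
        fix i assume i: "i \<in> {1..Max ?S}"
        then have "lam (Max ?S) \<le> lam i" by (intro mono) auto
        then show "i \<in> ?S" using m i by auto
      qed
    qed
    then show ?thesis unfolding num_nonneg_def by (metis card_atLeastAtMost diff_Suc_1)
  qed
qed

text \<open>With the shifted numbering \<open>la n\<close> is eigenvalue number n + 1, the largest
  negative one.\<close>

lemma la_n_neg: "la n < 0"
proof (rule ccontr)
  assume "\<not> la n < 0"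
  then have "Suc n \<in> {j. 1 \<le> j \<and> 0 \<le> lam j}" by simp
  then show False unfolding nonneg_indices by simp
qed

lemma A1_arrow: "A1 L c e lam = arrow n av lam"
  unfolding A1_def arrow_def av_def ..

lemma B1_bcol: "B1 L e lam = bcol n bv"
  unfolding B1_def bcol_def bv_def ..

definition kcol :: "real \<Rightarrow> real mat" where
  "kcol D = mat (n + 1) 1 (\<lambda>(i, j). kap av bv lam i (- D))"

lemma admissible_iff:
  "admissible_gain L D c e lam K \<longleftrightarrow> K \<in> carrier_mat 1 (n + 1) \<and>
     char_poly (arrow n av lam + kcol D * K) = [:1, 1:] ^ (n + 1)"
proof -
  have "arrow n av lam + kcol D * K \<in> carrier_mat (n + 1) (n + 1)" if "K \<in> carrier_mat 1 (n + 1)"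
    using that by (auto simp: kcol_def)
  then show ?thesis
    unfolding admissible_gain_def A1_arrow B1_bcol mat_exp_bcol kcol_def[symmetric]
    using char_poly_of_order order_of_char_poly by blast
qed

lemma lam_strict: "1 \<le> i \<Longrightarrow> i < j \<Longrightarrow> lam j < lam i"
  using la_strict[of "i - 1" "j - 1"] by simp

lemma gain_exists: "\<exists>K. admissible_gain L D c e lam K"
proof -
  have "\<exists>K\<in>carrier_mat 1 (n + 1). char_poly (arrow n av lam + kcol D * K) = [:1, 1:] ^ (n + 1)"
  proof (rule pole_placement)
    show "inj_on lam {1..n}"
    proof (rule inj_onI)
      fix i j assume "i \<in> {1..n}" "j \<in> {1..n}" "lam i = lam j"
      then show "i = j" using lam_strict[of i j] lam_strict[of j i]
        by (cases i j rule: linorder_cases) auto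
    qed
    fix i assume i: "i \<in> {1..n}"
    then have i0: "i \<noteq> 0" by simp
    have "av i + lam i * bv i \<noteq> 0"
      using control_coeff_nonzero[of "i - 1"] i by (simp add: av_def bv_def fourier_def)
    then show "lam i * kcol D $$ (i, 0) + av i \<noteq> 0"
      using kap_control[OF i0, of lam av bv "- D"] i by (simp add: kcol_def)
  qed (auto simp: kcol_def kap_def)
  then show ?thesis using admissible_iff by blast
qed

text \<open>Splits the closed-loop matrix into the drift of A_1 and the input column times the
  scalar K z, which is the control.\<close>

lemma feedback_row:
  assumes "K \<in> carrier_mat 1 (n + 1)" "i < n + 1"
  shows "(\<Sum>j<n + 1. (arrow n av lam + kcol D * K) $$ (i, j) * z j)
    = (if i = 0 then 0 else av i * z 0 + lam i * z i) + kap av bv lam i (- D) * (\<Sum>j<n + 1. K $$ (0, j) * z j)"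
proof -
  have "(\<Sum>j<n + 1. (arrow n av lam + kcol D * K) $$ (i, j) * z j)
      = (\<Sum>j<n + 1. arrow n av lam $$ (i, j) * z j + kap av bv lam i (- D) * (K $$ (0, j) * z j))"
  proof (rule sum.cong[OF refl])
    fix j assume "j \<in> {..<n + 1}"
    then have "(arrow n av lam + kcol D * K) $$ (i, j) = arrow n av lam $$ (i, j) + kap av bv lam i (- D) * K $$ (0, j)"
      using assms by (simp add: kcol_def arrow_def scalar_prod_def)
    then show "(arrow n av lam + kcol D * K) $$ (i, j) * z j
        = arrow n av lam $$ (i, j) * z j + kap av bv lam i (- D) * (K $$ (0, j) * z j)"
      by (simp add: algebra_simps)
  qed
  also have "\<dots> = (\<Sum>j<n + 1. arrow n av lam $$ (i, j) * z j) + kap av bv lam i (- D) * (\<Sum>j<n + 1. K $$ (0, j) * z j)"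
    by (simp only: sum.distrib sum_distrib_left)
  also have "(\<Sum>j<n + 1. arrow n av lam $$ (i, j) * z j) = (\<Sum>j\<in>{0, i}. arrow n av lam $$ (i, j) * z j)"
    by (rule sum.mono_neutral_right) (use assms(2) in \<open>auto simp: arrow_def\<close>)
  also have "\<dots> = (if i = 0 then 0 else av i * z 0 + lam i * z i)"
    using assms(2) by (auto simp: arrow_def)
  finally show ?thesis .
qed

lemma forcing_L2: "(\<lambda>x. a_fun L c x * q + b_fun L x * p) \<in> L2 L"
  using L2_add[OF L2_scale[OF a_fun_L2, of q] L2_scale[OF b_fun_L2, of p]] by (simp add: mult.commute)

lemma fourier_forcing:
  "fourier (\<lambda>x. a_fun L c x * q + b_fun L x * p) j = fourier (a_fun L c) j * q + fourier (b_fun L) j * p"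
  using fourier_add[OF L2_scale[OF a_fun_L2, of q] L2_scale[OF b_fun_L2, of p]]
  by (simp add: fourier_scale mult.commute)

text \<open>The semigroup behind a mild solution is only known to exist;
  \<open>fourier_semigroup\<close> determines its coefficients, so every mild solution obeys the
  same scalar formula.\<close>

lemma mild_solution_fourier:
  assumes mild: "mild_solution L c (\<lambda>t x. a_fun L c x * q t + b_fun L x * p t) w0 w"
    and w0: "w0 \<in> L2 L" and t: "0 \<le> t"
  shows "fourier (w t) j = exp (la j * t) * fourier w0 j
    + (LINT s|lebesgue_on {0..t}. exp (la j * (t - s)) * (fourier (a_fun L c) j * q s + fourier (b_fun L) j * p s))"
proof -
  obtain S where S: "C0_semigroup L S" "generated_by_A L c S"
    and int: "has_L2_integral L (\<lambda>s. S (t - s) (\<lambda>x. a_fun L c x * q s + b_fun L x * p s)) (\<lambda>x. w t x - S t w0 x) {0..t}"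
    using mild t unfolding mild_solution_def by blast
  have SL2: "S t w0 \<in> L2 L" using S(1) t w0 by (auto simp: C0_semigroup_def)
  have wL2: "w t \<in> L2 L" using mild t by (auto simp: mild_solution_def)
  have "fourier (w t) j - fourier (S t w0) j = L2_inner L (\<lambda>x. w t x - S t w0 x) (E j)"
    using fourier_diff[OF wL2 SL2, of j] by (simp add: fourier_def)
  also have "\<dots> = (LINT s|lebesgue_on {0..t}. fourier (S (t - s) (\<lambda>x. a_fun L c x * q s + b_fun L x * p s)) j)"
    using int E_L2[of j] unfolding has_L2_integral_def fourier_def by blast
  also have "\<dots> = (LINT s|lebesgue_on {0..t}. exp (la j * (t - s)) * (fourier (a_fun L c) j * q s + fourier (b_fun L) j * p s))"
    by (rule Bochner_Integration.integral_cong[OF refl])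
       (simp add: fourier_semigroup[OF S _ forcing_L2] fourier_forcing)
  finally show ?thesis using fourier_semigroup[OF S t w0, of j] by simp
qed

end

section \<open>The mild solution produced by a given control\<close>

locale driven = spectral L c e lam + control_signal D al A
  for L c e lam D al A
begin

abbreviation mode :: "(real \<Rightarrow> real) \<Rightarrow> nat \<Rightarrow> real \<Rightarrow> real" where
  "mode y0 j \<equiv> modal (la j) (fourier (a_fun L c) j) (fourier (b_fun L) j) (fourier y0 j)"

lemma signal_bound: "\<exists>B\<ge>0. \<forall>s\<in>{0..T}. \<bar>uu s\<bar> \<le> B \<and> \<bar>cut (s - D)\<bar> \<le> B"
proof -
  have "bounded (uu ` {0..T})"
    by (intro compact_imp_bounded compact_continuous_image continuous_on_subset[OF uu_cont]) auto
  then obtain B1 where B1: "\<And>s. s \<in> {0..T} \<Longrightarrow> \<bar>uu s\<bar> \<le> B1"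
    unfolding bounded_iff by (metis imageI real_norm_def)
  have "bounded (al ` {- D..T})"
    by (intro compact_imp_bounded compact_continuous_image continuous_on_subset[OF al_cont]) auto
  then obtain B2 where B2: "\<And>s. s \<in> {- D..T} \<Longrightarrow> \<bar>al s\<bar> \<le> B2"
    unfolding bounded_iff by (metis imageI real_norm_def)
  have "\<bar>uu s\<bar> \<le> \<bar>B1\<bar> + \<bar>B2\<bar> \<and> \<bar>cut (s - D)\<bar> \<le> \<bar>B1\<bar> + \<bar>B2\<bar>" if s: "s \<in> {0..T}" for s
    using B1[OF s] B2[of "s - D"] s D_pos by (auto simp: cut_def)
  then show ?thesis by (intro exI[of _ "\<bar>B1\<bar> + \<bar>B2\<bar>"]) auto
qed

lemma integrand_bound:
  assumes B: "\<And>s. s \<in> {0..T} \<Longrightarrow> \<bar>uu s\<bar> \<le> B \<and> \<bar>cut (s - D)\<bar> \<le> B" and s: "0 \<le> s" "s \<le> t" "t \<le> T"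
  shows "\<bar>exp (la j * (t - s)) * (a * uu s + b * cut (s - D))\<bar> \<le> exp (\<bar>la 0\<bar> * T) * (B * (\<bar>a\<bar> + \<bar>b\<bar>))"
proof -
  have "exp (la j * (t - s)) \<le> exp (\<bar>la 0\<bar> * (t - s))" using s by (intro exp_la_bound) simp
  also have "\<dots> \<le> exp (\<bar>la 0\<bar> * T)" using s by (simp add: mult_left_mono)
  finally have 1: "exp (la j * (t - s)) \<le> exp (\<bar>la 0\<bar> * T)" .
  have "\<bar>a * uu s + b * cut (s - D)\<bar> \<le> \<bar>a\<bar> * \<bar>uu s\<bar> + \<bar>b\<bar> * \<bar>cut (s - D)\<bar>"
    by (rule order_trans[OF abs_triangle_ineq]) (simp add: abs_mult)
  also have "\<dots> \<le> \<bar>a\<bar> * B + \<bar>b\<bar> * B"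
    using B[of s] s by (intro add_mono mult_left_mono) auto
  finally have 2: "\<bar>a * uu s + b * cut (s - D)\<bar> \<le> B * (\<bar>a\<bar> + \<bar>b\<bar>)" by (simp add: algebra_simps)
  show ?thesis unfolding abs_mult abs_exp_cancel by (intro mult_mono 1 2) auto
qed

lemma modal_bound:
  assumes B: "\<And>s. s \<in> {0..T} \<Longrightarrow> \<bar>uu s\<bar> \<le> B \<and> \<bar>cut (s - D)\<bar> \<le> B" "0 \<le> B" and t: "0 \<le> t" "t \<le> T"
  shows "\<bar>modal (la j) a b y t\<bar> \<le> exp (\<bar>la 0\<bar> * T) * (\<bar>y\<bar> + T * B * (\<bar>a\<bar> + \<bar>b\<bar>))"
proof -
  let ?I = "LINT s|lebesgue_on {0..t}. exp (la j * (t - s)) * (a * uu s + b * cut (s - D))"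
  have "\<bar>?I\<bar> \<le> (t - 0) * (exp (\<bar>la 0\<bar> * T) * (B * (\<bar>a\<bar> + \<bar>b\<bar>)))"
    by (rule LINT_Icc_bound[OF modal_integrable t(1)]) (rule integrand_bound[OF B(1)], use t in auto)
  also have "\<dots> \<le> T * (exp (\<bar>la 0\<bar> * T) * (B * (\<bar>a\<bar> + \<bar>b\<bar>)))"
    using t B(2) by (intro mult_right_mono) auto
  finally have 1: "\<bar>?I\<bar> \<le> exp (\<bar>la 0\<bar> * T) * (T * B * (\<bar>a\<bar> + \<bar>b\<bar>))" by (simp add: mult_ac)
  have "exp (la j * t) \<le> exp (\<bar>la 0\<bar> * T)"
    using order_trans[OF exp_la_bound[OF t(1)], of "exp (\<bar>la 0\<bar> * T)" j] t by (simp add: mult_left_mono)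
  then have 2: "\<bar>exp (la j * t) * y\<bar> \<le> exp (\<bar>la 0\<bar> * T) * \<bar>y\<bar>"
    unfolding abs_mult abs_exp_cancel by (intro mult_right_mono) auto
  show ?thesis
    unfolding modal_eq_LINT using 1 2 abs_triangle_ineq[of "exp (la j * t) * y" ?I]
    by (simp add: distrib_left)
qed

lemma bound_summable:
  assumes "f \<in> L2 L" "g \<in> L2 L" "h \<in> L2 L"
  shows "summable (\<lambda>j. (k * (\<bar>fourier f j\<bar> + m * (\<bar>fourier g j\<bar> + \<bar>fourier h j\<bar>)))\<^sup>2)"
proof (rule summable_comparison_test')
  show "summable (\<lambda>j. k\<^sup>2 * (3 * (fourier f j)\<^sup>2 + 3 * m\<^sup>2 * (fourier g j)\<^sup>2 + 3 * m\<^sup>2 * (fourier h j)\<^sup>2))"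
    by (intro summable_mult summable_add fourier_square_summable assms)
  fix j
  have sq: "(x + y + z)\<^sup>2 \<le> 3 * x\<^sup>2 + 3 * y\<^sup>2 + 3 * z\<^sup>2" for x y z :: real
  proof -
    have "0 \<le> (x - y)\<^sup>2 + (y - z)\<^sup>2 + (x - z)\<^sup>2" by simp
    then show ?thesis by (simp add: power2_eq_square algebra_simps)
  qed
  have "(\<bar>fourier f j\<bar> + m * (\<bar>fourier g j\<bar> + \<bar>fourier h j\<bar>))\<^sup>2
      \<le> 3 * (fourier f j)\<^sup>2 + 3 * m\<^sup>2 * (fourier g j)\<^sup>2 + 3 * m\<^sup>2 * (fourier h j)\<^sup>2"
    using sq[of "\<bar>fourier f j\<bar>" "m * \<bar>fourier g j\<bar>" "m * \<bar>fourier h j\<bar>"]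
    by (simp add: power_mult_distrib distrib_left add.assoc)
  then have "k\<^sup>2 * (\<bar>fourier f j\<bar> + m * (\<bar>fourier g j\<bar> + \<bar>fourier h j\<bar>))\<^sup>2
      \<le> k\<^sup>2 * (3 * (fourier f j)\<^sup>2 + 3 * m\<^sup>2 * (fourier g j)\<^sup>2 + 3 * m\<^sup>2 * (fourier h j)\<^sup>2)"
    by (rule mult_left_mono) simp
  then show "norm ((k * (\<bar>fourier f j\<bar> + m * (\<bar>fourier g j\<bar> + \<bar>fourier h j\<bar>)))\<^sup>2)
      \<le> k\<^sup>2 * (3 * (fourier f j)\<^sup>2 + 3 * m\<^sup>2 * (fourier g j)\<^sup>2 + 3 * m\<^sup>2 * (fourier h j)\<^sup>2)"
    by (simp add: power_mult_distrib)
qed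

definition state :: "(real \<Rightarrow> real) \<Rightarrow> real \<Rightarrow> real \<Rightarrow> real" where
  "state y0 t = synth (\<lambda>j. mode y0 j t)"

lemma state:
  assumes "y0 \<in> L2 L" "0 \<le> t"
  shows "state y0 t \<in> L2 L" "fourier (state y0 t) j = mode y0 j t"
proof -
  obtain B where B: "0 \<le> B" "\<And>s. s \<in> {0..t} \<Longrightarrow> \<bar>uu s\<bar> \<le> B \<and> \<bar>cut (s - D)\<bar> \<le> B" using signal_bound by blast
  have "summable (\<lambda>j. (mode y0 j t)\<^sup>2)"
  proof (rule summable_comparison_test')
    show "summable (\<lambda>j. (exp (\<bar>la 0\<bar> * t) * (\<bar>fourier y0 j\<bar> + t * B * (\<bar>fourier (a_fun L c) j\<bar> + \<bar>fourier (b_fun L) j\<bar>)))\<^sup>2)"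
      by (intro bound_summable assms a_fun_L2 b_fun_L2)
    fix j
    have "\<bar>mode y0 j t\<bar>\<^sup>2 \<le> (exp (\<bar>la 0\<bar> * t) * (\<bar>fourier y0 j\<bar> + t * B * (\<bar>fourier (a_fun L c) j\<bar> + \<bar>fourier (b_fun L) j\<bar>)))\<^sup>2"
      by (intro power_mono modal_bound[OF B(2,1) assms(2)]) auto
    then show "norm ((mode y0 j t)\<^sup>2) \<le> (exp (\<bar>la 0\<bar> * t) * (\<bar>fourier y0 j\<bar> + t * B * (\<bar>fourier (a_fun L c) j\<bar> + \<bar>fourier (b_fun L) j\<bar>)))\<^sup>2"
      by simp
  qed
  from synth[OF this] show "state y0 t \<in> L2 L" "fourier (state y0 t) j = mode y0 j t"
    by (auto simp: state_def)
qed

text \<open>Continuity in time follows mode by mode from a majorant on [0, t + 1]. The integral is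
  weak, so only pairings with a fixed \<open>v\<close> matter: Parseval turns them into series, and
  sum and integral may be exchanged.\<close>

lemma state_mild:
  assumes y0: "y0 \<in> L2 L"
  shows "mild_solution L c (\<lambda>t x. a_fun L c x * uu t + b_fun L x * cut (t - D)) y0 (state y0)"
  unfolding mild_solution_def
proof (intro conjI allI impI)
  fix t :: real assume t: "0 \<le> t"
  show "state y0 t \<in> L2 L" by (rule state[OF y0 t])
  obtain B where B: "0 \<le> B" "\<And>s. s \<in> {0..t + 1} \<Longrightarrow> \<bar>uu s\<bar> \<le> B \<and> \<bar>cut (s - D)\<bar> \<le> B" using signal_bound by blast
  have ev: "\<forall>\<^sub>F s in at t within {0..}. 0 \<le> s \<and> s < t + 1"
  proof -
    have "\<forall>\<^sub>F s in at t within {0..}. s < t + 1"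
      by (rule order_tendstoD(2)[OF tendsto_ident_at]) simp
    moreover have "\<forall>\<^sub>F s in at t within {0..}. s \<in> {0..}" by (simp add: eventually_at_filter)
    ultimately show ?thesis by eventually_elim simp
  qed
  let ?G = "\<lambda>j. exp (\<bar>la 0\<bar> * (t + 1)) * (\<bar>fourier y0 j\<bar> + (t + 1) * B * (\<bar>fourier (a_fun L c) j\<bar> + \<bar>fourier (b_fun L) j\<bar>))"
  have mb: "\<bar>mode y0 j s\<bar> \<le> ?G j" if "0 \<le> s" "s \<le> t + 1" for j s
    by (rule modal_bound[OF B(2,1) that])
  show "((\<lambda>s. L2_norm L (\<lambda>x. state y0 s x - state y0 t x)) \<longlongrightarrow> 0) (at t within {0..})"
  proof (rule norm_tendsto_0_of_coeff[where G = "\<lambda>j. 2 * ?G j"])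
    show "\<forall>\<^sub>F s in at t within {0..}. (\<lambda>x. state y0 s x - state y0 t x) \<in> L2 L"
      using ev by eventually_elim (intro L2_diff state y0 t, simp)
    show "((\<lambda>s. fourier (\<lambda>x. state y0 s x - state y0 t x) j) \<longlongrightarrow> 0) (at t within {0..})" for j
    proof (rule Lim_transform_eventually)
      have "(mode y0 j \<longlongrightarrow> mode y0 j t) (at t within {0..})"
      proof -
        have "continuous_on {0..} (mode y0 j)" by (rule continuous_on_subset[OF modal_cont]) simp
        then show ?thesis using t by (simp add: continuous_on_def)
      qed
      then show "((\<lambda>s. mode y0 j s - mode y0 j t) \<longlongrightarrow> 0) (at t within {0..})" by (simp add: LIM_zero)
      show "\<forall>\<^sub>F s in at t within {0..}. mode y0 j s - mode y0 j t = fourier (\<lambda>x. state y0 s x - state y0 t x) j"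
        using ev by eventually_elim (simp add: fourier_diff state y0 t)
    qed
    show "\<forall>\<^sub>F s in at t within {0..}. \<forall>j. \<bar>fourier (\<lambda>x. state y0 s x - state y0 t x) j\<bar> \<le> 2 * ?G j"
      using ev
    proof (eventually_elim, intro allI)
      fix s j assume s: "0 \<le> s \<and> s < t + 1"
      have "fourier (\<lambda>x. state y0 s x - state y0 t x) j = mode y0 j s - mode y0 j t"
        using s t y0 by (simp add: fourier_diff state)
      then show "\<bar>fourier (\<lambda>x. state y0 s x - state y0 t x) j\<bar> \<le> 2 * ?G j"
        using mb[of s j] mb[of t j] s t abs_triangle_ineq4[of "mode y0 j s" "mode y0 j t"] by linarith
    qed
    have "summable (\<lambda>j. 4 * (?G j)\<^sup>2)" by (intro summable_mult bound_summable y0 a_fun_L2 b_fun_L2)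
    then show "summable (\<lambda>j. (2 * ?G j)\<^sup>2)" by (simp only: power_mult_distrib) simp
    have "at_right t \<le> at t within {0..}" by (rule at_le) (use t in auto)
    then show "at t within {0..} \<noteq> bot"
      using trivial_limit_at_right_real[of t] by (metis bot.extremum_uniqueI)
  qed
next
  show "\<exists>S. C0_semigroup L S \<and> generated_by_A L c S \<and>
    (\<forall>t\<ge>0. has_L2_integral L (\<lambda>s. S (t - s) (\<lambda>x. a_fun L c x * uu s + b_fun L x * cut (s - D)))
      (\<lambda>x. state y0 t x - S t y0 x) {0..t})"
  proof (intro exI[of _ sg] conjI allI impI C0_semigroup_sg generated_by_A_sg)
    fix t :: real assume t: "0 \<le> t"
    let ?f = "\<lambda>s x. a_fun L c x * uu s + b_fun L x * cut (s - D)"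
    let ?a = "fourier (a_fun L c)" and ?b = "fourier (b_fun L)"
    let ?h = "\<lambda>j s. exp (la j * (t - s)) * (?a j * uu s + ?b j * cut (s - D))"
    have cf: "fourier (sg (t - s) (?f s)) j = ?h j s" if "s \<in> {0..t}" for s j
      using that by (simp add: fourier_sg forcing_L2 fourier_forcing)
    have dL2: "(\<lambda>x. state y0 t x - sg t y0 x) \<in> L2 L" by (intro L2_diff state y0 t sg_L2)
    have cd: "fourier (\<lambda>x. state y0 t x - sg t y0 x) j = (LINT s|lebesgue_on {0..t}. ?h j s)" for j
      using t y0 by (simp add: fourier_diff state sg_L2 fourier_sg modal_eq_LINT)
    show "has_L2_integral L (\<lambda>s. sg (t - s) (?f s)) (\<lambda>x. state y0 t x - sg t y0 x) {0..t}"
      unfolding has_L2_integral_def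
    proof (intro conjI ballI dL2)
      show "sg (t - s) (?f s) \<in> L2 L" if "s \<in> {0..t}" for s
        using that by (intro sg_L2 forcing_L2) auto
      fix v assume v: "v \<in> L2 L"
      obtain B where B: "0 \<le> B" "\<And>s. s \<in> {0..t} \<Longrightarrow> \<bar>uu s\<bar> \<le> B \<and> \<bar>cut (s - D)\<bar> \<le> B" using signal_bound by blast
      let ?K = "exp (\<bar>la 0\<bar> * t) * B"
      let ?M = "lebesgue_on {0..t}"
      let ?V = "fourier v"
      \<comment> \<open>A bound independent of s and summable in j, because the coefficients of
        \<open>a_fun\<close>, \<open>b_fun\<close> and \<open>v\<close> are square summable; it
        justifies the exchange.\<close>
      have hb: "\<bar>?h j s * ?V j\<bar> \<le> ?K * (\<bar>?a j * ?V j\<bar> + \<bar>?b j * ?V j\<bar>)" if "s \<in> {0..t}" for j s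
      proof -
        have "\<bar>?h j s\<bar> \<le> exp (\<bar>la 0\<bar> * t) * (B * (\<bar>?a j\<bar> + \<bar>?b j\<bar>))"
          by (rule integrand_bound[OF B(2)]) (use that in auto)
        then have "\<bar>?h j s\<bar> * \<bar>?V j\<bar> \<le> exp (\<bar>la 0\<bar> * t) * (B * (\<bar>?a j\<bar> + \<bar>?b j\<bar>)) * \<bar>?V j\<bar>"
          by (rule mult_right_mono) simp
        also have "exp (\<bar>la 0\<bar> * t) * (B * (\<bar>?a j\<bar> + \<bar>?b j\<bar>)) * \<bar>?V j\<bar> = ?K * (\<bar>?a j * ?V j\<bar> + \<bar>?b j * ?V j\<bar>)"
          by (simp add: abs_mult algebra_simps)
        finally show ?thesis unfolding abs_mult[of "?h j s"] .
      qed
      have abs_sum: "summable (\<lambda>j. \<bar>fourier f j * ?V j\<bar>)" if "f \<in> L2 L" for f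
      proof (rule summable_comparison_test')
        show "summable (\<lambda>j. (fourier f j)\<^sup>2 + (?V j)\<^sup>2)"
          by (intro summable_add fourier_square_summable that v)
        fix j
        have "0 \<le> (\<bar>fourier f j\<bar> - \<bar>?V j\<bar>)\<^sup>2" by simp
        then have "2 * (\<bar>fourier f j\<bar> * \<bar>?V j\<bar>) \<le> (fourier f j)\<^sup>2 + (?V j)\<^sup>2"
          by (simp add: power2_diff mult.assoc)
        moreover have "0 \<le> \<bar>fourier f j\<bar> * \<bar>?V j\<bar>" by simp
        ultimately show "norm \<bar>fourier f j * ?V j\<bar> \<le> (fourier f j)\<^sup>2 + (?V j)\<^sup>2"
          unfolding real_norm_def abs_abs abs_mult by linarith
      qed
      have bs: "summable (\<lambda>j. ?K * (\<bar>?a j * ?V j\<bar> + \<bar>?b j * ?V j\<bar>))"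
        by (intro summable_mult summable_add abs_sum a_fun_L2 b_fun_L2)
      have int: "integrable ?M (\<lambda>s. ?h j s * ?V j)" for j
        using modal_integrable[of t "la j" "?a j" "?b j"] by simp
      have aes: "AE s in ?M. summable (\<lambda>j. norm (?h j s * ?V j))"
      proof (rule AE_I2)
        fix s assume "s \<in> space ?M"
        then have "s \<in> {0..t}" by simp
        then show "summable (\<lambda>j. norm (?h j s * ?V j))"
          by (intro summable_comparison_test'[OF bs]) (use hb in auto)
      qed
      have ints: "summable (\<lambda>j. LINT s|?M. norm (?h j s * ?V j))"
      proof (rule summable_comparison_test')
        show "summable (\<lambda>j. t * (?K * (\<bar>?a j * ?V j\<bar> + \<bar>?b j * ?V j\<bar>)))"
          by (rule summable_mult[OF bs])
        fix j
        have "\<bar>LINT s|?M. norm (?h j s * ?V j)\<bar> \<le> (t - 0) * (?K * (\<bar>?a j * ?V j\<bar> + \<bar>?b j * ?V j\<bar>))"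
          by (rule LINT_Icc_bound[OF integrable_norm[OF int] t]) (use hb in auto)
        then show "norm (LINT s|?M. norm (?h j s * ?V j)) \<le> t * (?K * (\<bar>?a j * ?V j\<bar> + \<bar>?b j * ?V j\<bar>))"
          by simp
      qed
      have inner: "L2_inner L (sg (t - s) (?f s)) v = (\<Sum>j. ?h j s * ?V j)" if "s \<in> space ?M" for s
      proof -
        have s: "s \<in> {0..t}" using that by simp
        then have "sg (t - s) (?f s) \<in> L2 L" by (intro sg_L2 forcing_L2) auto
        from sums_unique[OF Parseval_inner[OF this v]] show ?thesis by (simp only: cf[OF s])
      qed
      have "integrable ?M (\<lambda>s. L2_inner L (sg (t - s) (?f s)) v) = integrable ?M (\<lambda>s. (\<Sum>j. ?h j s * ?V j))"
        by (rule Bochner_Integration.integrable_cong[OF refl]) (rule inner)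
      then show "integrable ?M (\<lambda>s. L2_inner L (sg (t - s) (?f s)) v)"
        using integrable_suminf[OF int aes ints] by blast
      have "L2_inner L (\<lambda>x. state y0 t x - sg t y0 x) v = (\<Sum>j. (LINT s|?M. ?h j s) * ?V j)"
        using sums_unique[OF Parseval_inner[OF dL2 v]] by (simp only: cd)
      also have "\<dots> = (\<Sum>j. LINT s|?M. ?h j s * ?V j)" by simp
      also have "\<dots> = (LINT s|?M. (\<Sum>j. ?h j s * ?V j))"
        by (rule integral_suminf[OF int aes ints, symmetric])
      also have "\<dots> = (LINT s|?M. L2_inner L (sg (t - s) (?f s)) v)"
        by (rule Bochner_Integration.integral_cong[OF refl inner[symmetric]])
      finally show "L2_inner L (\<lambda>x. state y0 t x - sg t y0 x) v = (LINT s|?M. L2_inner L (sg (t - s) (?f s)) v)" .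
    qed
  qed
qed

end

section \<open>Decay of the closed loop\<close>

context spectral
begin

text \<open>The first entry is the rate proved for Z, the second half of the spectral gap of the
  uncontrolled modes; the half is what \<open>modal_decay\<close> requires.\<close>

definition rate :: real where "rate = min (1 / 2) (- la n / 2)"

lemma rate_pos: "0 < rate" and rate_half: "rate \<le> 1 / 2"
  and rate_tail: "n \<le> j \<Longrightarrow> 2 * rate \<le> - la j"
  using la_n_neg la_le[of n j] by (auto simp: rate_def)

end

context driven
begin

lemma mode_eq: "mode y0 j = modal (la j) (av (Suc j)) (bv (Suc j)) (fourier y0 j)"
  by (simp add: av_def bv_def fourier_def)

text \<open>These modes do not decay by themselves. Their decay is that of Z at time t - D,
  amplified by at most exp (l D) through the predictor formula.\<close>

lemma low_mode_decay:
  assumes F: "\<And>s. s \<ge> D \<Longrightarrow> \<bar>A s\<bar> \<le> F * exp (- s / 2)"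
    and Z: "\<And>s. s \<ge> D \<Longrightarrow> \<bar>zed l a b y s\<bar> \<le> F * exp (- s / 2)"
    and t: "2 * D \<le> t" and F0: "0 \<le> F" and l: "0 \<le> l"
  shows "\<bar>modal l a b y t\<bar> \<le> exp (l * D) * (F + \<bar>a * exp_int l (- D)\<bar> * F) * exp (- rate * (t - D))"
proof -
  let ?r = "t - D"
  have r: "D \<le> ?r" using t by simp
  have ex: "exp (- ?r / 2) \<le> exp (- rate * ?r)"
  proof -
    have "rate * ?r \<le> 1 / 2 * ?r" using rate_half r D_pos by (intro mult_right_mono) auto
    then show ?thesis unfolding exp_le_cancel_iff by linarith
  qed
  have "\<bar>zed l a b y ?r - a * exp_int l (- D) * A ?r\<bar> \<le> \<bar>zed l a b y ?r\<bar> + \<bar>a * exp_int l (- D)\<bar> * \<bar>A ?r\<bar>"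
    using abs_triangle_ineq4[of "zed l a b y ?r" "a * exp_int l (- D) * A ?r"] by (simp only: abs_mult)
  also have "\<dots> \<le> F * exp (- ?r / 2) + \<bar>a * exp_int l (- D)\<bar> * (F * exp (- ?r / 2))"
    by (intro add_mono mult_left_mono F Z r) auto
  also have "\<dots> = (F + \<bar>a * exp_int l (- D)\<bar> * F) * exp (- ?r / 2)" by (simp only: distrib_right mult.assoc)
  also have "\<dots> \<le> (F + \<bar>a * exp_int l (- D)\<bar> * F) * exp (- rate * ?r)"
    using F0 by (intro mult_left_mono ex add_nonneg_nonneg mult_nonneg_nonneg) auto
  finally have "exp (l * D) * \<bar>zed l a b y ?r - a * exp_int l (- D) * A ?r\<bar>
      \<le> exp (l * D) * ((F + \<bar>a * exp_int l (- D)\<bar> * F) * exp (- rate * ?r))" by (rule mult_left_mono) simp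
  then show ?thesis unfolding modal_late[OF t] abs_mult abs_exp_cancel by (simp only: mult.assoc)
qed

text \<open>The constants must be uniform in j and summable after weighting: the initial part uses
  the smoothing of exp (l t) from time 1 on, the forced part uses the factor 1 / |l| of
  \<open>modal_decay\<close>.\<close>

lemma tail_mode_decay:
  assumes F: "\<And>s. s \<ge> D \<Longrightarrow> \<bar>A s\<bar> \<le> F * exp (- s / 2)" "\<And>s. s \<ge> D \<Longrightarrow> \<bar>al s\<bar> \<le> F * exp (- s / 2)"
    and t: "2 * D \<le> t" "1 \<le> t" and F0: "0 \<le> F" and j: "n \<le> j"
  shows "(1 + \<bar>la j\<bar>) * (modal (la j) a b y t)\<^sup>2
    \<le> exp (- 2 * rate * t) * (2 * y\<^sup>2 + 16 * F\<^sup>2 * (1 / (la n)\<^sup>2 + 1 / \<bar>la n\<bar>) * exp (2 * rate * D) * (a\<^sup>2 + b\<^sup>2))"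
proof -
  let ?l = "la j"
  have l: "la j \<le> la n" "la n < 0" using la_le[OF j] la_n_neg by auto
  have F': "F * exp (- s / 2) \<le> F * exp (- rate * s)" if "s \<ge> D" for s
    using F0 rate_half that D_pos mult_right_mono[of rate "1/2" s] by (intro mult_left_mono) simp_all
  define P where "P = exp (?l * t) * \<bar>y\<bar>"
  define Q where "Q = 2 * F * (\<bar>a\<bar> + \<bar>b\<bar>) / \<bar>?l\<bar> * exp (- rate * (t - D))"
  have "\<bar>modal ?l a b y t\<bar> \<le> P + Q"
    unfolding P_def Q_def
    by (rule modal_decay[OF order_trans[OF F(1) F'] order_trans[OF F(2) F'] rate_pos rate_tail[OF j] t(1)]) auto
  then have "\<bar>modal ?l a b y t\<bar>\<^sup>2 \<le> (P + Q)\<^sup>2" by (intro power_mono) auto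
  also have "\<dots> \<le> 2 * P\<^sup>2 + 2 * Q\<^sup>2"
    using zero_le_power2[of "P - Q"] by (simp add: power2_eq_square algebra_simps)
  finally have "(1 + \<bar>?l\<bar>) * (modal ?l a b y t)\<^sup>2 \<le> (1 + \<bar>?l\<bar>) * (2 * P\<^sup>2 + 2 * Q\<^sup>2)"
    by (intro mult_left_mono) auto
  also have "\<dots> = 2 * ((1 + \<bar>?l\<bar>) * P\<^sup>2) + 2 * ((1 + \<bar>?l\<bar>) * Q\<^sup>2)" by (simp add: algebra_simps)
  finally have main: "(1 + \<bar>?l\<bar>) * (modal ?l a b y t)\<^sup>2 \<le> 2 * ((1 + \<bar>?l\<bar>) * P\<^sup>2) + 2 * ((1 + \<bar>?l\<bar>) * Q\<^sup>2)" .
  have P: "(1 + \<bar>?l\<bar>) * P\<^sup>2 \<le> exp (- 2 * rate * t) * y\<^sup>2"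
  proof -
    have al: "\<bar>?l\<bar> = - ?l" using l by simp
    \<comment> \<open>One of the two factors exp (l t) in P^2 absorbs the weight, which needs t
      \<ge> 1; the other supplies the decay.\<close>
    have "1 + \<bar>?l\<bar> \<le> exp (- ?l)" using exp_ge_add_one_self[of "- ?l"] al by simp
    also have "\<dots> \<le> exp (- ?l * t)" using t(2) l mult_left_mono[of 1 t "- ?l"] by simp
    finally have "(1 + \<bar>?l\<bar>) * P\<^sup>2 \<le> exp (- ?l * t) * P\<^sup>2" by (intro mult_right_mono) auto
    also have "\<dots> = exp (?l * t) * y\<^sup>2"
      by (simp add: P_def power2_eq_square exp_minus field_simps)
    also have "\<dots> \<le> exp (- 2 * rate * t) * y\<^sup>2"
      using rate_tail[OF j] t(2) mult_right_mono[of "2 * rate" "- ?l" t] by (intro mult_right_mono) simp_all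
    finally show ?thesis .
  qed
  have Q: "(1 + \<bar>?l\<bar>) * Q\<^sup>2 \<le> exp (- 2 * rate * t) * (8 * F\<^sup>2 * (1 / (la n)\<^sup>2 + 1 / \<bar>la n\<bar>) * exp (2 * rate * D) * (a\<^sup>2 + b\<^sup>2))"
  proof -
    \<comment> \<open>(1 + |l|) / l^2 decreases in |l|, so its value at the first stable eigenvalue
      serves for all tail modes.\<close>
    let ?\<kappa> = "1 / (la n)\<^sup>2 + 1 / \<bar>la n\<bar>"
    have abs_l: "\<bar>la n\<bar> \<le> \<bar>?l\<bar>" "0 < \<bar>la n\<bar>" using l by auto
    have "1 / \<bar>?l\<bar> \<le> 1 / \<bar>la n\<bar>" using abs_l by (intro divide_left_mono mult_pos_pos) auto
    moreover have "1 / ?l\<^sup>2 \<le> 1 / (la n)\<^sup>2"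
      using abs_l power_mono[of "\<bar>la n\<bar>" "\<bar>?l\<bar>" 2] l by (intro divide_left_mono mult_pos_pos) auto
    moreover have "(1 + \<bar>?l\<bar>) / ?l\<^sup>2 = 1 / ?l\<^sup>2 + 1 / \<bar>?l\<bar>"
    proof -
      have "(1 + x) / (x * x) = 1 / (x * x) + 1 / x" if "0 < x" for x :: real
        using that by (simp add: field_simps)
      moreover have "?l\<^sup>2 = \<bar>?l\<bar> * \<bar>?l\<bar>" by (simp add: power2_eq_square)
      moreover have "0 < \<bar>?l\<bar>" using l by simp
      ultimately show ?thesis by metis
    qed
    ultimately have \<kappa>: "(1 + \<bar>?l\<bar>) / ?l\<^sup>2 \<le> ?\<kappa>" by simp
    have regroup: "4 * f * (h * g) * (k * (2 * m)) = g * (8 * f * k * h * m)" for f g h k m :: real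
      by (simp add: algebra_simps)
    have ab: "(\<bar>a\<bar> + \<bar>b\<bar>)\<^sup>2 \<le> 2 * (a\<^sup>2 + b\<^sup>2)"
      using zero_le_power2[of "\<bar>a\<bar> - \<bar>b\<bar>"] by (simp add: power2_sum power2_diff)
    have "(exp (- rate * (t - D)))\<^sup>2 = exp (2 * rate * D) * exp (- 2 * rate * t)"
      by (simp add: power2_eq_square exp_add[symmetric] algebra_simps)
    then have "(1 + \<bar>?l\<bar>) * Q\<^sup>2 = 4 * F\<^sup>2 * (exp (2 * rate * D) * exp (- 2 * rate * t)) * (((1 + \<bar>?l\<bar>) / ?l\<^sup>2) * (\<bar>a\<bar> + \<bar>b\<bar>)\<^sup>2)"
      by (simp add: Q_def power_mult_distrib power_divide)
    also have "\<dots> \<le> 4 * F\<^sup>2 * (exp (2 * rate * D) * exp (- 2 * rate * t)) * (?\<kappa> * (2 * (a\<^sup>2 + b\<^sup>2)))"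
      by (intro mult_left_mono mult_mono \<kappa> ab) auto
    also have "\<dots> = exp (- 2 * rate * t) * (8 * F\<^sup>2 * ?\<kappa> * exp (2 * rate * D) * (a\<^sup>2 + b\<^sup>2))"
      by (rule regroup)
    finally show ?thesis .
  qed
  have collect: "2 * (g * q) + 2 * (g * (8 * f * k * h * m)) = g * (2 * q + 16 * f * k * h * m)" for f g h k m q :: real
    by (simp add: algebra_simps)
  have "2 * ((1 + \<bar>?l\<bar>) * P\<^sup>2) + 2 * ((1 + \<bar>?l\<bar>) * Q\<^sup>2)
      \<le> 2 * (exp (- 2 * rate * t) * y\<^sup>2)
        + 2 * (exp (- 2 * rate * t) * (8 * F\<^sup>2 * (1 / (la n)\<^sup>2 + 1 / \<bar>la n\<bar>) * exp (2 * rate * D) * (a\<^sup>2 + b\<^sup>2)))"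
    by (intro add_mono mult_left_mono P Q) auto
  also have "\<dots> = exp (- 2 * rate * t) * (2 * y\<^sup>2 + 16 * F\<^sup>2 * (1 / (la n)\<^sup>2 + 1 / \<bar>la n\<bar>) * exp (2 * rate * D) * (a\<^sup>2 + b\<^sup>2))"
    by (rule collect)
  finally show ?thesis using main by linarith
qed

text \<open>Every weighted square of a coefficient is at most exp (- 2 rate t) times a fixed
  summable sequence; summing and taking the root gives the norm.\<close>

lemma H1_decay:
  assumes F: "\<And>s. s \<ge> D \<Longrightarrow> \<bar>A s\<bar> \<le> F * exp (- s / 2)" "\<And>s. s \<ge> D \<Longrightarrow> \<bar>al s\<bar> \<le> F * exp (- s / 2)"
    and F0: "0 \<le> F"
    and Z: "\<And>j s. j < n \<Longrightarrow> s \<ge> D \<Longrightarrow> \<bar>zed (la j) (av (Suc j)) (bv (Suc j)) (fourier y0 j) s\<bar> \<le> F * exp (- s / 2)"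
    and y0: "y0 \<in> L2 L"
    and w: "\<And>t. 0 \<le> t \<Longrightarrow> w t \<in> L2 L" "\<And>t j. 0 \<le> t \<Longrightarrow> fourier (w t) j = mode y0 j t"
  shows "\<exists>C\<ge>0. \<forall>t. 2 * D \<le> t \<longrightarrow> 1 \<le> t \<longrightarrow> w t \<in> H1 L \<and> H1_norm L (w t) \<le> C * exp (- rate * t)"
proof -
  let ?a = "fourier (a_fun L c)" and ?b = "fourier (b_fun L)"
  define k where "k j = exp (la j * D) * (F + \<bar>?a j * exp_int (la j) (- D)\<bar> * F)" for j
  define \<kappa> where "\<kappa> = 16 * F\<^sup>2 * (1 / (la n)\<^sup>2 + 1 / \<bar>la n\<bar>) * exp (2 * rate * D)"
  \<comment> \<open>The unstable modes add only finitely many terms; the tail terms are summable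
    because the coefficients of y0, a and b are square summable.\<close>
  define H where "H j = (if j \<in> {..<n} then (1 + \<bar>la j\<bar>) * (k j)\<^sup>2 * exp (2 * rate * D) else 0)
      + (2 * (fourier y0 j)\<^sup>2 + \<kappa> * ((?a j)\<^sup>2 + (?b j)\<^sup>2))" for j
  have \<kappa>0: "0 \<le> \<kappa>" by (simp add: \<kappa>_def)
  have Hs: "summable H"
    unfolding H_def[abs_def]
    by (intro summable_add summable_mult fourier_square_summable y0 a_fun_L2 b_fun_L2 summable_If_finite_set) simp
  have H0: "0 \<le> H j" for j using \<kappa>0 by (auto simp: H_def intro!: add_nonneg_nonneg mult_nonneg_nonneg)
  have bnd: "(1 + \<bar>la j\<bar>) * (fourier (w t) j)\<^sup>2 \<le> exp (- 2 * rate * t) * H j" if t: "2 * D \<le> t" "1 \<le> t" for t j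
  proof (cases "j < n")
    case True
    have l: "0 \<le> la j"
    proof -
      have "Suc j \<in> {j. 1 \<le> j \<and> 0 \<le> lam j}" unfolding nonneg_indices using True by simp
      then show ?thesis by simp
    qed
    have "\<bar>mode y0 j t\<bar> \<le> k j * exp (- rate * (t - D))"
      unfolding k_def
      by (rule low_mode_decay[OF F(1) _ t(1) F0 l]) (use Z[OF True] in \<open>auto simp: av_def bv_def fourier_def\<close>)
    then have "\<bar>mode y0 j t\<bar>\<^sup>2 \<le> (k j * exp (- rate * (t - D)))\<^sup>2" by (intro power_mono) auto
    also have "\<dots> = exp (- 2 * rate * t) * ((k j)\<^sup>2 * exp (2 * rate * D))"
      by (simp add: power_mult_distrib power2_eq_square[of "exp _"] exp_add[symmetric] algebra_simps)
    finally have "(1 + \<bar>la j\<bar>) * (mode y0 j t)\<^sup>2 \<le> (1 + \<bar>la j\<bar>) * (exp (- 2 * rate * t) * ((k j)\<^sup>2 * exp (2 * rate * D)))"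
      by (intro mult_left_mono) auto
    also have "\<dots> = exp (- 2 * rate * t) * ((1 + \<bar>la j\<bar>) * (k j)\<^sup>2 * exp (2 * rate * D))" by (simp only: mult_ac)
    also have "\<dots> \<le> exp (- 2 * rate * t) * H j"
      using True \<kappa>0 by (intro mult_left_mono) (auto simp: H_def)
    finally show ?thesis using w(2) t D_pos by simp
  next
    case False
    then have "(1 + \<bar>la j\<bar>) * (mode y0 j t)\<^sup>2 \<le> exp (- 2 * rate * t) * (2 * (fourier y0 j)\<^sup>2 + \<kappa> * ((?a j)\<^sup>2 + (?b j)\<^sup>2))"
      unfolding \<kappa>_def by (intro tail_mode_decay F t F0) auto
    also have "\<dots> = exp (- 2 * rate * t) * H j" using False by (simp add: H_def)
    finally show ?thesis using w(2) t D_pos by simp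
  qed
  have "w t \<in> H1 L \<and> H1_norm L (w t) \<le> sqrt ((2 + c_bound) * suminf H) * exp (- rate * t)"
    if t: "2 * D \<le> t" "1 \<le> t" for t
  proof -
    have t0: "0 \<le> t" using t by simp
    have s: "summable (\<lambda>j. (1 + \<bar>la j\<bar>) * (fourier (w t) j)\<^sup>2)"
      by (rule summable_comparison_test'[OF summable_mult[OF Hs]]) (use bnd[OF t] in auto)
    have "(\<Sum>j. (1 + \<bar>la j\<bar>) * (fourier (w t) j)\<^sup>2) \<le> (\<Sum>j. exp (- 2 * rate * t) * H j)"
      by (intro suminf_le bnd t s summable_mult Hs)
    also have "\<dots> = exp (- 2 * rate * t) * suminf H" by (rule suminf_mult[OF Hs])
    finally have "(2 + c_bound) * (\<Sum>j. (1 + \<bar>la j\<bar>) * (fourier (w t) j)\<^sup>2) \<le> (2 + c_bound) * (exp (- 2 * rate * t) * suminf H)"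
      using c_bound(1) by (intro mult_left_mono) auto
    also have "\<dots> = ((2 + c_bound) * suminf H) * (exp (- rate * t))\<^sup>2"
      by (simp add: power2_eq_square exp_add[symmetric] algebra_simps)
    finally have "sqrt ((2 + c_bound) * (\<Sum>j. (1 + \<bar>la j\<bar>) * (fourier (w t) j)\<^sup>2)) \<le> sqrt (((2 + c_bound) * suminf H) * (exp (- rate * t))\<^sup>2)"
      by (rule real_sqrt_le_mono)
    also have "\<dots> = sqrt ((2 + c_bound) * suminf H) * exp (- rate * t)"
      by (simp add: real_sqrt_mult)
    finally show ?thesis using H1_norm_of_coeff[OF w(1)[OF t0] s] by linarith
  qed
  moreover have "0 \<le> sqrt ((2 + c_bound) * suminf H)"
    using c_bound(1) suminf_nonneg[OF Hs H0] by simp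
  ultimately show ?thesis by blast
qed

end

text \<open>The factor 2 lets the L^2 triangle inequalities for function and derivative suffice, and
  constants are immaterial for the decay.\<close>

lemma H1_norm_add_le:
  assumes "weak_deriv L f f'" "weak_deriv L g g'"
  shows "H1_norm L (\<lambda>x. f x + g x) \<le> 2 * H1_norm L f + 2 * H1_norm L g"
proof -
  have part: "L2_norm L u \<le> H1_norm L u" "L2_norm L u' \<le> H1_norm L u" if "weak_deriv L u u'" for u u'
    unfolding H1_norm_eq[OF that] by (auto intro!: real_le_rsqrt)
  have "H1_norm L (\<lambda>x. f x + g x) \<le> L2_norm L (\<lambda>x. f x + g x) + L2_norm L (\<lambda>x. f' x + g' x)"
    by (rule H1_norm_le_sum[OF weak_deriv_add[OF assms]])
  also have "\<dots> \<le> (L2_norm L f + L2_norm L g) + (L2_norm L f' + L2_norm L g')"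
    by (intro add_mono L2_norm_triangle weak_deriv_L2[OF assms(1)] weak_deriv_L2[OF assms(2)])
  finally show ?thesis using part[OF assms(1)] part[OF assms(2)] by linarith
qed

section \<open>Regularity of the feedback\<close>

lemma integrable_lebesgue_on_subset:
  fixes f :: "real \<Rightarrow> real"
  assumes "integrable (lebesgue_on {p..q}) f" "{p'..q'} \<subseteq> {p..q}"
  shows "integrable (lebesgue_on {p'..q'}) f"
proof -
  have "set_integrable lebesgue {p..q} f"
    using assms(1) unfolding set_integrable_def by (subst (asm) integrable_restrict_space) auto
  then have "set_integrable lebesgue {p'..q'} f"
    by (rule set_integrable_subset) (use assms(2) in auto)
  then show ?thesis
    unfolding set_integrable_def by (subst integrable_restrict_space) auto
qed

lemma integrable_continuous_mult:
  fixes f k :: "real \<Rightarrow> real"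
  assumes f: "integrable (lebesgue_on {p..q}) f" and k: "continuous_on UNIV k"
  shows "integrable (lebesgue_on {p..q}) (\<lambda>s. k s * f s)"
proof -
  have "bounded (k ` {p..q})"
    by (intro compact_imp_bounded compact_continuous_image continuous_on_subset[OF k]) auto
  then obtain M where M: "\<And>x. x \<in> {p..q} \<Longrightarrow> \<bar>k x\<bar> \<le> M"
    unfolding bounded_iff by (metis imageI real_norm_def)
  have [measurable]: "k \<in> borel_measurable (lebesgue_on {p..q})" "f \<in> borel_measurable (lebesgue_on {p..q})"
    using continuous_measurable_interval[OF k] f by auto
  show ?thesis
  proof (rule Bochner_Integration.integrable_bound[where f = "\<lambda>s. \<bar>M\<bar> * f s"])
    show "AE s in lebesgue_on {p..q}. norm (k s * f s) \<le> norm (\<bar>M\<bar> * f s)"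
    proof (rule AE_I2)
      fix s assume "s \<in> space (lebesgue_on {p..q})"
      then have "\<bar>k s\<bar> \<le> \<bar>M\<bar>" using M[of s] by simp
      then show "norm (k s * f s) \<le> norm (\<bar>M\<bar> * f s)" by (simp add: abs_mult mult_right_mono)
    qed
  qed (use f in simp_all)
qed

lemma integrable_shift:
  fixes f :: "real \<Rightarrow> real"
  assumes "integrable (lebesgue_on {p..q}) f"
  shows "integrable (lebesgue_on {p + d..q + d}) (\<lambda>s. f (s - d))"
proof -
  have "f absolutely_integrable_on {p..q}"
    using assms unfolding set_integrable_def by (subst (asm) integrable_restrict_space) auto
  then have "f integrable_on {p..q}" "(\<lambda>x. norm (f x)) integrable_on {p..q}"
    by (auto simp: absolutely_integrable_on_def)
  then have "(\<lambda>s. f (s + - d)) integrable_on {p - - d..q - - d}"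
    "(\<lambda>s. norm (f (s + - d))) integrable_on {p - - d..q - - d}"
    using integrable_shift_real_ivl_iff[of f "- d" p q]
      integrable_shift_real_ivl_iff[of "\<lambda>x. norm (f x)" "- d" p q] by auto
  then have "(\<lambda>s. f (s - d)) absolutely_integrable_on {p + d..q + d}"
    by (auto simp: absolutely_integrable_on_def)
  then show ?thesis unfolding set_integrable_def by (subst integrable_restrict_space) auto
qed

lemma indefinite_LINT_continuous:
  fixes h :: "real \<Rightarrow> real"
  assumes h: "integrable (lebesgue_on {p..T}) h"
  shows "continuous_on {p..T} (\<lambda>t. LINT s|lebesgue_on {p..t}. h s)"
proof -
  have "h integrable_on {p..T}" by (rule integrable_on_lebesgue_on[OF h]) simp
  then have "continuous_on {p..T} (\<lambda>t. integral {p..t} h)" by (rule indefinite_integral_continuous_1)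
  moreover have "integral {p..t} h = (LINT s|lebesgue_on {p..t}. h s)" if "t \<in> {p..T}" for t
    using that by (intro lebesgue_integral_eq_integral[symmetric] integrable_lebesgue_on_subset[OF h]) auto
  ultimately show ?thesis by (rule continuous_on_eq)
qed

lemma LINT_window_continuous:
  fixes h :: "real \<Rightarrow> real"
  assumes D: "0 < D" and h: "integrable (lebesgue_on {D..T}) h"
  shows "continuous_on {D..T} (\<lambda>t. LINT s|lebesgue_on {max (t - D) D..t}. h s)"
proof -
  let ?I = "\<lambda>t. LINT s|lebesgue_on {D..t}. h s"
  have c: "continuous_on {D..T} ?I" by (rule indefinite_LINT_continuous[OF h])
  have "continuous_on {D..T} (\<lambda>t. ?I t - ?I (max (t - D) D))"
    using D by (intro continuous_on_diff c continuous_on_compose2[OF c, of _ "\<lambda>t. max (t - D) D"] continuous_intros) auto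
  moreover have "?I t - ?I (max (t - D) D) = (LINT s|lebesgue_on {max (t - D) D..t}. h s)" if t: "t \<in> {D..T}" for t
  proof -
    let ?m = "max (t - D) D"
    have m: "D \<le> ?m" "?m \<le> t" using t D by auto
    have int: "integrable (lebesgue_on {p..q}) h" if "D \<le> p" "q \<le> t" for p q
      using that t by (intro integrable_lebesgue_on_subset[OF h]) auto
    have eq: "(LINT s|lebesgue_on {p..q}. h s) = integral {p..q} h" if "D \<le> p" "q \<le> t" for p q
      by (intro lebesgue_integral_eq_integral int that) simp
    have "integral {D..?m} h + integral {?m..t} h = integral {D..t} h"
      using m by (intro Henstock_Kurzweil_Integration.integral_combine integrable_on_lebesgue_on[OF int]) auto
    then show ?thesis using m by (simp add: eq)
  qed
  ultimately show ?thesis by (rule continuous_on_eq)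
qed

text \<open>The group law exp ((r - s) A_1) B_1 = exp (r A_1) exp (- s A_1) B_1 in row i. It
  separates the two time variables of the delay kernel.\<close>

lemma kap_add: "kap a b l i (r - s) = (if i = 0 then 1 else a i * exp_int (l i) r + exp (l i * r) * kap a b l i (- s))"
  using exp_int_add[of "l i" r "- s"] by (simp add: kap_def algebra_simps exp_add[symmetric] exp_minus exp_diff divide_inverse)

lemma kap_cont: "continuous_on UNIV (kap a b l i)"
proof -
  have "continuous_on UNIV (exp_int (l i))"
    by (intro continuous_at_imp_continuous_on ballI DERIV_isCont[OF exp_int_deriv])
  then show ?thesis unfolding kap_def[abs_def] by (cases "i = 0") (auto intro!: continuous_intros)
qed

text \<open>The kernel depends on t as well as on s. Once \<open>kap_add\<close> has factored out t,
  only integrals of fixed functions over a moving window remain.\<close>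

lemma delay_continuous:
  assumes D: "0 < D" and \<alpha>: "integrable (lebesgue_on {D..T}) \<alpha>"
  shows "continuous_on {D..T} (\<lambda>t. LINT s|lebesgue_on {max (t - D) D..t}. kap a b l i (t - D - s) * \<alpha> s)"
proof -
  let ?W = "\<lambda>h t. LINT s|lebesgue_on {max (t - D) D..t}. h s"
  let ?k = "\<lambda>s. kap a b l i (- s) * \<alpha> s"
  have ki: "integrable (lebesgue_on {D..T}) ?k"
    by (rule integrable_continuous_mult[OF \<alpha>]) (rule continuous_on_compose2[OF kap_cont], auto intro: continuous_intros)
  have c: "continuous_on {D..T} (?W \<alpha>)" "continuous_on {D..T} (?W ?k)"
    by (intro LINT_window_continuous D \<alpha> ki)+
  show ?thesis
  proof (cases "i = 0")
    case True
    then show ?thesis using c(1) by (simp add: kap_def)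
  next
    case False
    have Ec: "continuous_on {D..T} (\<lambda>t. exp_int (l i) (t - D))"
      by (rule continuous_on_compose2[of UNIV "exp_int (l i)"])
         (auto intro!: continuous_intros continuous_at_imp_continuous_on DERIV_isCont[OF exp_int_deriv])
    have cont: "continuous_on {D..T} (\<lambda>t. a i * exp_int (l i) (t - D) * ?W \<alpha> t + exp (l i * (t - D)) * ?W ?k t)"
      by (intro continuous_intros Ec c)
    have eq: "?W (\<lambda>s. kap a b l i (t - D - s) * \<alpha> s) t = a i * exp_int (l i) (t - D) * ?W \<alpha> t + exp (l i * (t - D)) * ?W ?k t"
      if t: "t \<in> {D..T}" for t
    proof -
      have sub: "{max (t - D) D..t} \<subseteq> {D..T}" using t by auto
      note int = integrable_lebesgue_on_subset[OF \<alpha> sub] integrable_lebesgue_on_subset[OF ki sub]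
      have "?W (\<lambda>s. kap a b l i (t - D - s) * \<alpha> s) t
          = ?W (\<lambda>s. (a i * exp_int (l i) (t - D)) * \<alpha> s + exp (l i * (t - D)) * ?k s) t"
        using kap_add[of a b l i "t - D"] False
        by (intro Bochner_Integration.integral_cong) (simp_all add: distrib_right)
      then show ?thesis using int by simp
    qed
    show ?thesis by (rule continuous_on_eq[OF cont]) (rule eq[symmetric])
  qed
qed

section \<open>Regularity, decay and existence for the closed loop\<close>

context spectral
begin

lemma feedback_value:
  assumes K: "K \<in> carrier_mat 1 (n + 1)"
  shows "(K *\<^sub>v X1 L e lam uD w t) $ 0 + (K *\<^sub>v delay_integral L D c e lam \<alpha> t) $ 0
    = (\<Sum>i<n + 1. K $$ (0, i) * ((if i = 0 then uD t else L2_inner L (w t) (e i))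
        + (LINT s|lebesgue_on {max (t - D) D..t}. kap av bv lam i (t - D - s) * \<alpha> s)))"
proof -
  have mv: "(K *\<^sub>v Matrix.vec (n + 1) f) $ 0 = (\<Sum>i<n + 1. K $$ (0, i) * f i)" for f
    using K by (simp add: scalar_prod_def lessThan_atLeast0)
  have "delay_integral L D c e lam \<alpha> t = Matrix.vec (n + 1)
      (\<lambda>i. LINT s|lebesgue_on {max (t - D) D..t}. kap av bv lam i (t - D - s) * \<alpha> s)"
    unfolding delay_integral_def A1_arrow B1_bcol mat_exp_bcol by (rule eq_vecI) auto
  then show ?thesis unfolding X1_def by (simp only: mv) (simp only: sum.distrib distrib_left)
qed

text \<open>Bootstrapping: integrability of \<open>\<alpha>\<close> already makes u_D, the modes and
  the delay integral continuous in t, hence also the right-hand side of the feedback law. The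
  maximum with D hides the jump.\<close>

lemma feedback_continuous:
  assumes D: "0 < D" and K: "K \<in> carrier_mat 1 (n + 1)"
    and \<alpha>: "\<And>t. integrable (lebesgue_on {- D..t}) \<alpha>"
    and uD: "\<And>t. 0 \<le> t \<Longrightarrow> uD t = (LINT s|lebesgue_on {0..t}. \<alpha> (s - D))"
    and w: "\<And>t. 0 \<le> t \<Longrightarrow> w t \<in> L2 L"
      "\<And>t. 0 \<le> t \<Longrightarrow> ((\<lambda>s. L2_norm L (\<lambda>x. w s x - w t x)) \<longlongrightarrow> 0) (at t within {0..})"
    and eq: "\<And>t. D \<le> t \<Longrightarrow> \<alpha> t = (K *\<^sub>v X1 L e lam uD w t) $ 0 + (K *\<^sub>v delay_integral L D c e lam \<alpha> t) $ 0"
  shows "continuous_on UNIV (\<lambda>s. \<alpha> (max s D))"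
proof -
  have wc: "continuous_on {0..} (\<lambda>t. L2_inner L (w t) (e i))" if "1 \<le> i" for i
    unfolding continuous_on_def
  proof
    fix t :: real assume t: "t \<in> {0..}"
    have "\<forall>\<^sub>F s in at t within {0..}. w s \<in> L2 L" by (auto simp: eventually_at_filter w(1))
    moreover have "e i \<in> L2 L" using E_L2[of "i - 1"] that by simp
    ultimately show "((\<lambda>t. L2_inner L (w t) (e i)) \<longlongrightarrow> L2_inner L (w t) (e i)) (at t within {0..})"
      using w t by (intro L2_inner_tendsto) auto
  qed
  have \<alpha>c: "continuous_on {D..T} \<alpha>" for T
  proof -
    have aD: "integrable (lebesgue_on {D..T}) \<alpha>"
      using D by (intro integrable_lebesgue_on_subset[OF \<alpha>[of T]]) auto
    have "continuous_on {0..T} (\<lambda>t. LINT s|lebesgue_on {0..t}. \<alpha> (s - D))"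
      using integrable_shift[OF \<alpha>[of "T - D"], of D] by (intro indefinite_LINT_continuous) simp
    then have "continuous_on {D..T} (\<lambda>t. LINT s|lebesgue_on {0..t}. \<alpha> (s - D))"
      by (rule continuous_on_subset) (use D in auto)
    then have uc: "continuous_on {D..T} uD" by (rule continuous_on_eq) (use uD D in auto)
    have xc: "continuous_on {D..T} (\<lambda>t. if i = 0 then uD t else L2_inner L (w t) (e i))" for i
    proof (cases "i = 0")
      case False
      then have "continuous_on {D..T} (\<lambda>t. L2_inner L (w t) (e i))"
        using D by (intro continuous_on_subset[OF wc[of i]]) auto
      then show ?thesis using False by simp
    qed (use uc in simp)
    have "continuous_on {D..T} (\<lambda>t. \<Sum>i<n + 1. K $$ (0, i) * ((if i = 0 then uD t else L2_inner L (w t) (e i))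
        + (LINT s|lebesgue_on {max (t - D) D..t}. kap av bv lam i (t - D - s) * \<alpha> s)))"
      by (intro continuous_on_sum continuous_on_mult continuous_on_const continuous_on_add xc delay_continuous D aD)
    then show ?thesis
    proof (rule continuous_on_eq)
      fix t assume "t \<in> {D..T}"
      then have "D \<le> t" by simp
      from eq[OF this] show "(\<Sum>i<n + 1. K $$ (0, i) * ((if i = 0 then uD t else L2_inner L (w t) (e i))
        + (LINT s|lebesgue_on {max (t - D) D..t}. kap av bv lam i (t - D - s) * \<alpha> s))) = \<alpha> t"
        unfolding feedback_value[OF K] ..
    qed
  qed
  show ?thesis
  proof (intro continuous_at_imp_continuous_on ballI)
    fix x :: real
    let ?T = "max x D + 1"
    have "continuous_on {..<?T} (\<lambda>s. \<alpha> (max s D))"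
      by (rule continuous_on_compose2[OF \<alpha>c[of ?T]]) (auto intro!: continuous_intros)
    then show "isCont (\<lambda>s. \<alpha> (max s D)) x"
      by (subst (asm) continuous_on_eq_continuous_at) auto
  qed
qed

lemma closed_loop_decay:
  assumes D: "0 < D" and adm: "admissible_gain L D c e lam K" and y0: "y0 \<in> L2 L"
    and sol: "closed_loop_solution L D c e lam K y0 u \<alpha> y"
  shows "\<exists>C>0. \<forall>\<^sub>F t in at_top. y t \<in> H1 L \<and> H1_norm L (y t) \<le> C * exp (- rate * t)"
proof -
  define uD where "uD t = u (t - D)" for t
  define w where "w t x = y t x - x / L * uD t" for t x
  have K: "K \<in> carrier_mat 1 (n + 1)" and cp: "char_poly (arrow n av lam + kcol D * K) = [:1, 1:] ^ (n + 1)"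
    using adm by (auto simp: admissible_iff)
  have \<alpha>: "\<And>t. integrable (lebesgue_on {- D..t}) \<alpha>"
    and uD: "\<And>t. 0 \<le> t \<Longrightarrow> uD t = (LINT s|lebesgue_on {0..t}. \<alpha> (s - D))"
    and mild: "mild_solution L c (\<lambda>t x. a_fun L c x * uD t + b_fun L x * \<alpha> (t - D)) y0 w"
    and \<alpha>0: "\<And>t. t < D \<Longrightarrow> \<alpha> t = 0"
    and eq: "\<And>t. D \<le> t \<Longrightarrow> \<alpha> t = (K *\<^sub>v X1 L e lam uD w t) $ 0 + (K *\<^sub>v delay_integral L D c e lam \<alpha> t) $ 0"
    using sol unfolding closed_loop_solution_def Let_def uD_def[abs_def] w_def[abs_def] by auto
  have w: "\<And>t. 0 \<le> t \<Longrightarrow> w t \<in> L2 L"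
    "\<And>t. 0 \<le> t \<Longrightarrow> ((\<lambda>s. L2_norm L (\<lambda>x. w s x - w t x)) \<longlongrightarrow> 0) (at t within {0..})"
    using mild by (auto simp: mild_solution_def)
  \<comment> \<open>Freezing the signal at its value in D before that time removes the jump and
    leaves it unchanged from D on.\<close>
  define al where "al s = \<alpha> (max s D)" for s
  have alc: "continuous_on UNIV al"
    unfolding al_def by (rule feedback_continuous[OF D K \<alpha> uD w eq])
  obtain A0 where A0: "\<And>t. (A0 has_real_derivative al t) (at t)" using antiderivative_on_line[OF alc] by blast
  define A where "A t = A0 t - A0 D" for t
  interpret driven L c e lam D al A
  proof unfold_locales
    show "(A has_real_derivative al t) (at t)" for t
      unfolding A_def by (rule DERIV_cong[OF DERIV_diff[OF A0 DERIV_const]]) simp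
  qed (auto simp: A_def alc D)
  have cut: "cut = \<alpha>" using \<alpha>0 by (auto simp: cut_def al_def fun_eq_iff)
  have uu: "uu t = uD t" if "0 \<le> t" for t using uD[OF that] by (simp add: uu_eq_LINT cut)
  have wm: "fourier (w t) j = mode y0 j t" if t: "0 \<le> t" for t j
  proof -
    have "(LINT s|lebesgue_on {0..t}. exp (la j * (t - s)) * (fourier (a_fun L c) j * uD s + fourier (b_fun L) j * \<alpha> (s - D)))
        = (LINT s|lebesgue_on {0..t}. exp (la j * (t - s)) * (fourier (a_fun L c) j * uu s + fourier (b_fun L) j * cut (s - D)))"
      by (rule Bochner_Integration.integral_cong[OF refl]) (simp add: uu cut)
    then show ?thesis unfolding modal_eq_LINT mild_solution_fourier[OF mild y0 t] by simp
  qed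
  \<comment> \<open>The Artstein transform of the full vector: its entry 0 belongs to u_D and
    reduces to the primitive \<open>A\<close>.\<close>
  define Z where "Z i = (if i = 0 then A else zed (lam i) (av i) (bv i) (fourier y0 (i - 1)))" for i
  have sumZ: "al t = (\<Sum>i<n + 1. K $$ (0, i) * Z i t)" if t: "D \<le> t" for t
  proof -
    have "al t = (\<Sum>i<n + 1. K $$ (0, i) * ((if i = 0 then uD t else L2_inner L (w t) (e i))
        + (LINT s|lebesgue_on {max (t - D) D..t}. kap av bv lam i (t - D - s) * \<alpha> s)))"
      using eq[OF t] t unfolding feedback_value[OF K] by (simp add: al_def)
    also have "\<dots> = (\<Sum>i<n + 1. K $$ (0, i) * Z i t)"
    proof (rule sum.cong[OF refl])
      fix i
      have t0: "0 \<le> t" using t D by simp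
      show "K $$ (0, i) * ((if i = 0 then uD t else L2_inner L (w t) (e i))
        + (LINT s|lebesgue_on {max (t - D) D..t}. kap av bv lam i (t - D - s) * \<alpha> s)) = K $$ (0, i) * Z i t"
      proof (cases i)
        case 0
        then show ?thesis using delay_eq_zed_0[OF t] uu[OF t0] by (simp add: kap_def Z_def cut)
      next
        case (Suc j)
        have "L2_inner L (w t) (e i) = mode y0 j t" using wm[OF t0, of j] Suc by (simp add: fourier_def)
        then show ?thesis using delay_eq_zed[OF t, of "av i" "lam i" "bv i" "fourier y0 j"] Suc
          by (simp add: kap_def Z_def cut mode_eq)
      qed
    qed
    finally show ?thesis .
  qed
  have M: "arrow n av lam + kcol D * K \<in> carrier_mat (n + 1) (n + 1)" using K by (auto simp: kcol_def)
  have "(Z i has_real_derivative (\<Sum>j<n + 1. (arrow n av lam + kcol D * K) $$ (i, j) * Z j t)) (at t within {D..})"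
    if i: "i < n + 1" and t: "t \<ge> D" for i t
  proof -
    have "(Z i has_real_derivative (if i = 0 then 0 else av i * Z 0 t + lam i * Z i t) + kap av bv lam i (- D) * al t) (at t)"
    proof (cases "i = 0")
      case True
      then show ?thesis using A_deriv by (simp add: Z_def kap_def)
    next
      case False
      then show ?thesis
        using zed_deriv[of "lam i" "av i" "bv i" "fourier y0 (i - 1)" t]
        by (simp add: Z_def kap_def add.commute)
    qed
    then show ?thesis
      unfolding feedback_row[OF K i] sumZ[OF t] by (rule has_field_derivative_at_within)
  qed
  then have "\<exists>C. \<forall>i<n + 1. \<forall>t\<ge>D. \<bar>Z i t\<bar> \<le> C * exp (- t / 2)" by (rule stable_decay[OF M cp])
  then obtain C where "\<forall>i<n + 1. \<forall>t\<ge>D. \<bar>Z i t\<bar> \<le> C * exp (- t / 2)" ..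
  then have C: "\<bar>Z i t\<bar> \<le> C * exp (- t / 2)" if "i < n + 1" "t \<ge> D" for i t using that by blast
  \<comment> \<open>One constant for all components of Z and for the control, which is the row K
    applied to Z.\<close>
  define F where "F = \<bar>C\<bar> * (1 + (\<Sum>i<n + 1. \<bar>K $$ (0, i)\<bar>))"
  have sK: "0 \<le> (\<Sum>i<n + 1. \<bar>K $$ (0, i)\<bar>)" by (rule sum_nonneg) simp
  have F0: "0 \<le> F" using sK by (simp add: F_def)
  have ZF: "\<bar>Z i t\<bar> \<le> F * exp (- t / 2)" if "i < n + 1" "D \<le> t" for i t
  proof -
    have "C \<le> F" using sK mult_left_mono[of 1 "1 + (\<Sum>i<n + 1. \<bar>K $$ (0, i)\<bar>)" "\<bar>C\<bar>"] by (simp add: F_def)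
    then have "C * exp (- t / 2) \<le> F * exp (- t / 2)" by (rule mult_right_mono) simp
    then show ?thesis using C[OF that] by linarith
  qed
  have AF: "\<bar>A s\<bar> \<le> F * exp (- s / 2)" if "s \<ge> D" for s using ZF[of 0 s] that by (simp add: Z_def)
  have alF: "\<bar>al s\<bar> \<le> F * exp (- s / 2)" if s: "s \<ge> D" for s
  proof -
    have "\<bar>al s\<bar> \<le> (\<Sum>i<n + 1. \<bar>K $$ (0, i)\<bar> * \<bar>Z i s\<bar>)"
      unfolding sumZ[OF s] by (rule order_trans[OF sum_abs]) (simp add: abs_mult)
    also have "\<dots> \<le> (\<Sum>i<n + 1. \<bar>K $$ (0, i)\<bar> * (\<bar>C\<bar> * exp (- s / 2)))"
    proof (intro sum_mono mult_left_mono)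
      fix i assume "i \<in> {..<n + 1}"
      then have "\<bar>Z i s\<bar> \<le> C * exp (- s / 2)" using C s by simp
      also have "\<dots> \<le> \<bar>C\<bar> * exp (- s / 2)" by (intro mult_right_mono) auto
      finally show "\<bar>Z i s\<bar> \<le> \<bar>C\<bar> * exp (- s / 2)" .
    qed simp
    also have "\<dots> = (\<bar>C\<bar> * (\<Sum>i<n + 1. \<bar>K $$ (0, i)\<bar>)) * exp (- s / 2)"
      by (simp only: sum_distrib_right[symmetric]) (simp only: mult_ac)
    also have "\<dots> \<le> F * exp (- s / 2)" by (intro mult_right_mono) (auto simp: F_def distrib_left)
    finally show ?thesis .
  qed
  have zF: "\<bar>zed (la j) (av (Suc j)) (bv (Suc j)) (fourier y0 j) s\<bar> \<le> F * exp (- s / 2)" if "j < n" "s \<ge> D" for j s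
    using ZF[of "Suc j" s] that by (simp add: Z_def)
  obtain C1 where C1: "0 \<le> C1" "\<And>t. 2 * D \<le> t \<Longrightarrow> 1 \<le> t \<Longrightarrow> w t \<in> H1 L \<and> H1_norm L (w t) \<le> C1 * exp (- rate * t)"
    using H1_decay[OF AF alF F0 zF y0 w(1) wm] by blast
  have lin: "weak_deriv L (\<lambda>x. q * x) (\<lambda>x. q)" for q
    by (rule weak_deriv_C1[OF L_pos]) (auto intro!: derivative_eq_intros)
  define N where "N = L2_norm L (\<lambda>x. x) + L2_norm L (\<lambda>x. 1)"
  have N0: "0 \<le> N" by (simp add: N_def)
  have linN: "H1_norm L (\<lambda>x. q * x) \<le> \<bar>q\<bar> * N" for q
    using H1_norm_le_sum[OF lin[of q]] L2_norm_scale[of L q "\<lambda>x. x"] L2_norm_scale[of L q "\<lambda>x. 1"]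
    by (simp add: N_def distrib_left)
  \<comment> \<open>For the lifting x / L times u_D: u_D at time t is \<open>A\<close> at t - D,
    whence the factor exp (D / 2), and \<open>N\<close> bounds the H^1 norm of x.\<close>
  define C2 where "C2 = F * exp (D / 2) / L * N"
  have bound: "y t \<in> H1 L \<and> H1_norm L (y t) \<le> (2 * C1 + 2 * C2 + 1) * exp (- rate * t)"
    if t: "2 * D \<le> t" "1 \<le> t" for t
  proof -
    have t0: "0 \<le> t" using t by simp
    obtain w' where w': "weak_deriv L (w t) w'" using C1(2)[OF t] by (auto simp: H1_def)
    have y: "y t = (\<lambda>x. w t x + (uD t / L) * x)" by (simp add: w_def)
    have yH: "y t \<in> H1 L" unfolding y by (rule weak_deriv_H1[OF weak_deriv_add[OF w' lin]])
    have "\<bar>uD t\<bar> = \<bar>A (t - D)\<bar>" using uu[OF t0] t by (simp add: uu_def)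
    also have "\<dots> \<le> F * exp (- (t - D) / 2)" using t by (intro AF) simp
    also have "\<dots> = F * exp (D / 2) * exp (- t / 2)"
      by (simp add: exp_add[symmetric] diff_divide_distrib)
    also have "\<dots> \<le> F * exp (D / 2) * exp (- rate * t)"
      using F0 rate_half t0 mult_right_mono[of rate "1/2" t] by (intro mult_left_mono) simp_all
    finally have u: "\<bar>uD t / L\<bar> \<le> F * exp (D / 2) / L * exp (- rate * t)"
      using L_pos by (simp add: abs_divide divide_right_mono)
    have "H1_norm L (\<lambda>x. (uD t / L) * x) \<le> (F * exp (D / 2) / L * exp (- rate * t)) * N"
      by (rule order_trans[OF linN mult_right_mono[OF u N0]])
    then have u2: "H1_norm L (\<lambda>x. (uD t / L) * x) \<le> C2 * exp (- rate * t)" by (simp add: C2_def mult_ac)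
    have "H1_norm L (y t) \<le> 2 * H1_norm L (w t) + 2 * H1_norm L (\<lambda>x. (uD t / L) * x)"
      unfolding y by (rule H1_norm_add_le[OF w' lin])
    also have "\<dots> \<le> 2 * (C1 * exp (- rate * t)) + 2 * (C2 * exp (- rate * t))"
      using C1(2)[OF t] u2 by linarith
    also have "\<dots> \<le> (2 * C1 + 2 * C2 + 1) * exp (- rate * t)" by (simp add: algebra_simps)
    finally show ?thesis using yH by blast
  qed
  have "0 \<le> C2" using F0 N0 L_pos by (simp add: C2_def)
  then have "0 < 2 * C1 + 2 * C2 + 1" using C1(1) by simp
  moreover have "\<forall>\<^sub>F t in at_top. y t \<in> H1 L \<and> H1_norm L (y t) \<le> (2 * C1 + 2 * C2 + 1) * exp (- rate * t)"
    \<comment> \<open>The predictor formula holds from 2 D on, the smoothing estimate from 1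
      on.\<close>
    using eventually_ge_at_top[of "max (2 * D) 1"] by eventually_elim (rule bound, auto)
  ultimately show ?thesis by blast
qed

text \<open>The feedback law is implicit in the control, but in terms of Z it is the explicit linear
  equation without delay. Solving that first and setting the control to K Z avoids a fixed point
  argument; it remains to see that Z is the transform of the state this control produces.\<close>

lemma closed_loop_exists:
  assumes D: "0 < D" and adm: "admissible_gain L D c e lam K" and y0: "y0 \<in> L2 L"
  shows "\<exists>u \<alpha> y. closed_loop_solution L D c e lam K y0 u \<alpha> y"
proof -
  have K: "K \<in> carrier_mat 1 (n + 1)" and cp: "char_poly (arrow n av lam + kcol D * K) = [:1, 1:] ^ (n + 1)"
    using adm by (auto simp: admissible_iff)
  have M: "arrow n av lam + kcol D * K \<in> carrier_mat (n + 1) (n + 1)" using K by (auto simp: kcol_def)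
  \<comment> \<open>The values the transform must have at time D, according to \<open>zed_D\<close>
    and \<open>A D = 0\<close>: free evolution of the modes, and no control issued so far.\<close>
  obtain Z where Z0: "\<And>i. i < n + 1 \<Longrightarrow> Z i D = (if i = 0 then 0 else exp (lam i * D) * fourier y0 (i - 1))"
    and Zd: "\<And>i t. i < n + 1 \<Longrightarrow> (Z i has_real_derivative (\<Sum>j<n + 1. (arrow n av lam + kcol D * K) $$ (i, j) * Z j t)) (at t)"
    using stable_solution[OF M cp, of D "\<lambda>i. if i = 0 then 0 else exp (lam i * D) * fourier y0 (i - 1)"] by blast
  define al where "al t = (\<Sum>i<n + 1. K $$ (0, i) * Z i t)" for t
  have Zd': "(Z i has_real_derivative (if i = 0 then 0 else av i * Z 0 t + lam i * Z i t) + kap av bv lam i (- D) * al t) (at t)"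
    if "i < n + 1" for i t
    using Zd[OF that, of t] unfolding feedback_row[OF K that] al_def .
  have "continuous_on UNIV (Z i)" if "i < n + 1" for i
    using Zd[OF that] by (intro continuous_at_imp_continuous_on ballI DERIV_isCont)
  then have alc: "continuous_on UNIV al"
    unfolding al_def by (intro continuous_intros) auto
  interpret driven L c e lam D al "Z 0"
  proof unfold_locales
    show "(Z 0 has_real_derivative al t) (at t)" for t using Zd'[of 0 t] by (simp add: kap_def)
    show "Z 0 D = 0" using Z0[of 0] by simp
  qed (auto simp: alc D)
  \<comment> \<open>Both sides solve the same scalar equation with inputs \<open>Z 0\<close> and
    \<open>al\<close> and agree at D, so the difference times exp (- lam i t) is constant and
    zero.\<close>
  have Zz: "Z i t = zed (lam i) (av i) (bv i) (fourier y0 (i - 1)) t" if i: "i < n + 1" "i \<noteq> 0" for i t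
  proof -
    let ?z = "zed (lam i) (av i) (bv i) (fourier y0 (i - 1))"
    define \<delta> where "\<delta> t = exp (- lam i * t) * (Z i t - ?z t)" for t
    have zd: "(?z has_real_derivative av i * Z 0 t + lam i * ?z t + kap av bv lam i (- D) * al t) (at t)" for t
      using zed_deriv[of "lam i" "av i" "bv i" "fourier y0 (i - 1)" t] i by (simp add: kap_def add.commute)
    have Zi: "(Z i has_real_derivative av i * Z 0 t + lam i * Z i t + kap av bv lam i (- D) * al t) (at t)" for t
      using Zd'[OF i(1), of t] i(2) by simp
    have "(\<delta> has_real_derivative 0) (at t)" for t
    proof -
      have "(\<delta> has_real_derivative exp (- lam i * t) * (- lam i) * (Z i t - ?z t)
          + (av i * Z 0 t + lam i * Z i t + kap av bv lam i (- D) * al t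
             - (av i * Z 0 t + lam i * ?z t + kap av bv lam i (- D) * al t)) * exp (- lam i * t)) (at t)"
        unfolding \<delta>_def
        by (intro DERIV_mult DERIV_diff Zi zd) (auto intro!: derivative_eq_intros)
      then show ?thesis by (rule DERIV_cong) (simp add: algebra_simps)
    qed
    then have "\<delta> t = \<delta> D" by (intro DERIV_isconst_all) auto
    also have "\<delta> D = 0" using Z0[OF i(1)] i(2) by (simp add: \<delta>_def zed_D)
    finally show ?thesis by (simp add: \<delta>_def)
  qed
  define y where "y t x = state y0 t x + x / L * uu t" for t x
  \<comment> \<open>The shift by D in the control undoes u_D(t) = u(t - D).\<close>
  have "closed_loop_solution L D c e lam K y0 (\<lambda>s. uu (s + D)) cut y"
    unfolding closed_loop_solution_def Let_def
  proof (intro conjI allI impI)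
    have uD: "(\<lambda>t. uu (t - D + D)) = uu" by simp
    have w: "(\<lambda>t x. y t x - x / L * uu (t - D + D)) = state y0" by (simp add: y_def fun_eq_iff)
    show "integrable (lebesgue_on {- D..t}) cut" for t by (rule cut_integrable)
    show "uu (t - D + D) = (LINT s|lebesgue_on {0..t}. cut (s - D))" for t by (simp add: uu_eq_LINT)
    show "mild_solution L c (\<lambda>t x. a_fun L c x * uu (t - D + D) + b_fun L x * cut (t - D)) y0
        (\<lambda>t x. y t x - x / L * uu (t - D + D))"
      unfolding w using state_mild[OF y0] by simp
    fix t
    have "cut t = (\<Sum>i<n + 1. K $$ (0, i) * ((if i = 0 then uu t else L2_inner L (state y0 t) (e i))
        + (LINT s|lebesgue_on {max (t - D) D..t}. kap av bv lam i (t - D - s) * cut s)))" if t: "D \<le> t"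
    proof -
      have "cut t = (\<Sum>i<n + 1. K $$ (0, i) * Z i t)" using t by (simp add: cut_def al_def)
      also have "\<dots> = (\<Sum>i<n + 1. K $$ (0, i) * ((if i = 0 then uu t else L2_inner L (state y0 t) (e i))
        + (LINT s|lebesgue_on {max (t - D) D..t}. kap av bv lam i (t - D - s) * cut s)))"
      proof (rule sum.cong[OF refl])
        fix i assume i: "i \<in> {..<n + 1}"
        have t0: "0 \<le> t" using t D by simp
        show "K $$ (0, i) * Z i t = K $$ (0, i) * ((if i = 0 then uu t else L2_inner L (state y0 t) (e i))
          + (LINT s|lebesgue_on {max (t - D) D..t}. kap av bv lam i (t - D - s) * cut s))"
        proof (cases i)
          case 0
          then show ?thesis using delay_eq_zed_0[OF t] by (simp add: kap_def)
        next
          case (Suc j)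
          have "L2_inner L (state y0 t) (e i) = mode y0 j t"
            using state(2)[OF y0 t0, of j] Suc by (simp add: fourier_def)
          then show ?thesis using delay_eq_zed[OF t, of "av i" "lam i" "bv i" "fourier y0 j"] Suc i Zz[of i t]
            by (simp add: kap_def mode_eq)
        qed
      qed
      finally show ?thesis .
    qed
    then show "cut t = (if t < D then 0 else (K *\<^sub>v X1 L e lam (\<lambda>t. uu (t - D + D)) (\<lambda>t x. y t x - x / L * uu (t - D + D)) t) $ 0
        + (K *\<^sub>v delay_integral L D c e lam cut t) $ 0)"
      unfolding w uD feedback_value[OF K] by (simp add: cut_def)
  qed
  then show ?thesis by blast
qed

end

theorem theorem1:
  fixes L D :: real and c :: "real \<Rightarrow> real"
    and e :: "nat \<Rightarrow> real \<Rightarrow> real" and lam :: "nat \<Rightarrow> real"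
  assumes "L > 0" and "D > 0" and "c \<in> L_infty L"
    and "hilbert_basis L e"
    and "\<And>j. j \<ge> 1 \<Longrightarrow> A_graph L c (e j) (\<lambda>x. lam j * e j x)"
    and "\<And>j. j \<ge> 1 \<Longrightarrow> lam (Suc j) < lam j"
    and "filterlim lam at_bot sequentially"
  shows "(\<exists>K1. admissible_gain L D c e lam K1) \<and>
    (\<forall>K1. admissible_gain L D c e lam K1 \<longrightarrow>
      (\<exists>\<mu>>0. \<forall>y0\<in>L2 L.
        (\<exists>u \<alpha> y. closed_loop_solution L D c e lam K1 y0 u \<alpha> y) \<and>
        (\<forall>u \<alpha> y. closed_loop_solution L D c e lam K1 y0 u \<alpha> y \<longrightarrow>
          (\<exists>C>0. \<forall>\<^sub>F t in at_top. y t \<in> H1 L \<and> H1_norm L (y t) \<le> C * exp (- \<mu> * t)))))"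
proof -
  interpret spectral L c e lam
    by unfold_locales (use assms in auto)
  \<comment> \<open>The exponent is \<open>rate\<close>. It depends only on the eigenvalues, so it
    can be fixed before the initial state.\<close>
  show ?thesis
    using gain_exists rate_pos closed_loop_exists[OF \<open>D > 0\<close>] closed_loop_decay[OF \<open>D > 0\<close>] by blast
qed

end
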